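(* Let $n\ge 1$. As an algebra over the field $F_\Lambda$, the algebra $B_{I_2(2n+1)}(m,l)$ is semisimple. Moreover the set $\Sigma=\Sigma_1\cup\Sigma_2$, where $$\Sigma_1=\{[\ldots X_0X_1]_{l_1}E_0[X_1X_0\ldots]_{l_2}\mid 0\le l_1\le 2n,\ 0\le l_2\le 2n\},$$ $$\Sigma_2=\{[X_1X_0\ldots]_i\mid 0\le i\le 2n\}\cup\{[X_0X_1\ldots]_j\mid 1\le j\le 2n+1\},$$ is a basis of $B_{I_2(2n+1)}(m,l)$, and thus $\dim_{F_\Lambda}B_{I_2(2n+1)}(m,l)=2(2n+1)+(2n+1)^2$.
   Context: Notation: $F_\Lambda=\mathbb{Q}(m,l)$ with independent variables $m,l$ and $\tau=\frac{l-l^{-1}}{m}+1$. $[AB\ldots]_N$ is the alternating word of length $N$ in $A,B$ beginning with $A$; $[\ldots AB]_N$ is the alternating word of length $N$ ending with $B$; words of length $0$ are $1$. $B_{I_2(2n+1)}(m,l)$ is the unital associative $F_\Lambda$-algebra generated by invertible elements $X_0,X_1$ and elements $E_0,E_1$ with relations: (1) $[X_0X_1\ldots]_{2n+1}=[X_1X_0\ldots]_{2n+1}$; (2) $X_i-X_i^{-1}=m(E_i-1)$; (3) $X_iE_i=E_iX_i=lE_i$; (4) $E_i^2=\tau E_i$ (for $i=0,1$ in (2)-(4)); (5) $E_0[X_1X_0\ldots]_{2i-1}E_0=l^{-1}E_0$; (6) $E_1[X_0X_1\ldots]_{2i-1}E_1=l^{-1}E_1$; (7) $E_0[X_1^{-1}X_0^{-1}\ldots]_{2i-1}E_0=lE_0$;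 (8) $E_1[X_0^{-1}X_1^{-1}\ldots]_{2i-1}E_1=lE_1$ (for $1\le i\le n$ in (5)-(8)); (9) $[X_0X_1\ldots]_{2n}E_0=E_1[X_0X_1\ldots]_{2n}$; (10) $E_0[X_1X_0\ldots]_{2n}=[X_1X_0\ldots]_{2n}E_1$. *)

theory Defs
  imports
    "Jordan_Normal_Form.VS_Connect"
    "HOL-Library.Poly_Mapping"
    "HOL-Computational_Algebra.Fraction_Field"
    "HOL-Algebra.QuotRing"
    "HOL-Algebra.Generated_Groups"
begin

text \<open>The field \<open>\<rat>(m, l)\<close>, realised as \<open>Frac (\<rat>[l][m])\<close>.\<close>

type_synonym ratfun = "rat poly poly fract"

definition par_m :: ratfun where
  "par_m = Fract [:0, 1:] 1"

definition par_l :: ratfun where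
  "par_l = Fract [:[:0, 1:]:] 1"

definition tau :: ratfun where
  "tau = (par_l - inverse par_l) / par_m + 1"


text \<open>
  The free unital associative algebra on a set of letters is the monoid algebra of the free monoid.
  The multiplication of \<^type>\<open>poly_mapping\<close> is convolution over an additively written (not
  necessarily commutative) monoid, so concatenation of words is written \<open>+\<close> here.
\<close>

datatype 'g word = Word (letters: "'g list")

instantiation word :: (type) monoid_add
begin

definition zero_word :: "'a word" where
  "0 = Word []"

definition plus_word :: "'a word \<Rightarrow> 'a word \<Rightarrow> 'a word" where
  "u + v = Word (letters u @ letters v)"

instance
  by standard (simp_all add: zero_word_def plus_word_def)

end

text \<open>\<open>Xinv i\<close> is a separate letter, made inverse to \<open>X i\<close> by relations.\<close>

datatype node = N0 | N1

datatype letter = X node | Xinv node | E node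

type_synonym free_alg = "letter word \<Rightarrow>\<^sub>0 ratfun"

definition gen :: "letter \<Rightarrow> free_alg" where
  "gen g = Poly_Mapping.single (Word [g]) 1"

definition scalar :: "ratfun \<Rightarrow> free_alg" where
  "scalar c = Poly_Mapping.single 0 c"

text \<open>
  \<open>alt_from N a b\<close> is \<open>a b a \<dots>\<close> and \<open>alt_to N a b\<close> is \<open>\<dots> b a b\<close>, each with \<open>N\<close> factors.
\<close>

fun alt_from :: "nat \<Rightarrow> 'a::monoid_mult \<Rightarrow> 'a \<Rightarrow> 'a" where
  "alt_from 0 a b = 1"
| "alt_from (Suc N) a b = a * alt_from N b a"

fun alt_to :: "nat \<Rightarrow> 'a::monoid_mult \<Rightarrow> 'a \<Rightarrow> 'a" where
  "alt_to 0 a b = 1"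
| "alt_to (Suc N) a b = alt_to N b a * b"

abbreviation "X0 \<equiv> gen (X N0)"
abbreviation "X1 \<equiv> gen (X N1)"
abbreviation "Y0 \<equiv> gen (Xinv N0)"
abbreviation "Y1 \<equiv> gen (Xinv N1)"
abbreviation "E0 \<equiv> gen (E N0)"
abbreviation "E1 \<equiv> gen (E N1)"

inductive B_rel :: "nat \<Rightarrow> free_alg \<Rightarrow> free_alg \<Rightarrow> bool" for n :: nat where
  inv_right: "B_rel n (gen (X i) * gen (Xinv i)) 1"
| inv_left: "B_rel n (gen (Xinv i) * gen (X i)) 1"
| braid: "B_rel n (alt_from (2 * n + 1) X0 X1) (alt_from (2 * n + 1) X1 X0)"
| skein: "B_rel n (gen (X i) - gen (Xinv i)) (scalar par_m * (gen (E i) - 1))"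
| absorb_left: "B_rel n (gen (X i) * gen (E i)) (scalar par_l * gen (E i))"
| absorb_right: "B_rel n (gen (E i) * gen (X i)) (scalar par_l * gen (E i))"
| square: "B_rel n (gen (E i) * gen (E i)) (scalar tau * gen (E i))"
| sandwich0: "1 \<le> i \<Longrightarrow> i \<le> n \<Longrightarrow>
    B_rel n (E0 * alt_from (2 * i - 1) X1 X0 * E0) (scalar (inverse par_l) * E0)"
| sandwich1: "1 \<le> i \<Longrightarrow> i \<le> n \<Longrightarrow>
    B_rel n (E1 * alt_from (2 * i - 1) X0 X1 * E1) (scalar (inverse par_l) * E1)"
| sandwich_inv0: "1 \<le> i \<Longrightarrow> i \<le> n \<Longrightarrow>
    B_rel n (E0 * alt_from (2 * i - 1) Y1 Y0 * E0) (scalar par_l * E0)"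
| sandwich_inv1: "1 \<le> i \<Longrightarrow> i \<le> n \<Longrightarrow>
    B_rel n (E1 * alt_from (2 * i - 1) Y0 Y1 * E1) (scalar par_l * E1)"
| swap0: "B_rel n (alt_from (2 * n) X0 X1 * E0) (E1 * alt_from (2 * n) X0 X1)"
| swap1: "B_rel n (E0 * alt_from (2 * n) X1 X0) (alt_from (2 * n) X1 X0 * E1)"

abbreviation FA :: "free_alg ring" where
  "FA \<equiv> class_ring"

definition B_ideal :: "nat \<Rightarrow> free_alg set" where
  "B_ideal n = genideal FA {a - b | a b. B_rel n a b}"

definition B_proj :: "nat \<Rightarrow> free_alg \<Rightarrow> free_alg set" where
  "B_proj n a = a_r_coset FA (B_ideal n) a"

definition B_alg :: "nat \<Rightarrow> (ratfun, free_alg set) module" where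
  "B_alg n =
    (let Q = FactRing FA (B_ideal n) in
     \<lparr>carrier = carrier Q, mult = mult Q, one = one Q, zero = zero Q, add = add Q,
      smult = (\<lambda>c A. mult Q (B_proj n (scalar c)) A)\<rparr>)"

lemma B_ideal_ideal: "ideal (B_ideal n) FA"
  unfolding B_ideal_def by (rule ring.genideal_ideal[OF class_ring.ring_axioms]) simp

lemma B_alg_simps:
  "carrier (B_alg n) = carrier (FactRing FA (B_ideal n))"
  "mult (B_alg n) = mult (FactRing FA (B_ideal n))"
  "one (B_alg n) = one (FactRing FA (B_ideal n))"
  "zero (B_alg n) = zero (FactRing FA (B_ideal n))"
  "add (B_alg n) = add (FactRing FA (B_ideal n))"
  "smult (B_alg n) c A = mult (FactRing FA (B_ideal n)) (B_proj n (scalar c)) A"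
  by (simp_all add: B_alg_def Let_def)

lemma scalar_simps:
  "scalar 1 = 1" "scalar (a + b) = scalar a + scalar b" "scalar (a * b) = scalar a * scalar b"
  by (simp_all add: scalar_def single_add mult_single)

lemma scalar_central: "scalar c * f = f * scalar c"
proof (induction f rule: Poly_Mapping.update_induct)
  case const
  then show ?case by simp
next
  case (update f a b)
  have "Poly_Mapping.update a b f = f + Poly_Mapping.single a b"
    using update(1)
    by (intro poly_mapping_eqI)
       (auto simp: lookup_update lookup_add lookup_single in_keys_iff when_def)
  moreover have "scalar c * Poly_Mapping.single a b = Poly_Mapping.single a b * scalar c"
    by (simp add: scalar_def mult_single mult.commute)
  ultimately show ?case
    using update(3) by (simp add: distrib_left distrib_right)
qed

lemma B_proj_hom: "B_proj n \<in> Ring.ring_hom FA (FactRing FA (B_ideal n))"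
proof -
  interpret I: ideal "B_ideal n" FA by (rule B_ideal_ideal)
  have "B_proj n = a_r_coset FA (B_ideal n)"
    by (rule ext) (simp add: B_proj_def)
  then show ?thesis using I.rcos_ring_hom by simp
qed

lemma B_alg_ring: "ring (B_alg n)"
proof -
  interpret I: ideal "B_ideal n" FA by (rule B_ideal_ideal)
  interpret Q: ring "FactRing FA (B_ideal n)" by (rule I.quotient_is_ring)
  have l_inv: "\<exists>y\<in>carrier (B_alg n). y \<oplus>\<^bsub>B_alg n\<^esub> x = \<zero>\<^bsub>B_alg n\<^esub>"
    if "x \<in> carrier (B_alg n)" for x
    using that Q.l_neg[of x] Q.a_inv_closed[of x] unfolding B_alg_simps by blast
  have "abelian_group (B_alg n)"
    by (rule abelian_groupI) (auto simp: B_alg_simps Q.a_ac intro: l_inv[unfolded B_alg_simps])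
  moreover have "Group.monoid (B_alg n)"
    by (rule monoidI) (simp_all add: B_alg_simps Q.m_assoc)
  ultimately show ?thesis
    by (rule ringI) (simp_all add: B_alg_simps Q.l_distr Q.r_distr)
qed

lemma B_alg_vectorspace: "vectorspace (class_ring :: ratfun ring) (B_alg n)"
proof -
  interpret R: ring "B_alg n" by (rule B_alg_ring)
  interpret I: ideal "B_ideal n" FA by (rule B_ideal_ideal)
  interpret Q: ring "FactRing FA (B_ideal n)" by (rule I.quotient_is_ring)
  note h = B_proj_hom[of n]
  have cl: "B_proj n a \<in> carrier (FactRing FA (B_ideal n))" for a
    using Ring.ring_hom_closed[OF h, of a] by simp
  have "module (class_ring :: ratfun ring) (B_alg n)"
  proof (rule moduleI)
    show "cring (class_ring :: ratfun ring)" by (rule class_cring.cring_axioms)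
    show "abelian_group (B_alg n)" by (rule R.abelian_group_axioms)
  qed (use Ring.ring_hom_add[OF h] Ring.ring_hom_mult[OF h] Ring.ring_hom_one[OF h] in
      \<open>simp_all add: B_alg_simps scalar_simps cl Q.l_distr Q.r_distr Q.m_assoc\<close>)
  then show ?thesis
    by (simp add: vectorspace_def class_field.field_axioms)
qed

lemma B_alg_smult_mult:
  assumes "A \<in> carrier (B_alg n)" "B \<in> carrier (B_alg n)"
  shows "(c \<odot>\<^bsub>B_alg n\<^esub> A) \<otimes>\<^bsub>B_alg n\<^esub> B = c \<odot>\<^bsub>B_alg n\<^esub> (A \<otimes>\<^bsub>B_alg n\<^esub> B)"
    and "A \<otimes>\<^bsub>B_alg n\<^esub> (c \<odot>\<^bsub>B_alg n\<^esub> B) = c \<odot>\<^bsub>B_alg n\<^esub> (A \<otimes>\<^bsub>B_alg n\<^esub> B)"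
proof -
  interpret I: ideal "B_ideal n" FA by (rule B_ideal_ideal)
  interpret Q: ring "FactRing FA (B_ideal n)" by (rule I.quotient_is_ring)
  note h = B_proj_hom[of n]
  have cl: "B_proj n a \<in> carrier (FactRing FA (B_ideal n))" for a
    using Ring.ring_hom_closed[OF h, of a] by simp
  obtain f where f: "A = B_proj n f"
    using assms(1) by (auto simp: B_alg_simps FactRing_def A_RCOSETS_def' B_proj_def)
  have "A \<otimes>\<^bsub>FactRing FA (B_ideal n)\<^esub> B_proj n (scalar c) = B_proj n (scalar c) \<otimes>\<^bsub>FactRing FA (B_ideal n)\<^esub> A"
    unfolding f using Ring.ring_hom_mult[OF h, of f "scalar c"] Ring.ring_hom_mult[OF h, of "scalar c" f]
    by (simp add: scalar_central)
  then show "(c \<odot>\<^bsub>B_alg n\<^esub> A) \<otimes>\<^bsub>B_alg n\<^esub> B = c \<odot>\<^bsub>B_alg n\<^esub> (A \<otimes>\<^bsub>B_alg n\<^esub> B)"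
    and "A \<otimes>\<^bsub>B_alg n\<^esub> (c \<odot>\<^bsub>B_alg n\<^esub> B) = c \<odot>\<^bsub>B_alg n\<^esub> (A \<otimes>\<^bsub>B_alg n\<^esub> B)"
    using assms cl by (simp_all add: B_alg_simps Q.m_assoc flip: Q.m_assoc[of A])
qed

definition Sigma1 :: "nat \<Rightarrow> free_alg set" where
  "Sigma1 n = {alt_to l1 X0 X1 * E0 * alt_from l2 X1 X0 | l1 l2. l1 \<le> 2 * n \<and> l2 \<le> 2 * n}"

definition Sigma2 :: "nat \<Rightarrow> free_alg set" where
  "Sigma2 n =
    {alt_from i X1 X0 | i. i \<le> 2 * n} \<union> {alt_from j X0 X1 | j. 1 \<le> j \<and> j \<le> 2 * n + 1}"

definition Sigma_basis :: "nat \<Rightarrow> free_alg set set" where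
  "Sigma_basis n = B_proj n ` (Sigma1 n \<union> Sigma2 n)"


definition left_ideal :: "('a, 'b) ring_scheme \<Rightarrow> 'a set \<Rightarrow> bool" where
  "left_ideal R I \<longleftrightarrow>
    additive_subgroup I R \<and> (\<forall>a\<in>carrier R. \<forall>x\<in>I. a \<otimes>\<^bsub>R\<^esub> x \<in> I)"

definition simple_left_ideal :: "('a, 'b) ring_scheme \<Rightarrow> 'a set \<Rightarrow> bool" where
  "simple_left_ideal R I \<longleftrightarrow>
    left_ideal R I \<and> I \<noteq> {\<zero>\<^bsub>R\<^esub>} \<and>
    (\<forall>J. left_ideal R J \<and> J \<subseteq> I \<longrightarrow> J = {\<zero>\<^bsub>R\<^esub>} \<or> J = I)"

text \<open>
  \<open>R\<close> is semisimple if its left regular module is the internal direct sum of simple submodules.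
  The sum of a family of left ideals is the additive group generated by their union.
\<close>

definition semisimple_ring :: "('a, 'b) ring_scheme \<Rightarrow> bool" where
  "semisimple_ring R \<longleftrightarrow>
    (\<exists>\<I>. (\<forall>I\<in>\<I>. simple_left_ideal R I) \<and>
      generate (add_monoid R) (\<Union>\<I>) = carrier R \<and>
      (\<forall>I\<in>\<I>. I \<inter> generate (add_monoid R) (\<Union>(\<I> - {I})) = {\<zero>\<^bsub>R\<^esub>}))"

end

theory Submission
  imports Defs
begin

text \<open>Write \<open>N = 2 n + 1\<close> and let \<open>J\<close> be the two-sided ideal of the algebra \<open>B\<close> that is generated by
  \<open>E0\<close>. Everything rests on the exact sequence formed by \<open>J\<close>, a matrix algebra of size \<open>N\<close>, and
  \<open>B / J\<close>, the Hecke algebra of the dihedral group of order \<open>2 N\<close>.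

  \<^emph>\<open>Upper bound.\<close> The relations show that the left ideal \<open>B E0\<close> is spanned by the \<open>N\<close> elements
  \<open>[\<dots> X0 X1]_k E0\<close> with \<open>k \<le> 2 n\<close> (\<open>left_E0\<close>). The anti-involution \<open>star\<close>, which reverses words, respects
  the relations, so the same holds for \<open>E0 B\<close>, and \<open>J\<close> is spanned by the first family, \<open>Sigma1\<close>. It contains
  \<open>E1\<close>, which is conjugate to \<open>E0\<close>. Modulo \<open>J\<close> the letters \<open>X i\<close> satisfy a quadratic relation and the
  braid relation, hence the reduced words of the dihedral group, which form the second family, \<open>Sigma2\<close>, span
  the rest (\<open>sigma_spans\<close>).

  \<^emph>\<open>Lower bound.\<close> Two modules are constructed. On the first one, of dimension \<open>N\<close>, \<open>E0\<close> has rank one, the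
  rotation \<open>X1 X0\<close> is a cyclic shift twisted by \<open>l\<^sup>2\<close>, and the alternating word of length \<open>N\<close> is an
  explicit operator with square \<open>l\<^sup>2\<close>; all relations follow from a few identities between these three
  operators (\<open>V_rel\<close>). On the second one the \<open>E i\<close> are zero and the \<open>X i\<close> act as in the regular
  representation of the Hecke algebra (\<open>H_rel\<close>). The second module separates the second family. On the
  first module, an element of the first family has rank one, and the independence of the family
  means that an \<open>N\<close> by \<open>N\<close> matrix of scalars is regular. This follows from the ordering of \<open>\<rat>(m, l)\<close>
  for which \<open>l\<close> is larger than every rational number and \<open>m\<close> is larger than every element of \<open>\<rat>(l)\<close>: a
  vector \<open>x\<close> in the kernel satisfies \<open>m \<bar>x j\<bar> \<le> 2 l max \<bar>x\<bar>\<close> for all \<open>j\<close> (\<open>orbit_of_phi_nondegenerate\<close>).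
  Thus the two modules together are faithful (\<open>jointly_faithful\<close>).

  \<^emph>\<open>Semisimplicity.\<close> It suffices that no nonzero left ideal \<open>L\<close> has square zero
  (\<open>semisimple_if_semiprime\<close>, a consequence of Brauer's lemma). If \<open>L\<close> has square zero, it acts as zero on
  both modules. On the first one, \<open>E0 a E0\<close> is a multiple of \<open>E0\<close>, the factor being a matrix
  coefficient of \<open>a\<close>, and nilpotency makes these coefficients vanish for all \<open>a\<close> in \<open>L\<close>. On the second
  one, \<open>star\<close> is the adjoint for the standard scalar product, which is definite over an ordered
  field, so the classical argument with \<open>star x * x\<close> applies (\<open>no_square_zero_left_ideal\<close>).\<close>

section \<open>Alternating products\<close>

lemma alt_to_Suc: "alt_to (Suc k) a b = (if even k then b else a) * alt_to k a b"
proof (induction k arbitrary: a b)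
  case 0
  then show ?case by simp
next
  case (Suc k)
  have "alt_to (Suc (Suc k)) a b = alt_to (Suc k) b a * b" by simp
  also have "\<dots> = (if even k then a else b) * (alt_to k b a * b)"
    by (simp only: Suc mult.assoc)
  finally show ?case by (cases "even k") simp_all
qed

lemma alt_from_even: "alt_from (2 * i) a b = (a * b) ^ i"
  by (induction i) (simp_all add: mult.assoc)

lemma alt_from_odd: "alt_from (Suc (2 * i)) a b = (a * b) ^ i * a"
  by (induction i) (simp_all add: mult.assoc)

lemma alt_to_even: "alt_to (2 * i) a b = (a * b) ^ i"
  by (induction i) (simp_all add: mult.assoc power_Suc2 del: power_Suc)

lemma alt_to_odd: "alt_to (Suc (2 * i)) b a = (a * b) ^ i * a"
  by (simp only: alt_to.simps alt_to_even)

lemma alt_from_odd_palindrome: "alt_from (Suc (2 * i)) a b = alt_to (Suc (2 * i)) b a"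
  by (simp only: alt_from_odd alt_to_odd)


section \<open>The free algebra\<close>

lemma free_alg_induct [case_names zero add word]:
  fixes a :: free_alg
  assumes zero: "P 0"
    and add: "\<And>a b. P a \<Longrightarrow> P b \<Longrightarrow> P (a + b)"
    and word: "\<And>w c. P (Poly_Mapping.single w c)"
  shows "P a"
proof (induction a rule: Poly_Mapping.update_induct)
  case const
  show ?case by (rule zero)
next
  case (update f w c)
  have "Poly_Mapping.update w c f = f + Poly_Mapping.single w c"
    using update(1)
    by (intro poly_mapping_eqI)
       (auto simp: lookup_update lookup_add lookup_single in_keys_iff when_def)
  then show ?case using add[OF update(3) word] by simp
qed

lemma scalar_0 [simp]: "scalar 0 = 0"
  by (simp add: scalar_def)

lemma scalar_minus: "scalar (- c) = - scalar c"
  by (simp add: scalar_def single_uminus)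

lemma scalar_1 [simp]: "scalar 1 = 1"
  by (rule scalar_simps)

lemma scalar_left_commute: "a * (scalar c * b) = scalar c * (a * b)"
  by (metis mult.assoc scalar_central)

lemma single_eq_scalar_word:
  "Poly_Mapping.single w c = scalar c * Poly_Mapping.single w (1 :: ratfun)"
  by (simp add: scalar_def mult_single)

lemma single_Word_Cons:
  "Poly_Mapping.single (Word (g # gs)) (1 :: ratfun) = gen g * Poly_Mapping.single (Word gs) 1"
  by (simp add: gen_def mult_single plus_word_def)

lemma single_Word_Nil: "Poly_Mapping.single (Word []) (1 :: ratfun) = (1 :: free_alg)"
  by (simp flip: zero_word_def add: scalar_def)

text \<open>A subspace which contains \<open>1\<close> and is stable under left multiplication by the letters is
  everything; this is how spanning sets are recognised below.\<close>

lemma subspace_eq_UNIV_if_gen_stable: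
  assumes one: "(1 :: free_alg) \<in> M"
    and add: "\<And>a b. a \<in> M \<Longrightarrow> b \<in> M \<Longrightarrow> a + b \<in> M"
    and scale: "\<And>c a. a \<in> M \<Longrightarrow> scalar c * a \<in> M"
    and gen: "\<And>g a. a \<in> M \<Longrightarrow> gen g * a \<in> M"
  shows "a \<in> M"
proof (induction a rule: free_alg_induct)
  case zero
  show ?case using scale[OF one, of 0] by simp
next
  case (add a b)
  then show ?case by (rule assms)
next
  case (word w c)
  have "Poly_Mapping.single (Word gs) 1 \<in> M" for gs
    by (induction gs) (simp_all add: single_Word_Nil one single_Word_Cons gen)
  from scale[OF this[of "letters w"], of c] show ?case
    by (simp flip: single_eq_scalar_word)
qed


text \<open>The anti-automorphism that fixes the letters. It maps every defining relation to a defining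
  relation, which halves the work: a statement about left ideals becomes one about right ideals.\<close>

definition star :: "free_alg \<Rightarrow> free_alg" where
  "star = Poly_Mapping.map_key (\<lambda>w. Word (rev (letters w)))"

lemma inj_rev_word: "inj (\<lambda>w :: 'a word. Word (rev (letters w)))"
proof (rule injI)
  fix u v :: "'a word"
  assume "Word (rev (letters u)) = Word (rev (letters v))"
  then have "letters u = letters v" by simp
  then show "u = v" by (rule word.expand)
qed

lemma star_0 [simp]: "star 0 = 0"
  unfolding star_def by (rule map_key_zero[OF inj_rev_word])

lemma star_add: "star (a + b) = star a + star b"
  unfolding star_def by (rule map_key_plus[OF inj_rev_word])

lemma star_single: "star (Poly_Mapping.single w c) = Poly_Mapping.single (Word (rev (letters w))) c"
  unfolding star_def using map_key_single[OF inj_rev_word, of "Word (rev (letters w))" c] by simp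

lemma star_mult: "star (a * b) = star b * star a"
proof (induction a rule: free_alg_induct)
  case (word w c)
  show ?case
    by (induction b rule: free_alg_induct)
       (simp_all add: star_add star_single mult_single plus_word_def distrib_left distrib_right mult.commute)
qed (simp_all add: star_add distrib_left distrib_right)

lemma star_star [simp]: "star (star a) = a"
  by (induction a rule: free_alg_induct) (simp_all add: star_add star_single)

lemma star_scalar [simp]: "star (scalar c) = scalar c"
  by (simp add: scalar_def star_single zero_word_def)

lemma star_1 [simp]: "star 1 = 1"
  using star_scalar[of 1] by simp

lemma star_gen [simp]: "star (gen g) = gen g"
  by (simp add: gen_def star_single)

lemma star_uminus: "star (- a) = - star a"
  using star_add[of a "- a"] by (simp add: eq_neg_iff_add_eq_0 add.commute)

lemma star_diff: "star (a - b) = star a - star b"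
  using star_add[of a "- b"] by (simp add: star_uminus)

lemma star_sum: "star (sum f A) = (\<Sum>i\<in>A. star (f i))"
  by (induction A rule: infinite_finite_induct) (simp_all add: star_add)

lemma star_power: "star (a ^ k) = star a ^ k"
  by (induction k) (simp_all add: star_mult power_commutes)

lemma star_alt_from: "star (alt_from N a b) = alt_to N (star b) (star a)"
  by (induction N arbitrary: a b) (simp_all add: star_mult)

lemma star_alt_to: "star (alt_to N a b) = alt_from N (star b) (star a)"
  by (induction N arbitrary: a b) (simp_all add: star_mult)


section \<open>The ideal of relations\<close>

text \<open>Two-sided ideals are used below only through these closure properties, and always in order to
  compare them with \<open>B_ideal n\<close> by minimality.\<close>

lemma FA_idealI:
  fixes I :: "free_alg set"
  assumes "0 \<in> I" "\<And>a b. a \<in> I \<Longrightarrow> b \<in> I \<Longrightarrow> a + b \<in> I" "\<And>a. a \<in> I \<Longrightarrow> - a \<in> I"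
    and "\<And>a x. a \<in> I \<Longrightarrow> x * a \<in> I" "\<And>a x. a \<in> I \<Longrightarrow> a * x \<in> I"
  shows "ideal I FA"
proof (rule idealI)
  show "ring FA" by (rule class_ring.ring_axioms)
  have inv: "inv\<^bsub>add_monoid FA\<^esub> a = - a" for a :: free_alg
  proof -
    have "a_inv FA a = - a" by (simp add: class_ring_simps)
    then show ?thesis by (simp only: a_inv_def)
  qed
  show "subgroup I (add_monoid FA)"
    by (rule subgroup.intro) (use assms inv in simp_all)
qed (use assms in auto)

context
  fixes n :: nat
begin

interpretation I: ideal "B_ideal n" FA by (rule B_ideal_ideal)

lemma B_ideal_0: "0 \<in> B_ideal n"
  using I.zero_closed by simp

lemma B_ideal_add: "a \<in> B_ideal n \<Longrightarrow> b \<in> B_ideal n \<Longrightarrow> a + b \<in> B_ideal n"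
  using I.a_closed by simp

lemma B_ideal_mult_left: "a \<in> B_ideal n \<Longrightarrow> x * a \<in> B_ideal n"
  using I.I_l_closed by simp

lemma B_ideal_mult_right: "a \<in> B_ideal n \<Longrightarrow> a * x \<in> B_ideal n"
  using I.I_r_closed by simp

lemma B_ideal_uminus: "a \<in> B_ideal n \<Longrightarrow> - a \<in> B_ideal n"
  using B_ideal_mult_left[of a "- 1"] by simp

lemma B_ideal_rel: "B_rel n a b \<Longrightarrow> a - b \<in> B_ideal n"
  unfolding B_ideal_def using ring.genideal_self[OF class_ring.ring_axioms, of "{a - b | a b. B_rel n a b}"] by auto

lemma B_ideal_minimal:
  assumes "ideal J FA" "\<And>a b. B_rel n a b \<Longrightarrow> a - b \<in> J"
  shows "B_ideal n \<subseteq> J"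
  unfolding B_ideal_def by (rule ring.genideal_minimal[OF class_ring.ring_axioms]) (use assms in auto)

end

text \<open>Calculations in the quotient algebra are carried out on representatives, with this congruence.\<close>

definition eqv :: "nat \<Rightarrow> free_alg \<Rightarrow> free_alg \<Rightarrow> bool" where
  "eqv n a b \<longleftrightarrow> a - b \<in> B_ideal n"

lemma eqv_0_iff: "eqv n a 0 \<longleftrightarrow> a \<in> B_ideal n"
  by (simp add: eqv_def)

lemma eqv_refl [simp]: "eqv n a a"
  by (simp add: eqv_def B_ideal_0)

lemma eqv_sym: "eqv n a b \<Longrightarrow> eqv n b a"
  unfolding eqv_def using B_ideal_uminus[of "a - b"] by simp

lemma eqv_trans [trans]: "eqv n a b \<Longrightarrow> eqv n b c \<Longrightarrow> eqv n a c"
  unfolding eqv_def using B_ideal_add[of "a - b" n "b - c"] by simp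

lemma eqv_add: "eqv n a b \<Longrightarrow> eqv n c d \<Longrightarrow> eqv n (a + c) (b + d)"
  unfolding eqv_def using B_ideal_add[of "a - b" n "c - d"] by (simp add: algebra_simps)

lemma eqv_uminus: "eqv n a b \<Longrightarrow> eqv n (- a) (- b)"
  unfolding eqv_def using B_ideal_uminus[of "a - b"] by (simp add: algebra_simps)

lemma eqv_diff: "eqv n a b \<Longrightarrow> eqv n c d \<Longrightarrow> eqv n (a - c) (b - d)"
  using eqv_add[of n a b "- c" "- d"] eqv_uminus[of n c d] by simp

lemma eqv_left: "eqv n a b \<Longrightarrow> eqv n (x * a) (x * b)"
  unfolding eqv_def using B_ideal_mult_left[of "a - b" n x] by (simp add: right_diff_distrib)

lemma eqv_right: "eqv n a b \<Longrightarrow> eqv n (a * x) (b * x)"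
  unfolding eqv_def using B_ideal_mult_right[of "a - b" n x] by (simp add: left_diff_distrib)

lemma eqv_rel: "B_rel n a b \<Longrightarrow> eqv n a b"
  by (simp add: eqv_def B_ideal_rel)

text \<open>The words of odd length in the relations are palindromes; \<open>swap0\<close> and \<open>swap1\<close> are exchanged.\<close>

lemma eqv_star_rel:
  assumes "B_rel n a b"
  shows "eqv n (star a) (star b)"
  using assms
proof cases
  case (braid)
  have "alt_to (2 * n + 1) Y X = alt_from (2 * n + 1) X Y" for X Y :: free_alg
    using alt_from_odd_palindrome[of n X Y] by (simp del: alt_from.simps alt_to.simps)
  with braid show ?thesis
    using eqv_rel[OF B_rel.braid[of n]] by (simp add: star_alt_from del: alt_from.simps alt_to.simps)
next
  case (sandwich0 i)
  then obtain j where j: "2 * i - Suc 0 = Suc (2 * j)" by (cases i) auto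
  show ?thesis using eqv_rel[OF B_rel.sandwich0[of i n]] sandwich0
    by (simp add: star_mult star_alt_from star_alt_to alt_from_odd_palindrome j scalar_central mult.assoc del: alt_from.simps alt_to.simps)
next
  case (sandwich1 i)
  then obtain j where j: "2 * i - Suc 0 = Suc (2 * j)" by (cases i) auto
  show ?thesis using eqv_rel[OF B_rel.sandwich1[of i n]] sandwich1
    by (simp add: star_mult star_alt_from star_alt_to alt_from_odd_palindrome j scalar_central mult.assoc del: alt_from.simps alt_to.simps)
next
  case (sandwich_inv0 i)
  then obtain j where j: "2 * i - Suc 0 = Suc (2 * j)" by (cases i) auto
  show ?thesis using eqv_rel[OF B_rel.sandwich_inv0[of i n]] sandwich_inv0
    by (simp add: star_mult star_alt_from star_alt_to alt_from_odd_palindrome j scalar_central mult.assoc del: alt_from.simps alt_to.simps)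
next
  case (sandwich_inv1 i)
  then obtain j where j: "2 * i - Suc 0 = Suc (2 * j)" by (cases i) auto
  show ?thesis using eqv_rel[OF B_rel.sandwich_inv1[of i n]] sandwich_inv1
    by (simp add: star_mult star_alt_from star_alt_to alt_from_odd_palindrome j scalar_central mult.assoc del: alt_from.simps alt_to.simps)
next
  case swap0
  show ?thesis using eqv_rel[OF B_rel.swap1] swap0
    by (simp add: star_mult star_alt_from alt_from_even alt_to_even star_power)
next
  case swap1
  show ?thesis using eqv_rel[OF B_rel.swap0] swap1
    by (simp add: star_mult star_alt_from alt_from_even alt_to_even star_power)
qed (auto simp: star_mult star_diff scalar_central intro: eqv_rel[OF B_rel.inv_left] eqv_rel[OF B_rel.inv_right]
      eqv_rel[OF B_rel.skein] eqv_rel[OF B_rel.absorb_left] eqv_rel[OF B_rel.absorb_right] eqv_rel[OF B_rel.square]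
      eqv_rel[OF B_rel.skein, unfolded scalar_central] eqv_rel[OF B_rel.absorb_left, unfolded scalar_central] eqv_rel[OF B_rel.absorb_right, unfolded scalar_central] eqv_rel[OF B_rel.square, unfolded scalar_central])

lemma star_B_ideal: "a \<in> B_ideal n \<Longrightarrow> star a \<in> B_ideal n"
proof -
  have "ideal {a. star a \<in> B_ideal n} FA"
    by (rule FA_idealI)
       (simp_all add: B_ideal_0 star_add B_ideal_add star_uminus B_ideal_uminus star_mult
         B_ideal_mult_left B_ideal_mult_right)
  then have "B_ideal n \<subseteq> {a. star a \<in> B_ideal n}"
    by (rule B_ideal_minimal) (use eqv_star_rel in \<open>auto simp: star_diff eqv_def\<close>)
  then show "a \<in> B_ideal n \<Longrightarrow> star a \<in> B_ideal n" by auto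
qed

lemma eqv_star: "eqv n a b \<Longrightarrow> eqv n (star a) (star b)"
  unfolding eqv_def using star_B_ideal[of "a - b"] by (simp add: star_diff)


section \<open>Linear actions of the free algebra\<close>

text \<open>A module is given by operators for the letters on a space of functions. Not the whole function
  space but a subspace cut out by a support condition is a module of \<open>B_alg n\<close>, because the index
  types cannot depend on \<open>n\<close>.\<close>

definition word_act :: "(letter \<Rightarrow> ('i \<Rightarrow> ratfun) \<Rightarrow> 'i \<Rightarrow> ratfun) \<Rightarrow> letter word \<Rightarrow> ('i \<Rightarrow> ratfun) \<Rightarrow> 'i \<Rightarrow> ratfun" where
  "word_act op w u = foldr op (letters w) u"

locale letter_action =
  fixes op :: "letter \<Rightarrow> ('i \<Rightarrow> ratfun) \<Rightarrow> 'i \<Rightarrow> ratfun"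
  assumes op_add: "op g (\<lambda>i. u i + v i) = (\<lambda>i. op g u i + op g v i)"
    and op_scale: "op g (\<lambda>i. c * u i) = (\<lambda>i. c * op g u i)"
begin

definition act :: "free_alg \<Rightarrow> ('i \<Rightarrow> ratfun) \<Rightarrow> 'i \<Rightarrow> ratfun" where
  "act a u = (\<lambda>i. \<Sum>w\<in>Poly_Mapping.keys a. Poly_Mapping.lookup a w * word_act op w u i)"

lemma word_act_add: "word_act op w (\<lambda>i. u i + v i) = (\<lambda>i. word_act op w u i + word_act op w v i)"
proof -
  have "foldr op gs (\<lambda>i. u i + v i) = (\<lambda>i. foldr op gs u i + foldr op gs v i)" for gs
    by (induction gs) (simp_all add: op_add)
  then show ?thesis by (simp add: word_act_def)
qed

lemma word_act_scale: "word_act op w (\<lambda>i. c * u i) = (\<lambda>i. c * word_act op w u i)"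
proof -
  have "foldr op gs (\<lambda>i. c * u i) = (\<lambda>i. c * foldr op gs u i)" for gs
    by (induction gs) (simp_all add: op_scale)
  then show ?thesis by (simp add: word_act_def)
qed

lemma act_eq_sum:
  assumes "finite A" "Poly_Mapping.keys a \<subseteq> A"
  shows "act a u i = (\<Sum>w\<in>A. Poly_Mapping.lookup a w * word_act op w u i)"
  unfolding act_def using assms by (intro sum.mono_neutral_left) (auto simp: in_keys_iff)

lemma act_0 [simp]: "act 0 u = (\<lambda>i. 0)"
  by (simp add: act_def)

lemma act_add: "act (a + b) u = (\<lambda>i. act a u i + act b u i)"
proof
  fix i
  let ?A = "Poly_Mapping.keys a \<union> Poly_Mapping.keys b"
  have "Poly_Mapping.keys (a + b) \<subseteq> ?A" by (rule Poly_Mapping.keys_add)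
  then show "act (a + b) u i = act a u i + act b u i"
    by (simp add: act_eq_sum[of ?A] lookup_add distrib_right sum.distrib)
qed

lemma act_single: "act (Poly_Mapping.single w c) u = (\<lambda>i. c * word_act op w u i)"
  by (rule ext, subst act_eq_sum[of "{w}"]) auto

lemma act_add_right: "act a (\<lambda>i. u i + v i) = (\<lambda>i. act a u i + act a v i)"
  by (simp add: act_def word_act_add distrib_left sum.distrib)

lemma act_scale_right: "act a (\<lambda>i. c * u i) = (\<lambda>i. c * act a u i)"
  by (simp add: act_def word_act_scale sum_distrib_left mult_ac)

lemma act_zero_right [simp]: "act a (\<lambda>i. 0) = (\<lambda>i. 0)"
  using act_scale_right[of a 0 "\<lambda>i. 0"] by simp

lemma act_mult: "act (a * b) u = act a (act b u)"
proof (induction a rule: free_alg_induct)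
  case (word w c)
  show ?case
  proof (induction b rule: free_alg_induct)
    case zero
    show ?case by simp
  next
    case (add a b)
    then show ?case by (simp add: distrib_left act_add act_add_right)
  next
    case (word w' c')
    show ?case
      by (simp add: mult_single act_single act_scale_right mult.assoc mult.left_commute word_act_scale)
         (simp add: word_act_def plus_word_def)
  qed
qed (simp_all add: distrib_right act_add)

lemma act_scalar [simp]: "act (scalar c) u = (\<lambda>i. c * u i)"
  by (simp add: scalar_def act_single word_act_def zero_word_def)

lemma act_1 [simp]: "act 1 u = u"
  using act_scalar[of 1 u] by simp

lemma act_gen [simp]: "act (gen g) u = op g u"
  by (simp add: gen_def act_single word_act_def)

lemma act_uminus: "act (- a) u = (\<lambda>i. - act a u i)"
  using act_add[of a "- a" u] by (auto simp: fun_eq_iff) (metis minus_unique)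

lemma act_diff: "act (a - b) u = (\<lambda>i. act a u i - act b u i)"
  using act_add[of a "- b" u] by (simp add: act_uminus)

lemma act_sum: "act (sum f A) u = (\<lambda>i. \<Sum>x\<in>A. act (f x) u i)"
  by (induction A rule: infinite_finite_induct) (simp_all add: act_add)

lemma act_sum_right: "act a (\<lambda>i. \<Sum>x\<in>A. f x i) = (\<lambda>i. \<Sum>x\<in>A. act a (f x) i)"
  by (induction A rule: infinite_finite_induct) (simp_all add: act_add_right)

end

text \<open>The kernel of an action on a stable set of vectors is an ideal; it contains the ideal of
  relations as soon as it contains the relations.\<close>

locale B_action = letter_action op for op :: "letter \<Rightarrow> ('i \<Rightarrow> ratfun) \<Rightarrow> 'i \<Rightarrow> ratfun" +
  fixes V :: "('i \<Rightarrow> ratfun) set" and n :: nat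
  assumes V_0: "(\<lambda>i. 0) \<in> V"
    and V_add: "u \<in> V \<Longrightarrow> v \<in> V \<Longrightarrow> (\<lambda>i. u i + v i) \<in> V"
    and V_scale: "u \<in> V \<Longrightarrow> (\<lambda>i. c * u i) \<in> V"
    and V_op: "u \<in> V \<Longrightarrow> op g u \<in> V"
    and rel: "B_rel n a b \<Longrightarrow> u \<in> V \<Longrightarrow> act a u = act b u"
begin

lemma V_act: "u \<in> V \<Longrightarrow> act a u \<in> V"
proof (induction a rule: free_alg_induct)
  case (word w c)
  then have "foldr op gs u \<in> V" for gs
    by (induction gs) (simp_all add: V_op)
  then show ?case by (simp add: act_single word_act_def V_scale)
qed (simp_all add: act_add V_0 V_add)

lemma act_B_ideal: "a \<in> B_ideal n \<Longrightarrow> u \<in> V \<Longrightarrow> act a u = (\<lambda>i. 0)"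
proof -
  let ?J = "{a. \<forall>u\<in>V. act a u = (\<lambda>i. 0)}"
  have "ideal ?J FA"
    by (rule FA_idealI) (auto simp: act_add act_uminus act_mult V_act)
  then have "B_ideal n \<subseteq> ?J"
    by (rule B_ideal_minimal) (use rel in \<open>auto simp: act_diff\<close>)
  then show "a \<in> B_ideal n \<Longrightarrow> u \<in> V \<Longrightarrow> act a u = (\<lambda>i. 0)" by auto
qed

lemma act_eqv: "eqv n a b \<Longrightarrow> u \<in> V \<Longrightarrow> act a u = act b u"
  using act_B_ideal[of "a - b" u] unfolding eqv_def by (auto simp: act_diff fun_eq_iff)

end

section \<open>The ordering of the base field\<close>

text \<open>The polynomial rings and their fraction field are ordered by leading coefficients, so that \<open>l\<close>
  and \<open>m\<close> are infinitely large, \<open>m\<close> more so than \<open>l\<close>. The field being ordered at all makes sums of squares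
  definite.\<close>

lemma par_l_gt_1: "par_l > 1"
proof -
  have "(1::rat poly poly) < [:[:0, 1:]:]"
    by (simp add: less_poly_def pos_poly_def one_pCons)
  then show ?thesis
    by (simp add: par_l_def One_fract_def less_fract)
qed

lemma par_m_gt_par_l: "par_m > 2 * par_l"
proof -
  have "[:[:0, 2:]:] < ([:0, 1:] :: rat poly poly)"
    by (simp add: less_poly_def pos_poly_def one_pCons)
  moreover have "2 * par_l = Fract [:[:0, 2:]:] 1"
    by (simp add: par_l_def mult_2 numeral_2_eq_2)
  ultimately show ?thesis
    by (simp add: par_m_def less_fract)
qed


section \<open>Spanning\<close>

text \<open>The linear span of a family modulo the relations. Indexing by a family rather than a set avoids
  the question of coincidences, which is settled only by the independence result.\<close>

definition combs :: "nat \<Rightarrow> ('i \<Rightarrow> free_alg) \<Rightarrow> 'i set \<Rightarrow> free_alg set" where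
  "combs n f A = {a. \<exists>c. eqv n a (\<Sum>i\<in>A. scalar (c i) * f i)}"

lemma combs_eqv: "eqv n a b \<Longrightarrow> b \<in> combs n f A \<Longrightarrow> a \<in> combs n f A"
  unfolding combs_def using eqv_trans by blast

lemma combs_add:
  assumes "a \<in> combs n f A" "b \<in> combs n f A"
  shows "a + b \<in> combs n f A"
proof -
  from assms obtain c d where "eqv n a (\<Sum>i\<in>A. scalar (c i) * f i)" "eqv n b (\<Sum>i\<in>A. scalar (d i) * f i)"
    unfolding combs_def by auto
  from eqv_add[OF this] have "eqv n (a + b) (\<Sum>i\<in>A. scalar (c i + d i) * f i)"
    by (simp add: scalar_simps distrib_right sum.distrib)
  then show ?thesis unfolding combs_def by (intro CollectI exI[of _ "\<lambda>i. c i + d i"])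
qed

lemma combs_scale:
  assumes "a \<in> combs n f A"
  shows "scalar x * a \<in> combs n f A"
proof -
  from assms obtain c where "eqv n a (\<Sum>i\<in>A. scalar (c i) * f i)"
    unfolding combs_def by auto
  from eqv_left[OF this, of "scalar x"] have "eqv n (scalar x * a) (\<Sum>i\<in>A. scalar (x * c i) * f i)"
    by (simp add: scalar_simps sum_distrib_left mult.assoc)
  then show ?thesis unfolding combs_def by (intro CollectI exI[of _ "\<lambda>i. x * c i"])
qed

lemma combs_diff: "a \<in> combs n f A \<Longrightarrow> b \<in> combs n f A \<Longrightarrow> a - b \<in> combs n f A"
  using combs_add[of a n f A "scalar (- 1) * b"] combs_scale[of b n f A "- 1"]
  by (simp add: scalar_minus)

lemma combs_0: "0 \<in> combs n f A"
  unfolding combs_def by (intro CollectI exI[of _ "\<lambda>i. 0"]) simp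

lemma combs_sum: "(\<And>i. i \<in> B \<Longrightarrow> g i \<in> combs n f A) \<Longrightarrow> sum g B \<in> combs n f A"
  by (induction B rule: infinite_finite_induct) (simp_all add: combs_0 combs_add)

lemma combs_member:
  assumes "finite A" "i \<in> A"
  shows "f i \<in> combs n f A"
proof -
  have "(\<Sum>j\<in>A. scalar (if i = j then 1 else 0) * f j) = (\<Sum>j\<in>A. if i = j then f j else 0)"
    by (intro sum.cong) auto
  then have "f i = (\<Sum>j\<in>A. scalar (if i = j then 1 else 0) * f j)"
    using assms by simp
  then show ?thesis
    unfolding combs_def by (intro CollectI exI[of _ "\<lambda>j. if i = j then 1 else 0"]) (metis eqv_refl)
qed

lemma combs_mult_left:
  assumes "a \<in> combs n f A" "\<And>i. i \<in> A \<Longrightarrow> x * f i \<in> combs n g B"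
  shows "x * a \<in> combs n g B"
proof -
  from assms(1) obtain c where "eqv n a (\<Sum>i\<in>A. scalar (c i) * f i)"
    unfolding combs_def by auto
  from eqv_left[OF this, of x] have "eqv n (x * a) (\<Sum>i\<in>A. scalar (c i) * (x * f i))"
    by (simp add: sum_distrib_left scalar_left_commute)
  then show ?thesis by (rule combs_eqv) (intro combs_sum combs_scale assms)
qed

lemma combs_mult_right:
  assumes "a \<in> combs n f A" "\<And>i. i \<in> A \<Longrightarrow> f i * x \<in> combs n g B"
  shows "a * x \<in> combs n g B"
proof -
  from assms(1) obtain c where "eqv n a (\<Sum>i\<in>A. scalar (c i) * f i)"
    unfolding combs_def by auto
  from eqv_right[OF this, of x] have "eqv n (a * x) (\<Sum>i\<in>A. scalar (c i) * (f i * x))"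
    by (simp add: sum_distrib_right mult.assoc)
  then show ?thesis by (rule combs_eqv) (intro combs_sum combs_scale assms)
qed

lemma combs_mono:
  assumes "a \<in> combs n f A" "\<And>i. i \<in> A \<Longrightarrow> f i \<in> combs n g B"
  shows "a \<in> combs n g B"
  using combs_mult_left[of a n f A 1 g B] assms by simp


lemma Xinv_expand: "eqv n (gen (Xinv i)) (gen (X i) - scalar par_m * (gen (E i) - 1))"
  using eqv_diff[OF eqv_refl[of n "gen (X i)"] eqv_rel[OF B_rel.skein[of n i]]] by simp

text \<open>The quadratic relation of the Hecke algebra, with a correction term in the ideal of \<open>E i\<close>.\<close>

lemma X_X_left:
  "eqv n (gen (X i) * (gen (X i) * w))
    (w + scalar (par_m * par_l) * (gen (E i) * w) - scalar par_m * (gen (X i) * w))"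
proof -
  let ?X = "gen (X i)" and ?Y = "gen (Xinv i)" and ?E = "gen (E i)"
  have "?X * ?X = ?X * (?X - ?Y) + ?X * ?Y"
    by (simp add: right_diff_distrib)
  also have "eqv n \<dots> (?X * (scalar par_m * (?E - 1)) + 1)"
    by (intro eqv_add eqv_left eqv_rel B_rel.skein B_rel.inv_right)
  also have "\<dots> = scalar par_m * (?X * ?E - ?X) + 1"
    by (simp only: scalar_left_commute) (simp add: right_diff_distrib)
  also have "eqv n \<dots> (scalar par_m * (scalar par_l * ?E - ?X) + 1)"
    by (intro eqv_add eqv_diff eqv_left eqv_refl eqv_rel B_rel.absorb_left)
  also have "\<dots> = 1 + scalar (par_m * par_l) * ?E - scalar par_m * ?X"
    by (simp add: right_diff_distrib scalar_simps mult.assoc)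
  finally have "eqv n (?X * ?X * w) ((1 + scalar (par_m * par_l) * ?E - scalar par_m * ?X) * w)"
    by (rule eqv_right)
  then show ?thesis
    by (simp add: distrib_right left_diff_distrib mult.assoc)
qed

lemma Xinv_E: "eqv n (gen (Xinv i) * gen (E i)) (scalar (inverse par_l) * gen (E i))"
proof -
  let ?X = "gen (X i)" and ?Y = "gen (Xinv i)" and ?E = "gen (E i)"
  have "par_l \<noteq> 0" using par_l_gt_1 by auto
  then have "?Y * ?E = scalar (inverse par_l * par_l) * (?Y * ?E)" by simp
  also have "\<dots> = scalar (inverse par_l) * (?Y * (scalar par_l * ?E))"
    by (simp only: scalar_left_commute[of ?Y] scalar_simps mult.assoc)
  also have "eqv n \<dots> (scalar (inverse par_l) * (?Y * (?X * ?E)))"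
    by (intro eqv_left eqv_sym[OF eqv_rel[OF B_rel.absorb_left]])
  also have "\<dots> = scalar (inverse par_l) * ((?Y * ?X) * ?E)"
    by (simp add: mult.assoc)
  also have "eqv n \<dots> (scalar (inverse par_l) * (1 * ?E))"
    by (intro eqv_left eqv_right eqv_rel B_rel.inv_left)
  finally show ?thesis by simp
qed

lemma rotation_power_inverse: "eqv n ((X0 * X1) ^ i * (Y1 * Y0) ^ i) 1"
proof (induction i)
  case (Suc i)
  have "(X0 * X1) ^ Suc i * (Y1 * Y0) ^ Suc i = ((X0 * X1) ^ i * (X0 * X1)) * ((Y1 * Y0) * (Y1 * Y0) ^ i)"
    by (simp only: power_Suc2[of "X0 * X1"] power_Suc[of "Y1 * Y0"])
  also have "\<dots> = (X0 * X1) ^ i * (X0 * ((X1 * Y1) * (Y0 * (Y1 * Y0) ^ i)))"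
    by (simp only: mult.assoc)
  also have "eqv n \<dots> ((X0 * X1) ^ i * (X0 * (1 * (Y0 * (Y1 * Y0) ^ i))))"
    by (intro eqv_left eqv_right eqv_rel B_rel.inv_right)
  also have "\<dots> = (X0 * X1) ^ i * ((X0 * Y0) * (Y1 * Y0) ^ i)"
    by (simp only: mult.assoc mult_1_left)
  also have "eqv n \<dots> ((X0 * X1) ^ i * (1 * (Y1 * Y0) ^ i))"
    by (intro eqv_left eqv_right eqv_rel B_rel.inv_right)
  also have "eqv n \<dots> 1" using Suc by simp
  finally show ?case .
qed simp

text \<open>\<open>E1\<close> is conjugate to \<open>E0\<close> by the power \<open>(X0 X1)^n\<close>.\<close>

lemma E1_rotation:
  assumes "j \<le> n"
  shows "eqv n (E1 * (X0 * X1) ^ j) ((X0 * X1) ^ n * (E0 * (Y1 * Y0) ^ (n - j)))"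
proof -
  let ?D = "X0 * X1" and ?D' = "Y1 * Y0"
  have "eqv n (E1 * ?D ^ j * 1) (E1 * ?D ^ j * (?D ^ (n - j) * ?D' ^ (n - j)))"
    by (intro eqv_left eqv_sym[OF rotation_power_inverse])
  also have "\<dots> = (E1 * ?D ^ n) * ?D' ^ (n - j)"
    using assms by (simp add: mult.assoc) (simp add: mult.assoc[symmetric] power_add[symmetric])
  also have "eqv n \<dots> ((?D ^ n * E0) * ?D' ^ (n - j))"
    using eqv_sym[OF eqv_rel[OF B_rel.swap0[of n]]] by (intro eqv_right) (simp add: alt_from_even)
  finally show ?thesis by (simp add: mult.assoc)
qed

text \<open>The factor \<open>l\<close> from the sandwich relation for inverse letters cancels against the \<open>1/l\<close> by which
  the last letter \<open>Y0\<close> is absorbed into \<open>E0\<close>.\<close>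

lemma E0_inv_rotation_E0:
  assumes "1 \<le> i" "i \<le> n"
  shows "eqv n (E0 * (Y1 * Y0) ^ i * E0) E0"
proof -
  obtain j where j: "i = Suc j" using assms by (cases i) auto
  have l: "par_l \<noteq> 0" using par_l_gt_1 by auto
  have "(Y1 * Y0) ^ i = alt_from (2 * i - 1) Y1 Y0 * Y0"
    unfolding j by (simp only: power_Suc2) (simp add: alt_from_odd mult.assoc del: alt_from.simps)
  then have "E0 * (Y1 * Y0) ^ i * E0 = E0 * alt_from (2 * i - 1) Y1 Y0 * (Y0 * E0)"
    by (simp only: mult.assoc)
  also have "eqv n \<dots> (E0 * alt_from (2 * i - 1) Y1 Y0 * (scalar (inverse par_l) * E0))"
    by (intro eqv_left Xinv_E)
  also have "\<dots> = scalar (inverse par_l) * (E0 * alt_from (2 * i - 1) Y1 Y0 * E0)"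
    by (simp only: scalar_left_commute)
  also have "eqv n \<dots> (scalar (inverse par_l) * (scalar par_l * E0))"
    using assms by (intro eqv_left eqv_rel B_rel.sandwich_inv0)
  also have "\<dots> = E0"
    using l by (simp add: mult.assoc[symmetric] scalar_simps(3)[symmetric])
  finally show ?thesis .
qed

text \<open>These elements span the left ideal of \<open>E0\<close>. Both \<open>E0\<close> and \<open>E1\<close> act on them with rank one, with
  images spanned by the two ends \<open>cell 0\<close> and \<open>cell (2 * n)\<close> of the sequence.\<close>

definition cell :: "nat \<Rightarrow> free_alg" where
  "cell k = alt_to k X0 X1 * E0"

lemma cell_0: "cell 0 = E0"
  by (simp add: cell_def)

lemma cell_Suc: "cell (Suc k) = (if even k then X1 else X0) * cell k"
  by (simp add: cell_def alt_to_Suc mult.assoc del: alt_to.simps)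

lemma cell_even: "cell (2 * j) = (X0 * X1) ^ j * E0"
  by (simp add: cell_def alt_to_even)

lemma E0_cell:
  assumes "k \<le> 2 * n"
  obtains c where "eqv n (E0 * cell k) (scalar c * E0)"
proof -
  have odd: "eqv n (E0 * cell (Suc (2 * j))) (scalar (inverse par_l) * E0)" if "j < n" for j
  proof -
    have "2 * Suc j - 1 = Suc (2 * j)" by simp
    then have "eqv n (E0 * alt_to (Suc (2 * j)) X0 X1 * E0) (scalar (inverse par_l) * E0)"
      using eqv_rel[OF B_rel.sandwich0[of "Suc j" n]] that by (simp only: alt_from_odd_palindrome)
    then show ?thesis by (simp only: cell_def mult.assoc)
  qed
  consider "k = 0" | j where "k = Suc (2 * j)" | j where "k = Suc (Suc (2 * j))"
  proof -
    have "k = 0 \<or> (\<exists>j. k = Suc (2 * j)) \<or> (\<exists>j. k = Suc (Suc (2 * j)))" by presburger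
    then show thesis using that by blast
  qed
  then show ?thesis
  proof cases
    case 1
    then show ?thesis using that eqv_rel[OF B_rel.square[of n N0]] by (simp add: cell_0)
  next
    case (2 j)
    then show ?thesis using that odd[of j] assms by auto
  next
    case (3 j)
    have "E0 * cell k = (E0 * X0) * cell (Suc (2 * j))"
      unfolding 3 by (subst cell_Suc) (simp add: mult.assoc)
    also have "eqv n \<dots> (scalar par_l * E0 * cell (Suc (2 * j)))"
      by (intro eqv_right eqv_rel B_rel.absorb_right)
    also have "\<dots> = scalar par_l * (E0 * cell (Suc (2 * j)))"
      by (simp add: mult.assoc)
    also have "eqv n \<dots> (scalar par_l * (scalar (inverse par_l) * E0))"
      using 3 assms by (intro eqv_left odd) auto
    also have "\<dots> = scalar (par_l * inverse par_l) * E0"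
      by (simp add: scalar_simps mult.assoc)
    finally show ?thesis using that by blast
  qed
qed

lemma E1_cell:
  assumes "k \<le> 2 * n"
  obtains c where "eqv n (E1 * cell k) (scalar c * cell (2 * n))"
proof -
  have even: "\<exists>c. eqv n (E1 * cell (2 * j)) (scalar c * cell (2 * n))" if "j \<le> n" for j
  proof -
    have "\<exists>c. eqv n (E0 * (Y1 * Y0) ^ (n - j) * E0) (scalar c * E0)"
    proof (cases "j = n")
      case True
      then show ?thesis using eqv_rel[OF B_rel.square[of n N0]] by auto
    next
      case False
      then show ?thesis using E0_inv_rotation_E0[of "n - j" n] that
        by (intro exI[of _ 1]) simp
    qed
    then obtain c where c: "eqv n (E0 * (Y1 * Y0) ^ (n - j) * E0) (scalar c * E0)" ..
    have "E1 * cell (2 * j) = E1 * (X0 * X1) ^ j * E0"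
      by (simp add: cell_even mult.assoc)
    also have "eqv n \<dots> ((X0 * X1) ^ n * (E0 * (Y1 * Y0) ^ (n - j)) * E0)"
      by (intro eqv_right E1_rotation that)
    also have "\<dots> = (X0 * X1) ^ n * (E0 * (Y1 * Y0) ^ (n - j) * E0)"
      by (simp only: mult.assoc)
    also have "eqv n \<dots> ((X0 * X1) ^ n * (scalar c * E0))"
      by (intro eqv_left c)
    also have "\<dots> = scalar c * cell (2 * n)"
      by (simp add: cell_even scalar_left_commute)
    finally show ?thesis ..
  qed
  consider j where "k = 2 * j" | j where "k = Suc (2 * j)"
  proof -
    have "(\<exists>j. k = 2 * j) \<or> (\<exists>j. k = Suc (2 * j))" by presburger
    then show thesis using that by blast
  qed
  then show ?thesis
  proof cases
    case (1 j)
    then show ?thesis using even[of j] assms that by auto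
  next
    case (2 j)
    then obtain c where c: "eqv n (E1 * cell (2 * j)) (scalar c * cell (2 * n))"
      using even[of j] assms by auto
    have "E1 * cell k = (E1 * X1) * cell (2 * j)"
      unfolding 2 by (subst cell_Suc) (simp add: mult.assoc)
    also have "eqv n \<dots> (scalar par_l * E1 * cell (2 * j))"
      by (intro eqv_right eqv_rel B_rel.absorb_right)
    also have "\<dots> = scalar par_l * (E1 * cell (2 * j))"
      by (simp add: mult.assoc)
    also have "eqv n \<dots> (scalar par_l * (scalar c * cell (2 * n)))"
      by (intro eqv_left c)
    also have "\<dots> = scalar (par_l * c) * cell (2 * n)"
      by (simp add: scalar_simps mult.assoc)
    finally show ?thesis using that by blast
  qed
qed

text \<open>The letters \<open>X1\<close> and \<open>X0\<close> alternately lead from one cell to the next. A step down is a step up after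
  \<open>X i\<close> has been squared, and at the two ends the letter that does not lead further is absorbed.\<close>

lemma gen_cell:
  assumes k: "k \<le> 2 * n"
  shows "gen g * cell k \<in> combs n cell {..2 * n}"
proof -
  let ?M = "combs n cell {..2 * n}"
  have mem: "cell j \<in> ?M" if "j \<le> 2 * n" for j
    using that combs_member[of "{..2 * n}" j cell n] by simp
  have E: "gen (E i) * cell j \<in> ?M" if j: "j \<le> 2 * n" for i j
  proof (cases i)
    case N0
    obtain c where "eqv n (E0 * cell j) (scalar c * cell 0)"
      using E0_cell[OF j] by (auto simp: cell_0)
    then show ?thesis
      unfolding N0 by (rule combs_eqv) (intro combs_scale mem, simp)
  next
    case N1
    obtain c where "eqv n (E1 * cell j) (scalar c * cell (2 * n))"
      using E1_cell[OF j] .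
    then show ?thesis
      unfolding N1 by (rule combs_eqv) (intro combs_scale mem, simp)
  qed
  have twice: "gen (X i) * (gen (X i) * cell j) \<in> ?M"
    if "j \<le> 2 * n" "gen (X i) * cell j \<in> ?M" for i j
  proof (rule combs_eqv[OF X_X_left], rule combs_diff)
    show "cell j + scalar (par_m * par_l) * (gen (E i) * cell j) \<in> ?M"
      using that by (simp add: combs_add combs_scale mem E)
    show "scalar par_m * (gen (X i) * cell j) \<in> ?M"
      using that by (simp add: combs_scale)
  qed
  have X: "gen (X i) * cell k \<in> ?M" for i
  proof (cases k)
    case 0
    show ?thesis
    proof (cases i)
      case N0
      have "eqv n (X0 * cell 0) (scalar par_l * cell 0)"
        unfolding cell_0 by (intro eqv_rel B_rel.absorb_left)
      then show ?thesis
        unfolding N0 0 by (rule combs_eqv) (intro combs_scale mem, simp)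
    next
      case N1
      have "n = 0 \<or> 1 \<le> 2 * n" by auto
      then show ?thesis
      proof
        assume n: "n = 0"
        have "eqv n (X1 * cell 0) (X1 * (E1 * (X0 * X1) ^ 0))"
          unfolding cell_0 using eqv_sym[OF E1_rotation[of 0 n]] n by (intro eqv_left) simp
        also have "\<dots> = X1 * E1" by simp
        also have "eqv n \<dots> (scalar par_l * E1)" by (intro eqv_rel B_rel.absorb_left)
        also have "eqv n \<dots> (scalar par_l * cell 0)"
          unfolding cell_0 using E1_rotation[of 0 n] n by (intro eqv_left) simp
        finally show ?thesis
          unfolding N1 0 by (rule combs_eqv) (intro combs_scale mem, simp)
      next
        assume "1 \<le> 2 * n"
        then have "cell (Suc 0) \<in> ?M" by (intro mem) simp
        then show ?thesis using N1 0 by (simp add: cell_Suc)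
      qed
    qed
  next
    case (Suc j)
    have j: "j < 2 * n" using Suc k by simp
    define i' where "i' = (if even j then N1 else N0)"
    have step: "cell k = gen (X i') * cell j"
      by (simp add: Suc cell_Suc i'_def)
    show ?thesis
    proof (cases "i = i'")
      case True
      have "gen (X i) * cell j \<in> ?M" using mem[OF k] by (simp only: step True)
      then have "gen (X i) * (gen (X i) * cell j) \<in> ?M" using j by (intro twice) simp_all
      then show ?thesis by (simp only: step True)
    next
      case False
      show ?thesis
      proof (cases "k = 2 * n")
        case True
        \<comment> \<open>Here \<open>j\<close> is odd, so that \<open>i = N1\<close>, and \<open>cell (2 * n)\<close> is absorbed by \<open>E1\<close>.\<close>
        have "even k" using True by simp
        then have "i = N1" using False Suc by (cases i) (auto simp: i'_def)
        have "gen (X i) * cell k = X1 * ((X0 * X1) ^ n * E0)"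
          by (simp add: \<open>i = N1\<close> True cell_even)
        also have "eqv n \<dots> (X1 * (E1 * (X0 * X1) ^ n))"
          using eqv_rel[OF B_rel.swap0[of n]] by (intro eqv_left) (simp add: alt_from_even)
        also have "\<dots> = (X1 * E1) * (X0 * X1) ^ n"
          by (simp only: mult.assoc)
        also have "eqv n \<dots> (scalar par_l * E1 * (X0 * X1) ^ n)"
          by (intro eqv_right eqv_rel B_rel.absorb_left)
        also have "\<dots> = scalar par_l * (E1 * (X0 * X1) ^ n)"
          by (simp only: mult.assoc)
        also have "eqv n \<dots> (scalar par_l * cell (2 * n))"
          using eqv_sym[OF eqv_rel[OF B_rel.swap0[of n]]] by (intro eqv_left) (simp add: alt_from_even cell_even)
        finally show ?thesis by (rule combs_eqv) (intro combs_scale mem, simp)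
      next
        case False': False
        have "(if even k then X1 else X0) = gen (X i)"
          using False Suc by (cases i) (auto simp: i'_def)
        then have "gen (X i) * cell k = cell (Suc k)" by (simp only: cell_Suc)
        then show ?thesis using mem[of "Suc k"] False' k by simp
      qed
    qed
  qed
  show ?thesis
  proof (cases g)
    case (Xinv i)
    have "eqv n (gen (Xinv i) * cell k) ((gen (X i) - scalar par_m * (gen (E i) - 1)) * cell k)"
      by (intro eqv_right Xinv_expand)
    also have "\<dots> = gen (X i) * cell k - scalar par_m * (gen (E i) * cell k - cell k)"
      by (simp add: left_diff_distrib mult.assoc)
    finally show ?thesis
      unfolding Xinv by (rule combs_eqv) (intro combs_diff combs_scale X E mem k)
  qed (simp_all add: X E k)
qed

lemma left_E0: "a * E0 \<in> combs n cell {..2 * n}"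
proof -
  let ?M = "{a. a * E0 \<in> combs n cell {..2 * n}}"
  have "a \<in> ?M"
  proof (rule subspace_eq_UNIV_if_gen_stable)
    show "1 \<in> ?M"
      using combs_member[of "{..2 * n}" 0 cell n] by (simp add: cell_0)
    show "a + b \<in> ?M" if "a \<in> ?M" "b \<in> ?M" for a b
      using that by (simp add: distrib_right combs_add)
    show "scalar c * a \<in> ?M" if "a \<in> ?M" for c a
      using that by (simp add: mult.assoc combs_scale)
    show "gen g * a \<in> ?M" if "a \<in> ?M" for g a
    proof -
      have "gen g * (a * E0) \<in> combs n cell {..2 * n}"
        by (rule combs_mult_left[of _ n cell "{..2 * n}"]) (use that gen_cell in simp_all)
      then show ?thesis by (simp add: mult.assoc)
    qed
  qed
  then show ?thesis by simp
qed

lemma star_cell: "star (cell k) = E0 * alt_from k X1 X0"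
  by (simp add: cell_def star_mult star_alt_to)

lemma star_scale: "star (scalar c * a) = scalar c * star a"
  by (simp only: star_mult star_scalar scalar_central)

lemma right_E0: "E0 * b \<in> combs n (\<lambda>k. E0 * alt_from k X1 X0) {..2 * n}"
proof -
  obtain c where c: "eqv n (star b * E0) (\<Sum>k\<le>2 * n. scalar (c k) * cell k)"
    using left_E0[of "star b" n] unfolding combs_def mem_Collect_eq by (rule exE)
  have "star (\<Sum>k\<le>2 * n. scalar (c k) * cell k) = (\<Sum>k\<le>2 * n. scalar (c k) * (E0 * alt_from k X1 X0))"
    by (simp only: star_sum star_scale star_cell)
  moreover have "star (star b * E0) = E0 * b"
    by (simp only: star_mult star_star star_gen)
  ultimately have "eqv n (E0 * b) (\<Sum>k\<le>2 * n. scalar (c k) * (E0 * alt_from k X1 X0))"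
    using eqv_star[OF c] by (simp only:)
  then show ?thesis unfolding combs_def mem_Collect_eq by (rule exI[of _ c])
qed

definition sigma1 :: "nat \<times> nat \<Rightarrow> free_alg" where
  "sigma1 = (\<lambda>(k, j). alt_to k X0 X1 * E0 * alt_from j X1 X0)"

text \<open>The reduced words of the dihedral group, labelled by integers: the absolute value is the length and
  the sign tells the first letter. The longest element, which has two reduced words, appears once, as
  \<open>- (2 n + 1)\<close>.\<close>

definition sigma2 :: "int \<Rightarrow> free_alg" where
  "sigma2 k = (if 0 \<le> k then alt_from (nat k) X1 X0 else alt_from (nat (- k)) X0 X1)"

definition sigma :: "nat \<times> nat + int \<Rightarrow> free_alg" where
  "sigma = case_sum sigma1 sigma2"

definition index1 :: "nat \<Rightarrow> (nat \<times> nat) set" where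
  "index1 n = {..2 * n} \<times> {..2 * n}"

definition index2 :: "nat \<Rightarrow> int set" where
  "index2 n = {- int (2 * n + 1)..int (2 * n)}"

definition index :: "nat \<Rightarrow> (nat \<times> nat + int) set" where
  "index n = index1 n <+> index2 n"

lemma finite_index: "finite (index1 n)" "finite (index2 n)" "finite (index n)"
  by (simp_all add: index1_def index2_def index_def)

text \<open>Combining the left and the right spanning result: \<open>a * E0 * b\<close> is first expanded in \<open>a\<close>, then in \<open>b\<close>.\<close>

lemma two_sided_E0: "a * E0 * b \<in> combs n sigma1 (index1 n)"
proof (rule combs_mult_right[OF left_E0])
  fix k assume k: "k \<in> {..2 * n}"
  have "alt_to k X0 X1 * (E0 * b) \<in> combs n sigma1 (index1 n)"
  proof (rule combs_mult_left[OF right_E0])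
    fix j assume "j \<in> {..2 * n}"
    with k have "sigma1 (k, j) \<in> combs n sigma1 (index1 n)"
      using combs_member[of "index1 n" "(k, j)" sigma1 n] finite_index by (simp add: index1_def)
    then show "alt_to k X0 X1 * (E0 * alt_from j X1 X0) \<in> combs n sigma1 (index1 n)"
      by (simp add: sigma1_def mult.assoc)
  qed
  then show "cell k * b \<in> combs n sigma1 (index1 n)"
    by (simp add: cell_def mult.assoc)
qed

lemma sigma_member: "i \<in> index n \<Longrightarrow> sigma i \<in> combs n sigma (index n)"
  using combs_member[of "index n" i sigma n] finite_index by simp

lemma two_sided_E: "a * gen (E i) * b \<in> combs n sigma (index n)"
proof -
  have E0: "a * E0 * b \<in> combs n sigma (index n)" for a b
  proof (rule combs_mono[OF two_sided_E0])
    fix p assume "p \<in> index1 n"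
    then show "sigma1 p \<in> combs n sigma (index n)"
      using sigma_member[of "Inl p" n] by (auto simp: index_def sigma_def)
  qed
  show ?thesis
  proof (cases i)
    case N1
    have "a * E1 * b = a * (E1 * (X0 * X1) ^ 0) * b" by simp
    also have "eqv n \<dots> (a * ((X0 * X1) ^ n * (E0 * (Y1 * Y0) ^ (n - 0))) * b)"
      by (intro eqv_left eqv_right E1_rotation) simp
    also have "\<dots> = (a * (X0 * X1) ^ n) * E0 * ((Y1 * Y0) ^ n * b)"
      by (simp add: mult.assoc)
    finally show ?thesis
      unfolding N1 by (rule combs_eqv) (rule E0)
  qed (simp add: E0)
qed

lemma sigma2_member:
  assumes "- int (2 * n + 1) \<le> k" "k \<le> int (2 * n)"
  shows "sigma2 k \<in> combs n sigma (index n)"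
proof -
  have "Inr k \<in> index n" unfolding index_def by (rule InrI) (use assms in \<open>simp add: index2_def\<close>)
  from sigma_member[OF this] show ?thesis by (simp add: sigma_def)
qed

text \<open>Multiplication by a letter lengthens a word or, if it starts with this letter, is resolved by the
  quadratic relation. The braid relation is needed where the longest element is reached.\<close>

lemma X_sigma2:
  assumes k: "k \<in> index2 n" and n: "n \<ge> 1"
  shows "gen (X i) * sigma2 k \<in> combs n sigma (index n)"
proof -
  let ?M = "combs n sigma (index n)"
  have up: "alt_from j X1 X0 \<in> ?M" if "j \<le> 2 * n" for j
    using sigma2_member[of n "int j"] that by (simp add: sigma2_def)
  have dn: "alt_from j X0 X1 \<in> ?M" if "j \<le> 2 * n + 1" for j
    using sigma2_member[of n "- int j"] that by (cases "j = 0") (simp_all add: sigma2_def)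
  have top: "alt_from (2 * n + 1) X1 X0 \<in> ?M"
    by (rule combs_eqv[OF eqv_sym[OF eqv_rel[OF B_rel.braid]]], rule dn) simp
  have twice: "gen (X i) * (gen (X i) * w) \<in> ?M" if "w \<in> ?M" "gen (X i) * w \<in> ?M" for i w
    using two_sided_E[of 1 i w n] that
    by (intro combs_eqv[OF X_X_left[of n i w]] combs_add combs_diff combs_scale) simp_all
  show ?thesis
  proof (cases "0 \<le> k")
    case True
    then obtain j where j: "k = int j" using zero_le_imp_eq_int[OF True] by blast
    with k have j2: "j \<le> 2 * n" by (simp add: index2_def)
    show ?thesis
    proof (cases i)
      case N0
      then show ?thesis using dn[of "Suc j"] j j2 by (simp add: sigma2_def)
    next
      case N1
      show ?thesis
      proof (cases j)
        case 0
        then show ?thesis using up[of 1] n N1 j by (simp add: sigma2_def)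
      next
        case (Suc j')
        then show ?thesis using twice[of "alt_from j' X0 X1" N1] dn[of j'] up[of j] j2 N1 j
          by (simp add: sigma2_def nat_add_distrib)
      qed
    qed
  next
    case False
    then obtain j where j: "k = - int (Suc j)"
      by (cases k rule: int_cases) auto
    with k have j2: "j \<le> 2 * n" by (simp add: index2_def)
    have s: "sigma2 k = alt_from (Suc j) X0 X1"
      by (simp add: sigma2_def j nat_add_distrib)
    show ?thesis
    proof (cases i)
      case N0
      then show ?thesis
        unfolding s using twice[of "alt_from j X1 X0" N0] up[of j] dn[of "Suc j"] j2 by simp
    next
      case N1
      consider "Suc j \<le> 2 * n - 1" | "Suc j = 2 * n" | "j = 2 * n" using j2 n by linarith
      then show ?thesis
      proof cases
        case 1
        then show ?thesis unfolding s using up[of "Suc (Suc j)"] N1 by simp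
      next
        case 2
        then have "2 * n + 1 = Suc (Suc j)" by simp
        then show ?thesis unfolding s using top N1 by simp
      next
        case 3
        have "eqv n (X1 * alt_from (Suc j) X0 X1) (X1 * alt_from (Suc j) X1 X0)"
          using eqv_rel[OF B_rel.braid[of n]] 3 by (intro eqv_left) simp
        moreover have "X1 * (X1 * alt_from j X0 X1) \<in> ?M"
          using twice[of "alt_from j X0 X1" N1] dn[of j] top 3 by simp
        ultimately show ?thesis unfolding s N1 using 3 by (simp add: combs_eqv)
      qed
    qed
  qed
qed

theorem sigma_spans:
  assumes n: "n \<ge> 1"
  shows "a \<in> combs n sigma (index n)"
proof (rule subspace_eq_UNIV_if_gen_stable)
  let ?M = "combs n sigma (index n)"
  show "1 \<in> ?M" using sigma2_member[of n 0] by (simp add: sigma2_def)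
  have E: "gen (E i) * a \<in> ?M" for i a
    using two_sided_E[of 1 i a n] by simp
  have X: "gen (X i) * a \<in> ?M" if "a \<in> ?M" for i a
    using that
  proof (rule combs_mult_left)
    fix p assume p: "p \<in> index n"
    show "gen (X i) * sigma p \<in> ?M"
    proof (cases p)
      case (Inl q)
      then show ?thesis
        using two_sided_E[of "gen (X i) * alt_to (fst q) X0 X1" N0 "alt_from (snd q) X1 X0" n]
        by (simp add: sigma_def sigma1_def case_prod_unfold mult.assoc)
    next
      case (Inr k)
      then show ?thesis using X_sigma2[OF _ n] p by (auto simp: sigma_def index_def)
    qed
  qed
  show "gen g * a \<in> ?M" if a: "a \<in> ?M" for g a
  proof (cases g)
    case (Xinv i)
    have "eqv n (gen (Xinv i) * a) ((gen (X i) - scalar par_m * (gen (E i) - 1)) * a)"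
      by (intro eqv_right Xinv_expand)
    also have "\<dots> = gen (X i) * a - scalar par_m * (gen (E i) * a - a)"
      by (simp add: left_diff_distrib mult.assoc)
    finally show ?thesis
      unfolding Xinv by (rule combs_eqv) (intro combs_diff combs_scale X E a)
  qed (simp_all add: X E a)
qed (simp_all add: combs_add combs_scale)


section \<open>The module of dimension \<open>2n + 1\<close>\<close>

lemma par_l_nz [simp]: "par_l \<noteq> 0" and par_m_nz [simp]: "par_m \<noteq> 0"
  using par_l_gt_1 par_m_gt_par_l by auto

lemma par_m_tau: "par_m * (tau - 1) = par_l - inverse par_l"
  by (simp add: tau_def)

lemma tau_pos: "tau > 0"
proof -
  have "inverse par_l < par_l"
    using par_l_gt_1 by (meson inverse_less_1_iff less_trans not_le order_less_imp_le)
  moreover have "par_m > 0" using par_l_gt_1 par_m_gt_par_l by simp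
  ultimately have "(par_l - inverse par_l) / par_m > 0" by simp
  then show ?thesis by (simp add: tau_def)
qed

text \<open>The two sums below run over differences that change sign under reversal, which makes them
  symmetric in the number of terms. The half twist squares to a scalar for this reason.\<close>

lemma sum_antisymmetric:
  fixes f :: "nat \<Rightarrow> ratfun"
  assumes f: "\<And>i. 1 \<le> i \<Longrightarrow> i \<le> M \<Longrightarrow> f (M + 1 - i) = - f i" and j: "j \<le> M"
  shows "(\<Sum>i=1..M - j. f i) = (\<Sum>i=1..j. f i)"
  using j
proof (induction j)
  case 0
  have "(\<Sum>i=1..M. f i) = (\<Sum>i=1..M. f (M + 1 - i))"
    by (rule sum.atLeastAtMost_rev)
  also have "\<dots> = - (\<Sum>i=1..M. f i)"
    unfolding sum_negf[symmetric] by (intro sum.cong) (use f in auto)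
  finally show ?case by simp
next
  case (Suc j)
  have "M - j = Suc (M - Suc j)" using Suc.prems by simp
  then have "(\<Sum>i=1..M - j. f i) = (\<Sum>i=1..M - Suc j. f i) + f (M - j)" by simp
  moreover have "f (M - j) = - f (Suc j)"
    using f[of "Suc j"] Suc.prems by simp
  ultimately show ?case using Suc by simp
qed

lemma sum_telescope_down: "(\<Sum>t=1..j::nat. u (t - 1) - u t) = u 0 - (u j :: ratfun)"
  by (induction j) simp_all

text \<open>The module is the dual of \<open>B E0\<close>, turned into a left module by \<open>star\<close>. With \<open>D = X0 X1\<close>, the left ideal
  has the basis \<open>D^j E0\<close> for \<open>0 \<le> j \<le> 2 n\<close>, on which \<open>D^(2 n + 1)\<close> is \<open>l\<^sup>2\<close>; the number \<open>u j\<close> is the value of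
  the linear form \<open>u\<close> at \<open>D^j E0\<close>. The transpose of \<open>D\<close> is therefore a shift which multiplies by \<open>l\<^sup>2\<close>
  when it wraps around.\<close>

definition shift :: "nat \<Rightarrow> nat \<Rightarrow> (nat \<Rightarrow> ratfun) \<Rightarrow> nat \<Rightarrow> ratfun" where
  "shift n i u j =
    (if 2 * n < j then 0 else if j + i \<le> 2 * n then u (j + i) else par_l\<^sup>2 * u (j + i - (2 * n + 1)))"

definition low_sum :: "nat \<Rightarrow> (nat \<Rightarrow> ratfun) \<Rightarrow> nat \<Rightarrow> ratfun" where
  "low_sum n u j = (\<Sum>i=1..j. u (n + 1 - i) - u (i - 1))"

definition high_sum :: "nat \<Rightarrow> (nat \<Rightarrow> ratfun) \<Rightarrow> nat \<Rightarrow> ratfun" where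
  "high_sum n u j = (\<Sum>i=1..j. u (2 * n + 1 - i) - u (n + i))"

text \<open>The action of the alternating word of length \<open>2 n + 1\<close>. The formula is found by applying \<open>X0\<close> to
  \<open>D^j E0\<close> recursively with the help of the skein relation. The inverse differs from it by a scalar only, by
  \<open>halftwist_halftwist\<close>.\<close>

definition halftwist :: "nat \<Rightarrow> (nat \<Rightarrow> ratfun) \<Rightarrow> nat \<Rightarrow> ratfun" where
  "halftwist n u j =
    (if j \<le> n then par_l * u (n - j) + par_m * high_sum n u j
     else if j \<le> 2 * n then par_l * u (3 * n + 1 - j) + par_m * par_l\<^sup>2 * low_sum n u (j - n)
     else 0)"

definition halftwist_inv :: "nat \<Rightarrow> (nat \<Rightarrow> ratfun) \<Rightarrow> nat \<Rightarrow> ratfun" where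
  "halftwist_inv n u = (\<lambda>j. inverse (par_l\<^sup>2) * halftwist n u j)"

text \<open>For \<open>j \<le> 2 n\<close> these are the scalars with \<open>E0 D^j E0 = phi n j * E0\<close>.\<close>

definition phi :: "nat \<Rightarrow> nat \<Rightarrow> ratfun" where
  "phi n j = (if j = 0 then tau else if j \<le> n then 1 else if j \<le> 2 * n then par_l\<^sup>2 else 0)"

definition V_e :: "nat \<Rightarrow> (nat \<Rightarrow> ratfun) \<Rightarrow> nat \<Rightarrow> ratfun" where
  "V_e n u = (\<lambda>j. u 0 * phi n j)"

text \<open>The half twist is the word \<open>X0 (X1 X0)^n\<close>, and \<open>(X1 X0)^(- n)\<close> is the shift by \<open>n + 1\<close> up to \<open>l\<^sup>2\<close>.\<close>

definition V_x :: "nat \<Rightarrow> (nat \<Rightarrow> ratfun) \<Rightarrow> nat \<Rightarrow> ratfun" where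
  "V_x n u = halftwist_inv n (shift n (n + 1) u)"

definition V_y :: "nat \<Rightarrow> (nat \<Rightarrow> ratfun) \<Rightarrow> nat \<Rightarrow> ratfun" where
  "V_y n u = shift n n (halftwist_inv n u)"

fun V_op0 :: "nat \<Rightarrow> letter \<Rightarrow> (nat \<Rightarrow> ratfun) \<Rightarrow> nat \<Rightarrow> ratfun" where
  "V_op0 n (X i) = V_x n"
| "V_op0 n (Xinv i) = V_y n"
| "V_op0 n (E i) = V_e n"

fun letter_node :: "letter \<Rightarrow> node" where
  "letter_node (X i) = i" | "letter_node (Xinv i) = i" | "letter_node (E i) = i"

text \<open>Conjugation with the half twist exchanges the two nodes, so that the operators for \<open>N1\<close> are defined,
  and the relations between them proved, by transport.\<close>

definition V_op :: "nat \<Rightarrow> letter \<Rightarrow> (nat \<Rightarrow> ratfun) \<Rightarrow> nat \<Rightarrow> ratfun" where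
  "V_op n g u = (case letter_node g of N0 \<Rightarrow> V_op0 n g u
    | N1 \<Rightarrow> halftwist n (V_op0 n g (halftwist_inv n u)))"

definition V_space :: "nat \<Rightarrow> (nat \<Rightarrow> ratfun) set" where
  "V_space n = {u. \<forall>j>2 * n. u j = 0}"

lemma V_space_eqI:
  assumes "u \<in> V_space n" "v \<in> V_space n" "\<And>j. j \<le> 2 * n \<Longrightarrow> u j = v j"
  shows "u = v"
proof
  fix j show "u j = v j" using assms by (cases "j \<le> 2 * n") (simp_all add: V_space_def)
qed

lemma halftwist_low: "j \<le> n \<Longrightarrow> halftwist n u j = par_l * u (n - j) + par_m * high_sum n u j"
  by (simp add: halftwist_def)

lemma halftwist_high:
  "1 \<le> i \<Longrightarrow> i \<le> n \<Longrightarrow>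
    halftwist n u (n + i) = par_l * u (2 * n + 1 - i) + par_m * par_l\<^sup>2 * low_sum n u i"
  by (simp add: halftwist_def)

lemma par_l_square_cancel [simp]:
  "inverse (par_l\<^sup>2) * (par_l\<^sup>2 * x) = x" "par_l\<^sup>2 * (inverse (par_l\<^sup>2) * x) = x"
  by (simp_all add: mult.assoc[symmetric])

lemma V_space_shift: "shift n i u \<in> V_space n"
  and V_space_halftwist: "halftwist n u \<in> V_space n"
  and V_space_e: "V_e n u \<in> V_space n"
  by (simp_all add: V_space_def shift_def halftwist_def V_e_def phi_def)

lemma V_space_scale: "u \<in> V_space n \<Longrightarrow> (\<lambda>j. c * u j) \<in> V_space n"
  by (simp add: V_space_def)

lemma V_space_halftwist_inv: "halftwist_inv n u \<in> V_space n"
  unfolding halftwist_inv_def by (intro V_space_scale V_space_halftwist)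

lemma V_space_op0: "V_op0 n g u \<in> V_space n"
  by (cases g) (simp_all add: V_x_def V_y_def V_space_shift V_space_halftwist_inv V_space_e)

lemma low_sum_symmetric: "i \<le> n + 1 \<Longrightarrow> low_sum n u (n + 1 - i) = low_sum n u i"
  unfolding low_sum_def
  by (rule sum_antisymmetric) (auto simp: Suc_diff_le)

lemma high_sum_symmetric: "i \<le> n \<Longrightarrow> high_sum n u (n - i) = high_sum n u i"
  unfolding high_sum_def
proof (rule sum_antisymmetric)
  fix i assume i: "1 \<le> i" "i \<le> n"
  have "2 * n + 1 - (n + 1 - i) = n + i" "n + (n + 1 - i) = 2 * n + 1 - i" using i by auto
  then show "u (2 * n + 1 - (n + 1 - i)) - u (n + (n + 1 - i)) = - (u (2 * n + 1 - i) - u (n + i))"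
    by simp
qed

text \<open>In \<open>halftwist\<close>, the leading term is an involution times \<open>l\<close>, and the sums change sign under that
  involution on one side but not on the other. So the mixed terms cancel, and the sums compose to zero.\<close>

lemma halftwist_halftwist:
  assumes u: "u \<in> V_space n"
  shows "halftwist n (halftwist n u) = (\<lambda>j. par_l\<^sup>2 * u j)"
proof (rule V_space_eqI[OF V_space_halftwist V_space_scale[OF u]])
  fix j assume "j \<le> 2 * n"
  then consider "j \<le> n" | i where "j = n + i" "1 \<le> i" "i \<le> n"
    using that(1) that(2)[of "j - n"] by linarith
  then show "halftwist n (halftwist n u) j = par_l\<^sup>2 * u j"
  proof cases
    case 1
    have "high_sum n (halftwist n u) j = (\<Sum>i=1..j. - (par_l * (u (2 * n + 1 - i) - u (n + i))))"
      unfolding high_sum_def[of n "halftwist n u"]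
    proof (rule sum.cong)
      fix i assume "i \<in> {1..j}"
      with 1 have i: "1 \<le> i" "i \<le> n" by auto
      have *: "2 * n + 1 - i = n + (n + 1 - i)" "2 * n + 1 - (n + 1 - i) = n + i" using i by auto
      have "halftwist n u (2 * n + 1 - i) = par_l * u (n + i) + par_m * par_l\<^sup>2 * low_sum n u i"
        unfolding *(1) using i halftwist_high[of "n + 1 - i" n u] low_sum_symmetric[of i n u]
        by (simp only: *)
      then show "halftwist n u (2 * n + 1 - i) - halftwist n u (n + i) = - (par_l * (u (2 * n + 1 - i) - u (n + i)))"
        using halftwist_high[OF i, of u] by (simp add: algebra_simps)
    qed simp
    then have "high_sum n (halftwist n u) j = - (par_l * high_sum n u j)"
      by (simp only: sum_negf sum_distrib_left[symmetric] high_sum_def)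
    then show ?thesis
      using 1 high_sum_symmetric[OF 1, of u] by (simp add: halftwist_low algebra_simps power2_eq_square)
  next
    case (2 i)
    have *: "2 * n + 1 - i = n + (n + 1 - i)" "2 * n + 1 - (n + 1 - i) = n + i" using 2 by auto
    have "halftwist n u (2 * n + 1 - i) = par_l * u (n + i) + par_m * par_l\<^sup>2 * low_sum n u i"
      unfolding *(1) using 2 halftwist_high[of "n + 1 - i" n u] low_sum_symmetric[of i n u]
      by (simp only: *)
    moreover have "low_sum n (halftwist n u) i = (\<Sum>t=1..i. - (par_l * (u (n + 1 - t) - u (t - 1))))"
      unfolding low_sum_def
    proof (rule sum.cong)
      fix t assume "t \<in> {1..i}"
      with 2 have t: "1 \<le> t" "t \<le> n" by auto
      have *: "n - (n + 1 - t) = t - 1" "n - (t - 1) = n + 1 - t" using t by auto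
      show "halftwist n u (n + 1 - t) - halftwist n u (t - 1) = - (par_l * (u (n + 1 - t) - u (t - 1)))"
        using t halftwist_low[of "n + 1 - t" n u] halftwist_low[of "t - 1" n u]
          high_sum_symmetric[of "t - 1" n u]
        by (simp only: *) (simp add: algebra_simps)
    qed simp
    then have "low_sum n (halftwist n u) i = - (par_l * low_sum n u i)"
      by (simp only: sum_negf sum_distrib_left[symmetric] low_sum_def)
    moreover have "halftwist n (halftwist n u) j = par_l * halftwist n u (2 * n + 1 - i)
        + par_m * par_l\<^sup>2 * low_sum n (halftwist n u) i"
      using 2(1) halftwist_high[OF 2(2,3), of "halftwist n u"] by simp
    ultimately show ?thesis
      unfolding 2(1) by (simp only:) (simp add: algebra_simps power2_eq_square)
  qed
qed

lemma halftwist_add: "halftwist n (\<lambda>i. u i + v i) = (\<lambda>i. halftwist n u i + halftwist n v i)"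
  and halftwist_scale: "halftwist n (\<lambda>i. c * u i) = (\<lambda>i. c * halftwist n u i)"
proof -
  have "low_sum n (\<lambda>i. u i + v i) j = low_sum n u j + low_sum n v j"
    "high_sum n (\<lambda>i. u i + v i) j = high_sum n u j + high_sum n v j"
    "low_sum n (\<lambda>i. c * u i) j = c * low_sum n u j"
    "high_sum n (\<lambda>i. c * u i) j = c * high_sum n u j" for j
    by (simp_all add: low_sum_def high_sum_def sum.distrib sum_subtractf
        sum_distrib_left[symmetric] right_diff_distrib[symmetric])
  then show "halftwist n (\<lambda>i. u i + v i) = (\<lambda>i. halftwist n u i + halftwist n v i)"
    "halftwist n (\<lambda>i. c * u i) = (\<lambda>i. c * halftwist n u i)"
    by (simp_all add: halftwist_def fun_eq_iff algebra_simps)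
qed

lemma shift_add: "shift n k (\<lambda>i. u i + v i) = (\<lambda>i. shift n k u i + shift n k v i)"
  and shift_scale: "shift n k (\<lambda>i. c * u i) = (\<lambda>i. c * shift n k u i)"
  by (simp_all add: shift_def fun_eq_iff algebra_simps)

lemma halftwist_inv_add: "halftwist_inv n (\<lambda>i. u i + v i) = (\<lambda>i. halftwist_inv n u i + halftwist_inv n v i)"
  and halftwist_inv_scale: "halftwist_inv n (\<lambda>i. c * u i) = (\<lambda>i. c * halftwist_inv n u i)"
  by (simp_all add: halftwist_inv_def halftwist_add halftwist_scale distrib_left mult.left_commute)

lemma V_op0_add: "V_op0 n g (\<lambda>i. u i + v i) = (\<lambda>i. V_op0 n g u i + V_op0 n g v i)"
  and V_op0_scale: "V_op0 n g (\<lambda>i. c * u i) = (\<lambda>i. c * V_op0 n g u i)"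
  by (cases g; simp add: V_x_def V_y_def V_e_def shift_add shift_scale halftwist_inv_add
      halftwist_inv_scale distrib_right mult.assoc)+

interpretation V: letter_action "V_op n" for n
proof
  show "V_op n g (\<lambda>i. u i + v i) = (\<lambda>i. V_op n g u i + V_op n g v i)" for g u v
    by (simp add: V_op_def V_op0_add halftwist_add halftwist_inv_add split: node.split)
  show "V_op n g (\<lambda>i. c * u i) = (\<lambda>i. c * V_op n g u i)" for g u c
    by (simp add: V_op_def V_op0_scale halftwist_scale halftwist_inv_scale split: node.split)
qed

lemma halftwist_halftwist_inv: "u \<in> V_space n \<Longrightarrow> halftwist n (halftwist_inv n u) = u"
  and halftwist_inv_halftwist: "u \<in> V_space n \<Longrightarrow> halftwist_inv n (halftwist n u) = u"
  by (simp_all add: halftwist_inv_def halftwist_scale halftwist_halftwist)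

lemma halftwist_eq: "halftwist n u = (\<lambda>j. par_l\<^sup>2 * halftwist_inv n u j)"
  by (simp add: halftwist_inv_def)

lemma shift_0: "u \<in> V_space n \<Longrightarrow> shift n 0 u = u"
  by (auto simp: shift_def V_space_def fun_eq_iff)

lemma shift_full: "u \<in> V_space n \<Longrightarrow> shift n (2 * n + 1) u = (\<lambda>j. par_l\<^sup>2 * u j)"
  by (auto simp: shift_def V_space_def fun_eq_iff)

lemma shift_shift: "i + k \<le> 2 * n + 1 \<Longrightarrow> shift n i (shift n k u) = shift n (i + k) u"
  by (rule ext) (auto simp: shift_def algebra_simps)

lemma shift_full': "i + k = 2 * n + 1 \<Longrightarrow> u \<in> V_space n \<Longrightarrow> shift n i (shift n k u) = (\<lambda>j. par_l\<^sup>2 * u j)"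
  using shift_shift[of i k n u] shift_full[of u n] by simp

lemma V_x_V_y: "u \<in> V_space n \<Longrightarrow> V_x n (V_y n u) = u"
  by (simp add: V_x_def V_y_def shift_full' V_space_halftwist_inv halftwist_inv_scale)
     (simp add: halftwist_inv_def halftwist_scale halftwist_halftwist)

lemma V_y_V_x: "u \<in> V_space n \<Longrightarrow> V_y n (V_x n u) = u"
  by (simp add: V_x_def V_y_def halftwist_inv_def halftwist_scale shift_scale halftwist_halftwist
      V_space_shift shift_full')

lemma V_x_0: "V_x n u 0 = par_l * u 0"
  by (simp add: V_x_def halftwist_inv_def halftwist_low high_sum_def shift_def power2_eq_square field_simps)

lemma V_x_low:
  assumes j: "1 \<le> j" "j \<le> n"
  shows "V_x n u j = inverse par_l * u (2 * n + 1 - j) + par_m * (\<Sum>i=1..j. u (n + 1 - i) - u i)"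
proof -
  have "high_sum n (shift n (n + 1) u) j = (\<Sum>i=1..j. par_l\<^sup>2 * (u (n + 1 - i) - u i))"
    unfolding high_sum_def
  proof (rule sum.cong)
    fix i assume "i \<in> {1..j}"
    with j have i: "1 \<le> i" "i \<le> n" by auto
    have "2 * n + 1 - i + (n + 1) - (2 * n + 1) = n + 1 - i" using i by auto
    then have "shift n (n + 1) u (2 * n + 1 - i) = par_l\<^sup>2 * u (n + 1 - i)"
      using i by (auto simp: shift_def)
    moreover have "shift n (n + 1) u (n + i) = par_l\<^sup>2 * u i"
      using i by (auto simp: shift_def)
    ultimately show "shift n (n + 1) u (2 * n + 1 - i) - shift n (n + 1) u (n + i) = par_l\<^sup>2 * (u (n + 1 - i) - u i)"
      by (simp add: algebra_simps)
  qed simp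
  moreover have "shift n (n + 1) u (n - j) = u (2 * n + 1 - j)"
  proof -
    have "n - j + (n + 1) = 2 * n + 1 - j" using j by simp
    then show ?thesis using j by (simp only: shift_def) auto
  qed
  moreover have "par_l\<^sup>2 * (\<Sum>i=1..j. u (n + 1 - i) - u i) = (\<Sum>i=1..j. par_l\<^sup>2 * (u (n + 1 - i) - u i))"
    by (rule sum_distrib_left)
  ultimately have "V_x n u j = inverse (par_l\<^sup>2) *
      (par_l * u (2 * n + 1 - j) + par_m * (par_l\<^sup>2 * (\<Sum>i=1..j. u (n + 1 - i) - u i)))"
    unfolding V_x_def halftwist_inv_def halftwist_low[OF j(2)] by (simp only:)
  moreover have "inverse (par_l\<^sup>2) * (par_l * a + par_m * (par_l\<^sup>2 * b)) = inverse par_l * a + par_m * b" for a b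
    by (simp add: field_simps power2_eq_square)
  ultimately show ?thesis by (simp only:)
qed

lemma V_x_high:
  assumes i: "1 \<le> i" "i \<le> n"
  shows "V_x n u (n + i) = par_l * u (n + 1 - i)
    + par_m * (par_l\<^sup>2 * u 0 - u (n + i) + high_sum n u (i - 1))"
proof -
  let ?w = "shift n (n + 1) u"
  have *: "low_sum n ?w k = par_l\<^sup>2 * u 0 - u (n + k) + high_sum n u (k - 1)" if "1 \<le> k" "k \<le> n" for k
    using that
  proof (induction k rule: nat_induct_at_least)
    case base
    then show ?case by (simp add: low_sum_def high_sum_def shift_def)
  next
    case (Suc k)
    obtain k' where k': "k = Suc k'" using Suc by (cases k) auto
    have "low_sum n ?w (Suc k) = low_sum n ?w k + (?w (n + 1 - Suc k) - ?w k)"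
      by (simp add: low_sum_def)
    moreover have "?w (n + 1 - Suc k) = u (2 * n + 1 - k)"
    proof -
      have "n + 1 - Suc k + (n + 1) = 2 * n + 1 - k" using Suc by simp
      then show ?thesis using Suc by (simp only: shift_def) auto
    qed
    moreover have "?w k = u (n + Suc k)"
      using Suc by (simp add: shift_def add.commute)
    moreover have "high_sum n u k = high_sum n u (k - 1) + (u (2 * n + 1 - k) - u (n + k))"
      unfolding k' by (simp add: high_sum_def)
    ultimately show ?case using Suc by simp
  qed
  have "2 * n + 1 - i + (n + 1) - (2 * n + 1) = n + 1 - i" using i by auto
  then have "?w (2 * n + 1 - i) = par_l\<^sup>2 * u (n + 1 - i)"
    using i by (auto simp: shift_def)
  then have "V_x n u (n + i) = inverse (par_l\<^sup>2) * (par_l * (par_l\<^sup>2 * u (n + 1 - i))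
      + par_m * par_l\<^sup>2 * (par_l\<^sup>2 * u 0 - u (n + i) + high_sum n u (i - 1)))"
    unfolding V_x_def halftwist_inv_def halftwist_high[OF i] *[OF i] by (simp only:)
  moreover have "inverse (par_l\<^sup>2) * (par_l * (par_l\<^sup>2 * a) + par_m * par_l\<^sup>2 * b) = par_l * a + par_m * b" for a b
    by (simp add: field_simps power2_eq_square)
  ultimately show ?thesis by (simp only:)
qed

lemma V_y_0: "V_y n u 0 = inverse par_l * u 0"
proof -
  have "high_sum n u n = 0"
    using high_sum_symmetric[of n n u] by (simp add: high_sum_def)
  then show ?thesis
    by (simp add: V_y_def halftwist_inv_def shift_def halftwist_low power2_eq_square field_simps)
qed

lemma V_y_low:
  assumes j: "1 \<le> j" "j \<le> n"
  shows "V_y n u j = inverse par_l * u (2 * n + 1 - j) + par_m * low_sum n u j"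
  using j halftwist_high[OF j, of u]
  by (simp add: V_y_def halftwist_inv_def shift_def add.commute field_simps power2_eq_square)

lemma V_y_high:
  assumes i: "1 \<le> i" "i \<le> n"
  shows "V_y n u (n + i) = par_l * u (n + 1 - i) + par_m * high_sum n u (i - 1)"
proof -
  have "n + i + n - (2 * n + 1) = i - 1" "n - (i - 1) = n + 1 - i" using i by auto
  then show ?thesis
    using i halftwist_low[of "i - 1" n u]
    by (simp add: V_y_def halftwist_inv_def shift_def field_simps power2_eq_square)
qed

text \<open>The sums in \<open>V_x\<close> and \<open>V_y\<close> differ by a telescoping sum. At the index \<open>0\<close> the relation amounts to the
  definition of \<open>tau\<close>.\<close>

lemma V_skein:
  assumes u: "u \<in> V_space n"
  shows "V_x n u j - V_y n u j = par_m * (V_e n u j - u j)"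
proof -
  consider "j = 0" | "1 \<le> j" "j \<le> n" | i where "j = n + i" "1 \<le> i" "i \<le> n" | "2 * n < j"
    using that(1,2,4) that(3)[of "j - n"] by linarith
  then show ?thesis
  proof cases
    case 1
    have "V_x n u j - V_y n u j = (par_l - inverse par_l) * u 0"
      by (simp add: 1 V_x_0 V_y_0 left_diff_distrib)
    also have "\<dots> = par_m * (tau - 1) * u 0" by (simp only: par_m_tau)
    finally show ?thesis by (simp add: 1 V_e_def phi_def algebra_simps)
  next
    case 2
    have "(\<Sum>i=1..j. u (n + 1 - i) - u i) - low_sum n u j = (\<Sum>t=1..j. u (t - 1) - u t)"
      unfolding low_sum_def sum_subtractf[symmetric] by (intro sum.cong) auto
    then have "(\<Sum>i=1..j. u (n + 1 - i) - u i) = low_sum n u j + (u 0 - u j)"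
      using sum_telescope_down[of u j] by (simp add: algebra_simps)
    then show ?thesis
      using 2 by (simp only: V_x_low V_y_low) (simp add: V_e_def phi_def algebra_simps)
  next
    case (3 i)
    from 3(2,3) show ?thesis
      unfolding 3(1) by (simp only: V_x_high V_y_high) (simp add: V_e_def phi_def algebra_simps)
  next
    case 4
    have "V_x n u \<in> V_space n" "V_y n u \<in> V_space n" "V_e n u \<in> V_space n"
      using V_space_op0[of n "X N0" u] V_space_op0[of n "Xinv N0" u] V_space_e by simp_all
    with 4 u show ?thesis by (simp add: V_space_def)
  qed
qed

lemma V_x_phi: "V_x n (phi n) = (\<lambda>j. par_l * phi n j)"
proof (rule V_space_eqI[of _ n])
  show "V_x n (phi n) \<in> V_space n" using V_space_op0[of n "X N0"] by simp
  show "(\<lambda>j. par_l * phi n j) \<in> V_space n" by (simp add: V_space_def phi_def)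
  fix j assume "j \<le> 2 * n"
  then consider "j = 0" | "1 \<le> j" "j \<le> n" | i where "j = n + i" "1 \<le> i" "i \<le> n"
    using that(1,2) that(3)[of "j - n"] by linarith
  then show "V_x n (phi n) j = par_l * phi n j"
  proof cases
    case 1
    then show ?thesis by (simp add: V_x_0)
  next
    case 2
    then have "(\<Sum>i=1..j. phi n (n + 1 - i) - phi n i) = 0"
      by (intro sum.neutral) (auto simp: phi_def)
    moreover have "phi n (2 * n + 1 - j) = par_l\<^sup>2" using 2 by (auto simp: phi_def)
    ultimately show ?thesis
      using 2 by (simp only: V_x_low) (simp add: phi_def power2_eq_square)
  next
    case (3 i)
    then have "high_sum n (phi n) (i - 1) = 0"
      unfolding high_sum_def by (intro sum.neutral) (auto simp: phi_def)
    then have "V_x n (phi n) j = par_l + par_l\<^sup>2 * (par_m * (tau - 1))"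
      using 3 by (simp add: V_x_high) (simp add: phi_def algebra_simps)
    then show ?thesis
      using 3 unfolding par_m_tau by (simp add: phi_def power2_eq_square algebra_simps)
  qed
qed


lemma V_op_simps [simp]:
  "V_op n (X N0) = V_x n" "V_op n (Xinv N0) = V_y n" "V_op n (E N0) = V_e n"
  "V_op n (X N1) u = halftwist n (V_x n (halftwist_inv n u))"
  "V_op n (Xinv N1) u = halftwist n (V_y n (halftwist_inv n u))"
  "V_op n (E N1) u = halftwist n (V_e n (halftwist_inv n u))"
  by (simp_all add: V_op_def fun_eq_iff)

lemma V_space_xy [simp]: "V_x n u \<in> V_space n" "V_y n u \<in> V_space n"
  using V_space_op0[of n "X N0" u] V_space_op0[of n "Xinv N0" u] by simp_all

lemma V_space_op: "V_op n g u \<in> V_space n"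
  by (simp add: V_op_def V_space_op0 V_space_halftwist split: node.split)

lemmas V_space_intros [simp] =
  V_space_shift V_space_halftwist V_space_halftwist_inv V_space_e V_space_scale V_space_op

lemmas V_linear [simp] = halftwist_scale halftwist_inv_scale shift_scale
  V_op0_scale[of _ "X N0", simplified] V_op0_scale[of _ "Xinv N0", simplified]
  V_op0_scale[of _ "E N0", simplified]

lemmas V_inverse [simp] = V_x_V_y V_y_V_x halftwist_halftwist_inv halftwist_inv_halftwist

text \<open>The exchange of the two nodes.\<close>

fun flip :: "letter \<Rightarrow> letter" where
  "flip (X N0) = X N1" | "flip (X N1) = X N0"
| "flip (Xinv N0) = Xinv N1" | "flip (Xinv N1) = Xinv N0"
| "flip (E N0) = E N1" | "flip (E N1) = E N0"

lemma halftwist_inv_op: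
  assumes "u \<in> V_space n"
  shows "halftwist_inv n (V_op n g u) = V_op n (flip g) (halftwist_inv n u)"
proof -
  have "halftwist n (V_op0 n h (halftwist_inv n (halftwist_inv n u))) = halftwist_inv n (V_op0 n h u)" for h
  proof -
    have "halftwist_inv n (halftwist_inv n u) = (\<lambda>j. inverse (par_l\<^sup>2) * u j)"
      using halftwist_inv_scale[of n "inverse (par_l\<^sup>2)" "halftwist n u"] assms
      by (simp add: halftwist_inv_def[of n u])
    then show ?thesis
      by (simp only: V_op0_scale halftwist_scale halftwist_inv_def)
  qed
  from this[of g] show ?thesis
    by (cases g rule: flip.cases) (simp_all add: V_op_def V_space_op0)
qed

lemma halftwist_inv_alt:
  assumes "u \<in> V_space n"
  shows "halftwist_inv n (V.act n (alt_from k (gen a) (gen b)) u) =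
    V.act n (alt_from k (gen (flip a)) (gen (flip b))) (halftwist_inv n u)"
proof (induction k arbitrary: a b)
  case (Suc k)
  have "V.act n (alt_from k (gen b) (gen a)) u \<in> V_space n"
    using assms by (cases k) (simp_all add: V.act_mult)
  then show ?case by (simp add: V.act_mult halftwist_inv_op Suc)
qed simp

text \<open>The rotation \<open>X1 X0\<close> is the shift by one, and the inverse rotation \<open>Y0 Y1\<close> the shift by \<open>2 n\<close> divided by
  \<open>l\<^sup>2\<close>. The other two rotations are their conjugates under \<open>X0\<close>.\<close>

lemma X1_eq_shift: "u \<in> V_space n \<Longrightarrow> V_op n (X N1) u = shift n (n + 1) (halftwist_inv n u)"
  by (simp add: V_x_def)

lemma X1_eq_shift_V_y: "V_op n (X N1) u = shift n 1 (V_y n u)"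
  by (simp add: V_x_def V_y_def shift_shift)

lemma X1_X0: "u \<in> V_space n \<Longrightarrow> V_op n (X N1) (V_x n u) = shift n 1 u"
  by (simp only: X1_eq_shift_V_y V_y_V_x)

lemma shift_1_inverse: "u \<in> V_space n \<Longrightarrow> shift n (2 * n) (shift n 1 u) = (\<lambda>j. par_l\<^sup>2 * u j)"
  by (rule shift_full') simp_all

lemma Y0_Y1: "u \<in> V_space n \<Longrightarrow> V_y n (V_op n (Xinv N1) u) = (\<lambda>j. inverse (par_l\<^sup>2) * shift n (2 * n) u j)"
  by (simp add: V_y_def halftwist_inv_def halftwist_halftwist shift_shift mult_2)

lemma act_X1X0_power:
  "u \<in> V_space n \<Longrightarrow> i \<le> 2 * n + 1 \<Longrightarrow> V.act n ((X1 * X0) ^ i) u = shift n i u"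
proof (induction i)
  case (Suc i)
  then show ?case by (simp add: V.act_mult X1_X0 shift_shift del: V_op_simps(4))
qed (simp add: shift_0)

lemma act_Y0Y1_power:
  "u \<in> V_space n \<Longrightarrow> i \<le> 2 * n + 1 \<Longrightarrow>
    V.act n ((Y0 * Y1) ^ i) u = (\<lambda>j. inverse (par_l\<^sup>2) * shift n (2 * n + 1 - i) u j)"
proof (induction i)
  case (Suc i)
  have "shift n (2 * n) (shift n (2 * n + 1 - i) u) = (\<lambda>j. par_l\<^sup>2 * shift n (2 * n + 1 - Suc i) u j)"
    using shift_1_inverse[of "shift n (2 * n + 1 - Suc i) u" n] Suc.prems
    by (simp add: shift_shift Suc_diff_le)
  with Suc show ?case
    by (simp add: V.act_mult Y0_Y1 del: V_op_simps(5))
qed (simp add: shift_full[simplified])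

lemma act_X0X1_power:
  assumes "u \<in> V_space n" "i \<le> 2 * n + 1"
  shows "V.act n ((X0 * X1) ^ i) u = V_x n (shift n i (V_y n u))"
  using assms
proof (induction i)
  case (Suc i)
  then show ?case by (simp add: V.act_mult X1_X0 shift_shift del: V_op_simps(4))
qed (simp add: shift_0)

lemma act_Y1Y0_power:
  assumes "u \<in> V_space n"
  shows "V.act n ((Y1 * Y0) ^ i) u = V_x n (V.act n ((Y0 * Y1) ^ i) (V_y n u))"
proof (induction i)
  case (Suc i)
  have "V.act n ((Y0 * Y1) ^ i) (V_y n u) \<in> V_space n"
    by (cases i) (simp_all add: V.act_mult)
  with Suc show ?case by (simp add: V.act_mult del: V_op_simps(5))
qed (simp add: assms)

lemma V_y_phi: "V_y n (phi n) = (\<lambda>j. inverse par_l * phi n j)"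
proof -
  have "phi n \<in> V_space n" by (simp add: V_space_def phi_def)
  then have "phi n = (\<lambda>j. par_l * V_y n (phi n) j)"
    using V_y_V_x[of "phi n" n] V_x_phi[of n] by simp
  then show ?thesis by (simp add: fun_eq_iff field_simps)
qed

lemma V_x_e: "V_x n (V_e n u) = (\<lambda>j. par_l * V_e n u j)"
  and V_y_e: "V_y n (V_e n u) = (\<lambda>j. inverse par_l * V_e n u j)"
  using V_op0_scale[of n "X N0" "u 0" "phi n"] V_op0_scale[of n "Xinv N0" "u 0" "phi n"]
  by (simp_all add: V_e_def V_x_phi V_y_phi mult_ac)

lemma V_e_x: "V_e n (V_x n u) = (\<lambda>j. par_l * V_e n u j)"
  and V_e_y: "V_e n (V_y n u) = (\<lambda>j. inverse par_l * V_e n u j)"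
  by (simp_all add: V_e_def V_x_0 V_y_0 mult.assoc)

lemma V_e_e: "V_e n (V_e n u) = (\<lambda>j. tau * V_e n u j)"
  by (simp add: V_e_def phi_def mult.commute mult.left_commute)

lemma V_e_shift_e:
  assumes "1 \<le> i" "i \<le> 2 * n"
  shows "V_e n (shift n i (V_e n u)) = (\<lambda>j. (if i \<le> n then 1 else par_l\<^sup>2) * V_e n u j)"
  using assms by (auto simp: V_e_def shift_def phi_def)

lemma V_sandwich0:
  assumes "j < n"
  shows "V_e n (V.act n (alt_from (Suc (2 * j)) X1 X0) (V_e n u)) = (\<lambda>i. inverse par_l * V_e n u i)"
proof -
  have "V.act n (alt_from (Suc (2 * j)) X1 X0) (V_e n u) = shift n j (shift n 1 (V_y n (V_e n u)))"
    unfolding alt_from_odd using assms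
    by (simp add: V.act_mult act_X1X0_power X1_eq_shift_V_y del: V_op_simps(4))
  also have "\<dots> = (\<lambda>i. inverse par_l * shift n (Suc j) (V_e n u) i)"
    using assms by (simp add: V_y_e shift_shift)
  finally show ?thesis using assms by (simp add: V_e_shift_e)
qed

lemma V_sandwich_inv0:
  assumes "j < n"
  shows "V_e n (V.act n (alt_from (Suc (2 * j)) Y1 Y0) (V_e n u)) = (\<lambda>i. par_l * V_e n u i)"
proof -
  have "V.act n (alt_from (Suc (2 * j)) Y1 Y0) (V_e n u) = V_x n (V.act n ((Y0 * Y1) ^ Suc j) (V_e n u))"
    unfolding alt_from_odd power_Suc2
    by (simp add: V.act_mult act_Y1Y0_power del: V_op_simps(5))
  also have "\<dots> = V_x n (\<lambda>i. inverse (par_l\<^sup>2) * shift n (2 * n - j) (V_e n u) i)"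
    using assms by (simp only: act_Y0Y1_power V_space_e) simp
  moreover have "\<not> 2 * n - j \<le> n" using assms by auto
  ultimately show ?thesis using assms
    by (simp add: V_e_x V_e_shift_e del: alt_from.simps) (simp add: field_simps)
qed

text \<open>Transport of the sandwich relations from \<open>E0\<close> to \<open>E1\<close> by conjugation with the half twist.\<close>

lemma V_sandwich1:
  assumes u: "u \<in> V_space n"
    and 0: "\<And>u. V_e n (V.act n (alt_from k (gen a) (gen b)) (V_e n u)) = (\<lambda>i. c * V_e n u i)"
    and a: "a = flip a'" "b = flip b'"
  shows "V_op n (E N1) (V.act n (alt_from k (gen a') (gen b')) (V_op n (E N1) u)) = (\<lambda>i. c * V_op n (E N1) u i)"
  by (simp add: halftwist_inv_alt 0 a[symmetric])

lemma V_rel: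
  assumes "B_rel n a b" and u: "u \<in> V_space n"
  shows "V.act n a u = V.act n b u"
  using assms(1)
proof cases
  case (inv_right i)
  then show ?thesis using u by (cases i) (simp_all add: V.act_mult)
next
  case (inv_left i)
  then show ?thesis using u by (cases i) (simp_all add: V.act_mult)
next
  case braid
  have "V.act n (alt_from (Suc (2 * n)) X0 X1) u = halftwist n u"
    unfolding alt_from_odd using u
    by (simp add: V.act_mult act_X0X1_power)
       (simp add: V_x_def shift_full' halftwist_eq)
  moreover have "V.act n (alt_from (Suc (2 * n)) X1 X0) u = halftwist n u"
    unfolding alt_from_odd using u
    by (simp add: V.act_mult act_X1X0_power X1_eq_shift shift_full' halftwist_eq del: V_op_simps(4))
  ultimately show ?thesis using braid by simp
next
  case (skein i)
  have "V_op n (X i) u j - V_op n (Xinv i) u j = par_m * (V_op n (E i) u j - u j)" for j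
  proof (cases i)
    case N0
    then show ?thesis using V_skein[OF u] by simp
  next
    case N1
    let ?w = "halftwist_inv n u"
    have "(\<lambda>j. V_x n ?w j + (- 1) * V_y n ?w j) = (\<lambda>j. par_m * (V_e n ?w j + (- 1) * ?w j))"
      using V_skein[of ?w n] by (simp add: fun_eq_iff)
    from arg_cong[OF this, of "halftwist n"] show ?thesis
      using u by (simp only: halftwist_add halftwist_scale halftwist_halftwist_inv) (simp add: N1 fun_eq_iff)
  qed
  then show ?thesis
    unfolding skein by (simp add: V.act_mult V.act_diff)
next
  case (absorb_left i)
  then show ?thesis by (cases i) (simp_all add: V.act_mult V_x_e)
next
  case (absorb_right i)
  then show ?thesis by (cases i) (simp_all add: V.act_mult V_e_x)
next
  case (square i)
  then show ?thesis by (cases i) (simp_all add: V.act_mult V_e_e)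
next
  case (sandwich0 i)
  then obtain j where j: "2 * i - 1 = Suc (2 * j)" "j < n" by (cases i) auto
  show ?thesis
    unfolding sandwich0 j(1) V.act_mult V.act_gen V_op_simps V.act_scalar by (rule V_sandwich0[OF j(2)])
next
  case (sandwich1 i)
  then obtain j where j: "2 * i - 1 = Suc (2 * j)" "j < n" by (cases i) auto
  have "V_op n (E N1) (V.act n (alt_from (Suc (2 * j)) X0 X1) (V_op n (E N1) u))
      = (\<lambda>i. inverse par_l * V_op n (E N1) u i)"
    by (rule V_sandwich1[OF u V_sandwich0[OF j(2)]]) simp_all
  then show ?thesis unfolding sandwich1 j(1) V.act_mult V.act_gen V.act_scalar .
next
  case (sandwich_inv0 i)
  then obtain j where j: "2 * i - 1 = Suc (2 * j)" "j < n" by (cases i) auto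
  show ?thesis
    unfolding sandwich_inv0 j(1) V.act_mult V.act_gen V_op_simps V.act_scalar by (rule V_sandwich_inv0[OF j(2)])
next
  case (sandwich_inv1 i)
  then obtain j where j: "2 * i - 1 = Suc (2 * j)" "j < n" by (cases i) auto
  have "V_op n (E N1) (V.act n (alt_from (Suc (2 * j)) Y0 Y1) (V_op n (E N1) u))
      = (\<lambda>i. par_l * V_op n (E N1) u i)"
    by (rule V_sandwich1[OF u V_sandwich_inv0[OF j(2)]]) simp_all
  then show ?thesis unfolding sandwich_inv1 j(1) V.act_mult V.act_gen V.act_scalar .
next
  case swap0
  have tw: "V_x n (shift n n w) = halftwist n w" if "w \<in> V_space n" for w
    using that by (simp add: V_x_def shift_full' halftwist_eq)
  show ?thesis
    unfolding swap0 alt_from_even using u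
    by (simp add: V.act_mult act_X0X1_power tw V_y_e V_e_y)
next
  case swap1
  have tw: "shift n n w = V_y n (halftwist n w)" if "w \<in> V_space n" for w
    using that by (simp add: V_y_def)
  have "V_e n (shift n n u) = (\<lambda>j. inverse par_l * V_e n (halftwist n u) j)"
    using u by (simp add: tw V_e_y)
  also have "\<dots> = (\<lambda>j. par_l * V_e n (halftwist_inv n u) j)"
    by (simp add: halftwist_eq power2_eq_square mult.assoc[symmetric])
  also have "\<dots> = shift n n (halftwist n (V_e n (halftwist_inv n u)))"
    by (simp add: tw V_y_e halftwist_halftwist power2_eq_square field_simps)
  finally show ?thesis
    unfolding swap1 alt_from_even using u by (simp add: V.act_mult act_X1X0_power)
qed

interpretation V: B_action "V_op n" "V_space n" n for n
  by unfold_locales (simp add: V_space_def, simp add: V_space_def, simp, simp, rule V_rel)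

lemma phi_in_V_space: "phi n \<in> V_space n"
  by (simp add: V_space_def phi_def)


section \<open>Nondegeneracy of the module of dimension \<open>2n + 1\<close>\<close>

lemma unit_vector_in_V_space: "p \<le> 2 * n \<Longrightarrow> (\<lambda>j. if j = p then 1 else 0) \<in> V_space n"
  by (simp add: V_space_def)

lemma act_even_at_0:
  assumes "u \<in> V_space n" "i \<le> n"
  shows "V.act n (alt_from (2 * i) X1 X0) u 0 = u i"
  unfolding alt_from_even using assms by (simp add: act_X1X0_power shift_def)

lemma act_odd_at_0:
  assumes "u \<in> V_space n" "i < n"
  shows "V.act n (alt_from (Suc (2 * i)) X1 X0) u 0
    = inverse par_l * u (2 * n - i) + par_m * low_sum n u (Suc i)"
proof -
  have "V.act n (alt_from (Suc (2 * i)) X1 X0) u = shift n i (shift n 1 (V_y n u))"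
    unfolding alt_from_odd using assms
    by (simp add: V.act_mult act_X1X0_power X1_eq_shift_V_y del: V_op_simps(4))
  then have "V.act n (alt_from (Suc (2 * i)) X1 X0) u 0 = V_y n u (Suc i)"
    using assms by (simp add: shift_shift) (simp add: shift_def)
  then show ?thesis using assms by (simp add: V_y_low)
qed

text \<open>The functionals for words of even length \<open>2 i\<close> are the coordinates up to \<open>n\<close>, those for words of odd
  length are the coordinates beyond \<open>n\<close>, up to a factor and coordinates up to \<open>n\<close>. The matrix is triangular.\<close>

lemma evaluation_functionals_independent:
  assumes c: "\<And>u. u \<in> V_space n \<Longrightarrow> (\<Sum>k\<le>2 * n. c k * V.act n (alt_from k X1 X0) u 0) = 0"
    and k: "k \<le> 2 * n"
  shows "c k = 0"
proof -
  let ?T = "\<lambda>k u. V.act n (alt_from k X1 X0) u 0"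
  have odd: "c (Suc (2 * i)) = 0" if i: "i < n" for i
  proof -
    let ?u = "\<lambda>j. if j = 2 * n - i then 1 else 0 :: ratfun"
    have u: "?u \<in> V_space n" by (rule unit_vector_in_V_space) simp
    have "?T k ?u = (if k = Suc (2 * i) then inverse par_l else 0)" if k: "k \<le> 2 * n" for k
    proof (cases "even k")
      case True
      then obtain i' where i': "k = 2 * i'" by blast
      have "?T k ?u = ?u i'" unfolding i' by (rule act_even_at_0[OF u]) (use k i' in simp)
      moreover have "k \<noteq> Suc (2 * i)" using i' by presburger
      ultimately show ?thesis using i k i' by (simp del: alt_from.simps)
    next
      case False
      then obtain i' where i': "k = Suc (2 * i')" by (metis oddE Suc_eq_plus1)
      with k have "i' < n" by auto
      have "low_sum n ?u (Suc i') = 0"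
        unfolding low_sum_def using i \<open>i' < n\<close> by (intro sum.neutral) auto
      then have "?T k ?u = inverse par_l * ?u (2 * n - i')"
        unfolding i' using act_odd_at_0[OF u \<open>i' < n\<close>] by (simp del: alt_from.simps)
      then show ?thesis using i i' \<open>i' < n\<close> by auto
    qed
    then have "(\<Sum>k\<le>2 * n. c k * ?T k ?u) = (\<Sum>k\<le>2 * n. if k = Suc (2 * i) then c k * inverse par_l else 0)"
      by (intro sum.cong) auto
    also have "\<dots> = c (Suc (2 * i)) * inverse par_l"
      using i by (simp add: sum.delta)
    finally show ?thesis using c[OF u] by simp
  qed
  have even: "c (2 * i) = 0" if i: "i \<le> n" for i
  proof -
    let ?u = "\<lambda>j. if j = i then 1 else 0 :: ratfun"
    have u: "?u \<in> V_space n" by (rule unit_vector_in_V_space) (use i in simp)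
    have "c k * ?T k ?u = (if k = 2 * i then c k else 0)" if k: "k \<le> 2 * n" for k
    proof (cases "even k")
      case True
      then obtain i' where i': "k = 2 * i'" by blast
      have "?T k ?u = ?u i'" unfolding i' by (rule act_even_at_0[OF u]) (use k i' in simp)
      then show ?thesis using i' by auto
    next
      case False
      then obtain i' where i': "k = Suc (2 * i')" by (metis oddE Suc_eq_plus1)
      with k show ?thesis using odd[of i'] by auto
    qed
    then have "(\<Sum>k\<le>2 * n. c k * ?T k ?u) = (\<Sum>k\<le>2 * n. if k = 2 * i then c k else 0)"
      by (intro sum.cong) auto
    also have "\<dots> = c (2 * i)" using i by (simp add: sum.delta)
    finally show ?thesis using c[OF u] by simp
  qed
  show ?thesis
  proof (cases "even k")
    case True
    then show ?thesis using even k by auto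
  next
    case False
    then obtain i where "k = Suc (2 * i)" by (metis oddE Suc_eq_plus1)
    then show ?thesis using odd k by auto
  qed
qed

text \<open>The orbit of \<open>phi\<close> under the rotation spans the module. The entries of \<open>phi\<close> are constant apart from few
  jumps, so that the differences of consecutive equations for \<open>x\<close> have few terms: they express
  \<open>l\<^sup>2 - 1 = (tau - 1) m l\<close> times one entry of \<open>x\<close> by \<open>tau - 1\<close> times two others. Because \<open>m\<close> is
  much larger than \<open>l\<close>, an entry of maximal size must vanish.\<close>

lemma orbit_of_phi_nondegenerate:
  assumes x: "\<And>i. i \<le> 2 * n \<Longrightarrow> (\<Sum>j\<le>2 * n. x j * shift n i (phi n) j) = 0" and j: "j \<le> 2 * n"
  shows "x j = 0"
proof -
  let ?g = "\<lambda>i. \<Sum>j\<le>2 * n. x j * shift n i (phi n) j"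
  let ?d = "\<lambda>k. if k \<le> 2 * n then x k else 0"
  have g: "?g i = 0" if "i \<le> 2 * n + 1" for i
  proof (cases "i = 2 * n + 1")
    case True
    have "?g i = par_l\<^sup>2 * ?g 0"
      unfolding True shift_full[OF phi_in_V_space] shift_0[OF phi_in_V_space] sum_distrib_left
      by (simp add: mult.left_commute)
    then show ?thesis using x[of 0] by simp
  next
    case False
    then show ?thesis using that x by simp
  qed
  \<comment> \<open>An entry of maximal size will be bounded by a small multiple of itself.\<close>
  define M where "M = Max ((\<lambda>j. \<bar>x j\<bar>) ` {..2 * n})"
  have M: "\<bar>x j\<bar> \<le> M" if "j \<le> 2 * n" for j
    unfolding M_def using that by (intro Max_ge) auto
  have M0: "0 \<le> M" using M[of 0] by (simp add: order_trans[OF abs_ge_zero])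
  have l2: "par_l\<^sup>2 - 1 = (tau - 1) * (par_m * par_l)"
  proof -
    have "(tau - 1) * (par_m * par_l) = par_m * (tau - 1) * par_l" by (simp add: mult_ac)
    also have "\<dots> = par_l\<^sup>2 - 1" unfolding par_m_tau by (simp add: left_diff_distrib power2_eq_square)
    finally show ?thesis by simp
  qed
  have t: "tau - 1 \<noteq> 0"
  proof
    assume "tau - 1 = 0"
    then have "par_l\<^sup>2 = 1" using l2 by simp
    then show False using par_l_gt_1 by (simp add: power2_eq_1_iff)
  qed
  define P where "P k = (if k \<le> 2 * n then phi n k else par_l\<^sup>2 * phi n (k - (2 * n + 1)))" for k
  have shift_P: "shift n i (phi n) j = P (i + j)" if "j \<le> 2 * n" for i j
    using that by (simp add: shift_def P_def add.commute)
  \<comment> \<open>The sequence \<open>P\<close> jumps in five places only, so that differences of consecutive equations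
    have few terms.\<close>
  have jump: "P (Suc k) - P k = (if k = 0 then 1 - tau else 0) + (if k = n then par_l\<^sup>2 - 1 else 0)
      + (if k = 2 * n then par_l\<^sup>2 * (tau - 1) else 0) + (if k = 2 * n + 1 then par_l\<^sup>2 * (1 - tau) else 0)
      + (if k = 3 * n + 1 then par_l\<^sup>2 * (par_l\<^sup>2 - 1) else 0)" if "k \<le> 4 * n" for k
    using that by (auto simp: P_def phi_def algebra_simps)
  have delta: "(\<Sum>j\<le>2 * n. x j * (if i + j = c then d else 0)) = (if i \<le> c \<and> c \<le> i + 2 * n then d * x (c - i) else 0)"
    for i c d
  proof -
    have "(\<Sum>j\<le>2 * n. x j * (if i + j = c then d else 0))
        = (\<Sum>j\<le>2 * n. if j = c - i then (if i \<le> c then d * x j else 0) else 0)"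
      by (intro sum.cong) auto
    then show ?thesis by (auto simp: sum.delta)
  qed
  have key: "(par_l\<^sup>2 - 1) * (if i \<le> n then x (n - i) else par_l\<^sup>2 * x (3 * n + 1 - i))
      = (tau - 1) * ((if i = 0 then x 0 else par_l\<^sup>2 * x (2 * n + 1 - i)) - par_l\<^sup>2 * x (2 * n - i))"
    if i: "i \<le> 2 * n" for i
  proof -
    have "0 = ?g (Suc i) - ?g i" using g i by simp
    also have "\<dots> = (\<Sum>j\<le>2 * n. x j * (P (Suc (i + j)) - P (i + j)))"
      unfolding sum_subtractf[symmetric] by (intro sum.cong) (simp_all add: shift_P right_diff_distrib)
    also have "\<dots> = (\<Sum>j\<le>2 * n. x j * (if i + j = 0 then 1 - tau else 0)
        + x j * (if i + j = n then par_l\<^sup>2 - 1 else 0)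
        + x j * (if i + j = 2 * n then par_l\<^sup>2 * (tau - 1) else 0)
        + x j * (if i + j = 2 * n + 1 then par_l\<^sup>2 * (1 - tau) else 0)
        + x j * (if i + j = 3 * n + 1 then par_l\<^sup>2 * (par_l\<^sup>2 - 1) else 0))"
      using i by (intro sum.cong refl) (subst jump, simp, simp only: distrib_left)
    also have "\<dots> = (if i = 0 then (1 - tau) * x 0 else 0) + (if i \<le> n then (par_l\<^sup>2 - 1) * x (n - i) else 0)
        + par_l\<^sup>2 * (tau - 1) * x (2 * n - i) + (if i = 0 then 0 else par_l\<^sup>2 * (1 - tau) * x (2 * n + 1 - i))
        + (if i \<le> n then 0 else par_l\<^sup>2 * (par_l\<^sup>2 - 1) * x (3 * n + 1 - i))"
      unfolding sum.distrib delta using i by auto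
    finally show ?thesis by (cases "i = 0"; cases "i \<le> n"; simp add: algebra_simps)
  qed
  have pos: "par_l > 0" "par_l\<^sup>2 > 1" "par_m > 0"
    using par_l_gt_1 par_m_gt_par_l by (auto simp: one_less_power)
  have bound: "\<bar>(if i = 0 then x 0 else par_l\<^sup>2 * x (2 * n + 1 - i)) - par_l\<^sup>2 * x (2 * n - i)\<bar> \<le> 2 * par_l\<^sup>2 * M"
    if i: "i \<le> 2 * n" for i
  proof -
    have 1: "\<bar>par_l\<^sup>2 * x j\<bar> \<le> par_l\<^sup>2 * M" if "j \<le> 2 * n" for j
      using M[OF that] pos by (simp add: abs_mult mult_left_mono)
    moreover have "1 * M \<le> par_l\<^sup>2 * M" using pos M0 by (intro mult_right_mono) auto
    then have "\<bar>x 0\<bar> \<le> par_l\<^sup>2 * M" using M[of 0] by simp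
    ultimately have "\<bar>if i = 0 then x 0 else par_l\<^sup>2 * x (2 * n + 1 - i)\<bar> \<le> par_l\<^sup>2 * M"
      by auto
    moreover have "\<bar>par_l\<^sup>2 * x (2 * n - i)\<bar> \<le> par_l\<^sup>2 * M" by (rule 1) simp
    moreover have "\<bar>a - b\<bar> \<le> 2 * par_l\<^sup>2 * M" if "\<bar>a\<bar> \<le> par_l\<^sup>2 * M" "\<bar>b\<bar> \<le> par_l\<^sup>2 * M" for a b
      using order_trans[OF abs_triangle_ineq4 add_mono[OF that]] by (simp only: mult_2 distrib_right)
    ultimately show ?thesis by blast
  qed
  have small: "par_m * \<bar>x j\<bar> \<le> 2 * par_l * M" if j: "j \<le> 2 * n" for j
  proof -
    define i where "i = (if j \<le> n then n - j else 3 * n + 1 - j)"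
    have i: "i \<le> 2 * n" using j by (auto simp: i_def)
    let ?y = "if i \<le> n then x (n - i) else par_l\<^sup>2 * x (3 * n + 1 - i)"
    let ?r = "(if i = 0 then x 0 else par_l\<^sup>2 * x (2 * n + 1 - i)) - par_l\<^sup>2 * x (2 * n - i)"
    have "(tau - 1) * (par_m * par_l * ?y) = (tau - 1) * ?r"
      using key[OF i] unfolding l2 by (simp only: mult.assoc)
    then have eq: "par_m * par_l * ?y = ?r" using t by (simp only: mult_cancel_left) blast
    have "\<bar>x j\<bar> \<le> \<bar>?y\<bar>"
    proof (cases "j \<le> n")
      case True
      then have "?y = x j" by (simp add: i_def)
      then show ?thesis by simp
    next
      case False
      then have "?y = par_l\<^sup>2 * x j" using j by (auto simp: i_def)
      then show ?thesis using pos by (simp add: abs_mult mult_le_cancel_right1)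
    qed
    then have "par_m * par_l * \<bar>x j\<bar> \<le> par_m * par_l * \<bar>?y\<bar>"
      using pos by (intro mult_left_mono) auto
    also have "\<dots> = \<bar>par_m * par_l * ?y\<bar>"
      using pos by (simp only: abs_mult abs_of_pos)
    also have "\<dots> \<le> 2 * par_l\<^sup>2 * M"
      unfolding eq by (rule bound[OF i])
    finally have "par_l * (par_m * \<bar>x j\<bar>) \<le> par_l * (2 * par_l * M)"
      by (simp add: power2_eq_square mult_ac)
    then show ?thesis using pos by simp
  qed
  have "M \<in> (\<lambda>j. \<bar>x j\<bar>) ` {..2 * n}"
    unfolding M_def by (rule Max_in) auto
  then obtain j0 where "j0 \<le> 2 * n" "M = \<bar>x j0\<bar>" by auto
  then have "par_m * M \<le> 2 * par_l * M" using small by auto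
  then have "M = 0" using M0 par_m_gt_par_l mult_strict_right_mono[of "2 * par_l" par_m M] by fastforce
  then show ?thesis using M[OF j] by simp
qed


section \<open>The module of dimension \<open>2 (2n + 1)\<close>\<close>

text \<open>The dihedral group, labelled as in \<open>sigma2\<close>: the label \<open>k\<close> stands for the reduced word of length \<open>\<bar>k\<bar>\<close>
  which starts with \<open>X1\<close> if \<open>k > 0\<close> and with \<open>X0\<close> if \<open>k < 0\<close>.\<close>

definition H_range :: "nat \<Rightarrow> int set" where
  "H_range n = {- int (2 * n + 1)..int (2 * n)}"

text \<open>Left and right multiplication with the two generating reflections, and the descents, where the
  multiplication shortens the word. The longest element has the label \<open>- (2 n + 1)\<close> and ought to have the
  label \<open>2 n + 1\<close> as well; the exceptional clauses for \<open>N1\<close> come from this.\<close>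

definition H_left :: "nat \<Rightarrow> node \<Rightarrow> int \<Rightarrow> int" where
  "H_left n i k = (case i of N0 \<Rightarrow> - 1 - k
    | N1 \<Rightarrow> if k = - int (2 * n + 1) then - int (2 * n)
      else if k = - int (2 * n) then - int (2 * n + 1) else 1 - k)"

definition H_left_desc :: "nat \<Rightarrow> node \<Rightarrow> int \<Rightarrow> bool" where
  "H_left_desc n i k = (case i of N0 \<Rightarrow> k < 0 | N1 \<Rightarrow> 0 < k \<or> k = - int (2 * n + 1))"

definition H_right :: "nat \<Rightarrow> node \<Rightarrow> int \<Rightarrow> int" where
  "H_right n i k = (case i of N0 \<Rightarrow> if even k then k - 1 else k + 1
    | N1 \<Rightarrow> if k = - int (2 * n + 1) then int (2 * n) else if k = int (2 * n) then - int (2 * n + 1)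
      else if even k then k + 1 else k - 1)"

definition H_right_desc :: "nat \<Rightarrow> node \<Rightarrow> int \<Rightarrow> bool" where
  "H_right_desc n i k = (case i of N0 \<Rightarrow> (0 < k \<and> even k) \<or> (k < 0 \<and> odd k)
    | N1 \<Rightarrow> (0 < k \<and> odd k) \<or> (k < 0 \<and> even k) \<or> k = - int (2 * n + 1))"

text \<open>For an involution \<open>s\<close> with descents \<open>d\<close>, this is the operator that maps a basis vector to its image
  under \<open>s\<close>, and subtracts \<open>m\<close> times the basis vector itself at a descent.\<close>

definition hecke_op :: "(int \<Rightarrow> int) \<Rightarrow> (int \<Rightarrow> bool) \<Rightarrow> (int \<Rightarrow> ratfun) \<Rightarrow> int \<Rightarrow> ratfun" where
  "hecke_op s d u k = u (s k) - (if d k then par_m * u k else 0)"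

lemma hecke_op_commute:
  assumes "s (r k) = r (s k)"
    and "(d (r k) = d k \<and> e (s k) = e k) \<or> (s k = r k \<and> d k = e k \<and> d (s k) = e (s k))"
  shows "hecke_op s d (hecke_op r e u) k = hecke_op r e (hecke_op s d u) k"
  using assms by (auto simp: hecke_op_def algebra_simps)

text \<open>Left and right multiplications commute, in the Hecke algebra as in the group. The second alternative
  in \<open>hecke_op_commute\<close> covers the elements on which both multiplications agree.\<close>

lemma H_left_right:
  assumes "k \<in> H_range n"
  shows "hecke_op (H_left n i) (H_left_desc n i) (hecke_op (H_right n j) (H_right_desc n j) u) k
    = hecke_op (H_right n j) (H_right_desc n j) (hecke_op (H_left n i) (H_left_desc n i) u) k"
proof (rule hecke_op_commute)
  show "H_left n i (H_right n j k) = H_right n j (H_left n i k)"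
    using assms by (cases i; cases j; simp add: H_left_def H_right_def H_range_def; presburger)
  show "(H_left_desc n i (H_right n j k) = H_left_desc n i k \<and> H_right_desc n j (H_left n i k) = H_right_desc n j k) \<or>
    (H_left n i k = H_right n j k \<and> H_left_desc n i k = H_right_desc n j k
      \<and> H_left_desc n i (H_left n i k) = H_right_desc n j (H_left n i k))"
    using assms
    by (cases i; cases j; simp add: H_left_def H_right_def H_range_def H_left_desc_def H_right_desc_def; presburger)
qed

lemma H_left_range: "k \<in> H_range n \<Longrightarrow> H_left n i k \<in> H_range n"
  by (cases i) (auto simp: H_left_def H_range_def)

lemma H_left_involution: "k \<in> H_range n \<Longrightarrow> H_left n i (H_left n i k) = k"
  by (cases i) (auto simp: H_left_def H_range_def)

lemma H_left_desc_flip: "k \<in> H_range n \<Longrightarrow> H_left_desc n i (H_left n i k) \<longleftrightarrow> \<not> H_left_desc n i k"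
  by (cases i) (auto simp: H_left_def H_range_def H_left_desc_def)

text \<open>Values outside the range are set to zero, in order to make the operators total.\<close>

definition H_x :: "nat \<Rightarrow> node \<Rightarrow> (int \<Rightarrow> ratfun) \<Rightarrow> int \<Rightarrow> ratfun" where
  "H_x n i u k = (if k \<in> H_range n then hecke_op (H_left n i) (H_left_desc n i) u k else 0)"

definition H_op :: "nat \<Rightarrow> letter \<Rightarrow> (int \<Rightarrow> ratfun) \<Rightarrow> int \<Rightarrow> ratfun" where
  "H_op n g u = (case g of X i \<Rightarrow> H_x n i u | Xinv i \<Rightarrow> (\<lambda>k. H_x n i u k + par_m * u k) | E i \<Rightarrow> (\<lambda>k. 0))"

definition H_space :: "nat \<Rightarrow> (int \<Rightarrow> ratfun) set" where
  "H_space n = {u. \<forall>k. k \<notin> H_range n \<longrightarrow> u k = 0}"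

lemma H_op_simps [simp]:
  "H_op n (X i) u = H_x n i u" "H_op n (Xinv i) u = (\<lambda>k. H_x n i u k + par_m * u k)"
  "H_op n (E i) u = (\<lambda>k. 0)"
  by (simp_all add: H_op_def)

lemma H_x_add: "H_x n i (\<lambda>k. u k + v k) = (\<lambda>k. H_x n i u k + H_x n i v k)"
  and H_x_scale: "H_x n i (\<lambda>k. c * u k) = (\<lambda>k. c * H_x n i u k)"
  by (simp_all add: H_x_def hecke_op_def fun_eq_iff algebra_simps)

interpretation H: letter_action "H_op n" for n
proof
  show "H_op n g (\<lambda>i. u i + v i) = (\<lambda>i. H_op n g u i + H_op n g v i)" for g u v
    by (cases g) (simp_all add: H_x_add algebra_simps)
  show "H_op n g (\<lambda>i. c * u i) = (\<lambda>i. c * H_op n g u i)" for g u c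
    by (cases g) (simp_all add: H_x_scale algebra_simps)
qed

lemma H_space_op: "u \<in> H_space n \<Longrightarrow> H_op n g u \<in> H_space n"
  by (cases g) (simp_all add: H_space_def H_x_def)

lemma H_quadratic:
  assumes "u \<in> H_space n"
  shows "H_x n i (H_x n i u) = (\<lambda>k. u k - par_m * H_x n i u k)"
proof
  fix k
  show "H_x n i (H_x n i u) k = u k - par_m * H_x n i u k"
  proof (cases "k \<in> H_range n")
    case True
    then show ?thesis
      by (auto simp: H_x_def hecke_op_def H_left_range H_left_involution H_left_desc_flip algebra_simps)
  next
    case False
    then show ?thesis using assms by (simp add: H_x_def H_space_def)
  qed
qed

definition H_unit :: "int \<Rightarrow> int \<Rightarrow> ratfun" where
  "H_unit k j = (if j = k then 1 else 0)"

lemma H_unit_in_H_space: "k \<in> H_range n \<Longrightarrow> H_unit k \<in> H_space n"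
  by (auto simp: H_space_def H_unit_def)

lemma H_x_unit:
  assumes "k \<in> H_range n"
  shows "H_x n i (H_unit k) = (\<lambda>j. H_unit (H_left n i k) j - (if H_left_desc n i k then par_m * H_unit k j else 0))"
proof
  fix j
  have "H_left n i j = k \<longleftrightarrow> j = H_left n i k" if "j \<in> H_range n"
    using H_left_involution that assms by metis
  then show "H_x n i (H_unit k) j = H_unit (H_left n i k) j - (if H_left_desc n i k then par_m * H_unit k j else 0)"
    using assms H_left_range[OF assms, of i] by (auto simp: H_x_def hecke_op_def H_unit_def)
qed

lemma H_x_ascend: "k \<in> H_range n \<Longrightarrow> \<not> H_left_desc n i k \<Longrightarrow> H_x n i (H_unit k) = H_unit (H_left n i k)"
  by (simp add: H_x_unit)

lemma H_words:
  shows H_word1: "j \<le> 2 * n \<Longrightarrow> H.act n (alt_from j X1 X0) (H_unit 0) = H_unit (int j)"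
    and H_word0: "j \<le> 2 * n + 1 \<Longrightarrow> H.act n (alt_from j X0 X1) (H_unit 0) = H_unit (- int j)"
    and H_word_top: "H.act n (alt_from (2 * n + 1) X1 X0) (H_unit 0) = H_unit (- int (2 * n + 1))"
proof -
  have *: "(j \<le> 2 * n \<longrightarrow> H.act n (alt_from j X1 X0) (H_unit 0) = H_unit (int j)) \<and>
    (j \<le> 2 * n + 1 \<longrightarrow> H.act n (alt_from j X0 X1) (H_unit 0) = H_unit (- int j))" for j
  proof (induction j)
    case (Suc j)
    have "H_x n N1 (H_unit (- int j)) = H_unit (int (Suc j))" if "Suc j \<le> 2 * n"
      using that by (subst H_x_ascend) (auto simp: H_range_def H_left_desc_def H_left_def algebra_simps)
    moreover have "H_x n N0 (H_unit (int j)) = H_unit (- int (Suc j))" if "Suc j \<le> 2 * n + 1"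
      using that by (subst H_x_ascend) (auto simp: H_range_def H_left_desc_def H_left_def algebra_simps)
    ultimately show ?case using Suc by (auto simp: H.act_mult)
  qed simp
  show "j \<le> 2 * n \<Longrightarrow> H.act n (alt_from j X1 X0) (H_unit 0) = H_unit (int j)"
    "j \<le> 2 * n + 1 \<Longrightarrow> H.act n (alt_from j X0 X1) (H_unit 0) = H_unit (- int j)"
    using * by blast+
  have "H_x n N1 (H_unit (- int (2 * n))) = H_unit (- int (2 * n + 1))"
    by (subst H_x_ascend) (auto simp: H_range_def H_left_desc_def H_left_def)
  then show "H.act n (alt_from (2 * n + 1) X1 X0) (H_unit 0) = H_unit (- int (2 * n + 1))"
    using *[of "2 * n"] by (simp add: H.act_mult)
qed

definition H_r :: "nat \<Rightarrow> node \<Rightarrow> (int \<Rightarrow> ratfun) \<Rightarrow> int \<Rightarrow> ratfun" where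
  "H_r n i u k = (if k \<in> H_range n then hecke_op (H_right n i) (H_right_desc n i) u k else 0)"

lemma H_right_range: "k \<in> H_range n \<Longrightarrow> H_right n i k \<in> H_range n"
  by (cases i) (simp_all add: H_right_def H_range_def, presburger+)

lemma H_right_involution: "k \<in> H_range n \<Longrightarrow> H_right n i (H_right n i k) = k"
  by (cases i) (simp_all add: H_right_def H_range_def, presburger)

lemma H_x_r: "H_x n i (H_r n j u) = H_r n j (H_x n i u)"
proof
  fix k
  show "H_x n i (H_r n j u) k = H_r n j (H_x n i u) k"
  proof (cases "k \<in> H_range n")
    case True
    then have "H_x n i (H_r n j u) k
        = hecke_op (H_left n i) (H_left_desc n i) (hecke_op (H_right n j) (H_right_desc n j) u) k"
      by (simp add: H_x_def H_r_def hecke_op_def[of "H_left n i"] H_left_range)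
    also have "\<dots> = hecke_op (H_right n j) (H_right_desc n j) (hecke_op (H_left n i) (H_left_desc n i) u) k"
      by (rule H_left_right[OF True])
    also have "\<dots> = H_r n j (H_x n i u) k"
      using True by (simp add: H_x_def H_r_def hecke_op_def[of "H_right n j"] H_right_range)
    finally show ?thesis .
  next
    case False
    then show ?thesis by (simp add: H_x_def H_r_def)
  qed
qed

lemma H_r_ascend:
  assumes "k \<in> H_range n" "\<not> H_right_desc n i k"
  shows "H_r n i (H_unit k) = H_unit (H_right n i k)"
proof
  fix j
  have "H_right n i j = k \<longleftrightarrow> j = H_right n i k" if "j \<in> H_range n"
    using H_right_involution that assms by metis
  then show "H_r n i (H_unit k) j = H_unit (H_right n i k) j"
    using assms H_right_range[OF assms(1), of i] by (auto simp: H_r_def hecke_op_def H_unit_def)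
qed

lemma act_r:
  "H.act n (alt_from N (gen (X i)) (gen (X i'))) (H_r n j u) = H_r n j (H.act n (alt_from N (gen (X i)) (gen (X i'))) u)"
  by (induction N arbitrary: i i') (simp_all add: H.act_mult H_x_r)

text \<open>Both sides of the braid relation send the basis vector of the unit element to that of the longest
  element. They commute with right multiplications, which lead from the unit element to every other
  basis vector by ascents.\<close>

lemma H_braid_unit:
  assumes "k \<in> H_range n"
  shows "H.act n (alt_from (2 * n + 1) X0 X1) (H_unit k) = H.act n (alt_from (2 * n + 1) X1 X0) (H_unit k)"
proof -
  let ?P = "\<lambda>k. H.act n (alt_from (2 * n + 1) X0 X1) (H_unit k) = H.act n (alt_from (2 * n + 1) X1 X0) (H_unit k)"
  have step: "?P (H_right n j k)" if "?P k" "k \<in> H_range n" "\<not> H_right_desc n j k" for j k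
    using that(1) H_r_ascend[OF that(2,3), symmetric] by (simp only: act_r)
  have up: "j \<le> 2 * n + 1 \<Longrightarrow> (j \<le> 2 * n \<longrightarrow> ?P (int j)) \<and> ?P (- int j)" for j
  proof (induction j)
    case 0
    have "?P 0" using H_word0[of "2 * n + 1" n] H_word_top[of n] by (simp del: alt_from.simps)
    then show ?case by simp
  next
    case (Suc j)
    let ?a = "if even j then N1 else N0" and ?b = "if even j then N0 else N1"
    have "?P (int (Suc j))" if "Suc j \<le> 2 * n"
    proof -
      have "H_right n ?a (int j) = int (Suc j)" "\<not> H_right_desc n ?a (int j)"
        using that by (auto simp: H_right_def H_right_desc_def)
      then show ?thesis
        using step[of "int j" ?a] Suc that by (simp add: H_range_def del: alt_from.simps)
    qed
    moreover have "?P (- int (Suc j))"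
    proof -
      have "H_right n ?b (- int j) = - int (Suc j)" "\<not> H_right_desc n ?b (- int j)"
        using Suc.prems by (auto simp: H_right_def H_right_desc_def)
      then show ?thesis
        using step[of "- int j" ?b] Suc by (simp add: H_range_def del: alt_from.simps)
    qed
    ultimately show ?case by blast
  qed
  show ?thesis
  proof (cases "0 \<le> k")
    case True
    then show ?thesis using up[of "nat k"] assms by (simp add: H_range_def del: alt_from.simps)
  next
    case False
    then show ?thesis using up[of "nat (- k)"] assms by (simp add: H_range_def del: alt_from.simps)
  qed
qed

lemma finite_H_range: "finite (H_range n)"
  by (simp add: H_range_def)

lemma H_expand:
  assumes "u \<in> H_space n"
  shows "u = (\<lambda>j. \<Sum>k\<in>H_range n. u k * H_unit k j)"
  using assms finite_H_range[of n]
  by (auto simp: fun_eq_iff H_unit_def H_space_def if_distrib cong: if_cong)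

lemma H_braid:
  assumes "u \<in> H_space n"
  shows "H.act n (alt_from (2 * n + 1) X0 X1) u = H.act n (alt_from (2 * n + 1) X1 X0) u"
proof -
  have "H.act n a u = (\<lambda>j. \<Sum>k\<in>H_range n. u k * H.act n a (H_unit k) j)" for a
    by (subst H_expand[OF assms]) (simp add: H.act_sum_right H.act_scale_right)
  from this[of "alt_from (2 * n + 1) X0 X1"] this[of "alt_from (2 * n + 1) X1 X0"] show ?thesis
    by (simp only: H_braid_unit cong: sum.cong)
qed

lemma H_rel:
  assumes "B_rel n a b" and u: "u \<in> H_space n"
  shows "H.act n a u = H.act n b u"
  using assms(1)
proof cases
  case (inv_right i)
  then show ?thesis
    using H_quadratic[OF u, of i] by (simp add: H.act_mult H_x_add H_x_scale)
next
  case (inv_left i)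
  then show ?thesis using H_quadratic[OF u, of i] by (simp add: H.act_mult)
next
  case braid
  then show ?thesis using H_braid[OF u] by simp
qed (simp_all add: H.act_mult H.act_diff H.act_zero_right)

interpretation H: B_action "H_op n" "H_space n" n for n
  by unfold_locales (simp add: H_space_def, simp add: H_space_def, simp add: H_space_def,
    rule H_space_op, assumption, rule H_rel)

text \<open>The scalar product for which the group elements are orthonormal. An involution is a symmetric
  operator, hence \<open>star a\<close> acts as the adjoint of \<open>a\<close>.\<close>

definition H_form :: "nat \<Rightarrow> (int \<Rightarrow> ratfun) \<Rightarrow> (int \<Rightarrow> ratfun) \<Rightarrow> ratfun" where
  "H_form n u v = (\<Sum>k\<in>H_range n. u k * v k)"

lemma H_form_x: "H_form n (H_x n i u) v = H_form n u (H_x n i v)"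
proof -
  have bij: "bij_betw (H_left n i) (H_range n) (H_range n)"
    by (rule bij_betwI[where g = "H_left n i"]) (auto simp: H_left_range H_left_involution)
  have "(\<Sum>k\<in>H_range n. u (H_left n i k) * v k) = (\<Sum>k\<in>H_range n. u (H_left n i (H_left n i k)) * v (H_left n i k))"
    by (rule sum.reindex_bij_betw[OF bij, symmetric])
  also have "\<dots> = (\<Sum>k\<in>H_range n. u k * v (H_left n i k))"
    by (intro sum.cong) (simp_all add: H_left_involution)
  finally have *: "(\<Sum>k\<in>H_range n. u (H_left n i k) * v k) = (\<Sum>k\<in>H_range n. u k * v (H_left n i k))" .
  have "H_form n (H_x n i u) v = (\<Sum>k\<in>H_range n. u (H_left n i k) * v k) - (\<Sum>k\<in>H_range n. (if H_left_desc n i k then par_m * u k * v k else 0))"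
    unfolding H_form_def sum_subtractf[symmetric]
    by (intro sum.cong) (auto simp: H_x_def hecke_op_def algebra_simps)
  also have "\<dots> = H_form n u (H_x n i v)"
    unfolding H_form_def sum_subtractf[symmetric] *
    by (intro sum.cong) (auto simp: H_x_def hecke_op_def algebra_simps)
  finally show ?thesis .
qed

lemma H_form_op: "H_form n (H_op n g u) v = H_form n u (H_op n g v)"
proof (cases g)
  case (Xinv i)
  then show ?thesis
    using H_form_x[of n i u v] by (simp add: H_form_def sum.distrib algebra_simps)
qed (simp_all add: H_form_x, simp add: H_form_def)

lemma H_form_act: "H_form n (H.act n a u) v = H_form n u (H.act n (star a) v)"
proof (induction a arbitrary: u v rule: free_alg_induct)
  case zero
  show ?case by (simp add: H_form_def)
next
  case (add a b)
  then show ?case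
    by (simp add: H.act_add star_add) (simp add: H_form_def distrib_left distrib_right sum.distrib)
next
  case (word w c)
  have gens: "H_form n (foldr (H_op n) gs u) v = H_form n u (foldr (H_op n) (rev gs) v)" for gs u v
    by (induction gs arbitrary: u v) (simp_all add: H_form_op)
  show ?case
    using gens[of "letters w" u v]
    by (simp add: star_single H.act_single word_act_def) (simp add: H_form_def sum_distrib_left[symmetric] mult.assoc mult.left_commute)
qed

lemma H_form_definite:
  assumes "u \<in> H_space n" "H_form n u u = 0"
  shows "u = (\<lambda>k. 0)"
proof
  fix k
  have "\<forall>k\<in>H_range n. u k * u k = 0"
    using assms(2) sum_nonneg_eq_0_iff[OF finite_H_range, of n "\<lambda>k. u k * u k"] by (simp add: H_form_def)
  then show "u k = 0" using assms(1) by (cases "k \<in> H_range n") (auto simp: H_space_def)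
qed


section \<open>Faithfulness\<close>

lemma scalar_E0_in_ideal: "scalar c * E0 \<in> B_ideal n \<Longrightarrow> c = 0"
proof -
  assume "scalar c * E0 \<in> B_ideal n"
  from V.act_B_ideal[OF this phi_in_V_space] have "V.act n (scalar c * E0) (phi n) 0 = 0"
    by (simp only:)
  then have "c * (tau * tau) = 0" by (simp add: V.act_mult V_e_def phi_def)
  then show "c = 0" using tau_pos by simp
qed

lemma scalar_E0_inj: "eqv n (scalar c * E0) (scalar d * E0) \<Longrightarrow> c = d"
  using scalar_E0_in_ideal[of "c - d" n] scalar_simps(2)[of c "- d"]
  by (simp add: eqv_def scalar_minus left_diff_distrib)

text \<open>A multiple of \<open>E0\<close> is obtained because \<open>a * E0\<close> is a combination of cells. The action on \<open>phi\<close>, an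
  eigenvector of \<open>E0\<close> for \<open>tau\<close>, identifies the factor.\<close>

lemma E0_corner: "eqv n (E0 * a * E0) (scalar (V.act n a (phi n) 0) * E0)"
proof -
  have "E0 * (a * E0) \<in> combs n (\<lambda>_. E0) {()}"
  proof (rule combs_mult_left[OF left_E0])
    fix k assume "k \<in> {..2 * n}"
    then obtain c where c: "eqv n (E0 * cell k) (scalar c * E0)"
      using E0_cell[of k n] by auto
    then show "E0 * cell k \<in> combs n (\<lambda>_. E0) {()}"
      unfolding combs_def by (intro CollectI exI[of _ "\<lambda>_. c"]) simp
  qed
  then obtain c where c: "eqv n (E0 * a * E0) (scalar c * E0)"
    by (auto simp: combs_def mult.assoc)
  have "V.act n (E0 * a * E0) (phi n) 0 = V.act n (scalar c * E0) (phi n) 0"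
    by (simp only: V.act_eqv[OF c phi_in_V_space])
  moreover have "V_e n (phi n) = (\<lambda>j. tau * phi n j)" "phi n 0 = tau" "V_e n u 0 = u 0 * tau" for u
    by (simp_all add: V_e_def phi_def)
  ultimately have "tau * tau * V.act n a (phi n) 0 = tau * tau * c"
    by (simp only: V.act_mult V.act_gen V_op_simps V.act_scalar V.act_scale_right) (simp add: mult_ac)
  then have "V.act n a (phi n) 0 = c" using tau_pos by simp
  then show ?thesis using c by simp
qed

lemma corner_star: "V.act n (star a) (phi n) 0 = V.act n a (phi n) 0"
proof -
  have "eqv n (E0 * star a * E0) (scalar (V.act n a (phi n) 0) * E0)"
    using eqv_star[OF E0_corner[of n a]] by (simp only: star_scale) (simp only: star_mult star_gen mult.assoc)
  from scalar_E0_inj[OF eqv_trans[OF eqv_sym[OF E0_corner] this]] show ?thesis .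
qed

lemma V_space_expand:
  assumes "u \<in> V_space n"
  shows "u = (\<lambda>i. \<Sum>j\<le>2 * n. u j * (if i = j then 1 else 0))"
  using assms by (auto simp: fun_eq_iff V_space_def if_distrib cong: if_cong)

text \<open>The form in which \<open>orbit_of_phi_nondegenerate\<close> is applied: \<open>phi\<close> generates the module.\<close>

lemma functional_vanishing_on_orbit:
  assumes lin: "\<And>c f. L (\<lambda>i. \<Sum>j\<le>2 * n. c j * f j i) = (\<Sum>j\<le>2 * n. c j * L (f j))"
    and van: "\<And>a. L (V.act n a (phi n)) = (0 :: ratfun)"
    and u: "u \<in> V_space n"
  shows "L u = 0"
proof -
  let ?d = "\<lambda>j i. if i = j then 1 else 0 :: ratfun"
  have expand: "L w = (\<Sum>j\<le>2 * n. w j * L (?d j))" if "w \<in> V_space n" for w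
    by (subst V_space_expand[OF that]) (rule lin)
  have "(\<Sum>j\<le>2 * n. L (?d j) * shift n i (phi n) j) = 0" if "i \<le> 2 * n" for i
  proof -
    have "L (V.act n ((X1 * X0) ^ i) (phi n)) = (\<Sum>j\<le>2 * n. shift n i (phi n) j * L (?d j))"
      using that by (simp only: act_X1X0_power[OF phi_in_V_space] expand[OF V_space_shift])
    then show ?thesis using van by (simp add: mult.commute)
  qed
  from orbit_of_phi_nondegenerate[where x = "\<lambda>j. L (?d j)", OF this]
  show ?thesis using expand[OF u] by simp
qed

text \<open>By \<open>corner_star\<close>, a relation between the vectors \<open>[\<dots> X0 X1]_k phi\<close> yields a relation between the functionals
  \<open>u \<mapsto> ([X1 X0 \<dots>]_k u) 0\<close> on the orbit of \<open>phi\<close>, hence on the whole module.\<close>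

lemma cells_independent:
  assumes c: "\<And>i. (\<Sum>k\<le>2 * n. c k * V.act n (alt_to k X0 X1) (phi n) i) = 0" and k: "k \<le> 2 * n"
  shows "c k = 0"
proof -
  let ?L = "\<lambda>u. \<Sum>k\<le>2 * n. c k * V.act n (alt_from k X1 X0) u 0"
  have "?L u = 0" if u: "u \<in> V_space n" for u
  proof (rule functional_vanishing_on_orbit[where L = ?L, OF _ _ u])
    fix d f
    show "?L (\<lambda>i. \<Sum>j\<le>2 * n. d j * f j i) = (\<Sum>j\<le>2 * n. d j * ?L (f j))"
      by (simp add: V.act_sum_right V.act_scale_right sum_distrib_left mult.left_commute)
         (rule sum.swap)
  next
    fix a
    have "c k * V.act n (alt_from k X1 X0) (V.act n a (phi n)) 0 =
        V.act n (star a) (\<lambda>i. c k * V.act n (alt_to k X0 X1) (phi n) i) 0" for k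
      using corner_star[of n "alt_from k X1 X0 * a"]
      by (simp add: V.act_mult star_mult star_alt_from V.act_scale_right)
    then have "?L (V.act n a (phi n)) = V.act n (star a) (\<lambda>i. \<Sum>k\<le>2 * n. c k * V.act n (alt_to k X0 X1) (phi n) i) 0"
      by (simp add: V.act_sum_right)
    then show "?L (V.act n a (phi n)) = 0" by (simp add: c)
  qed
  from evaluation_functionals_independent[OF this k] show ?thesis .
qed

lemma act_sigma2: "k \<in> index2 n \<Longrightarrow> H.act n (sigma2 k) (H_unit 0) = H_unit k"
  using H_word1[of "nat k" n] H_word0[of "nat (- k)" n] by (auto simp: sigma2_def index2_def)

lemma H_act_sigma1: "H.act n (sigma1 p) u = (\<lambda>i. 0)"
  by (cases p) (simp add: sigma1_def H.act_mult)

lemma V_act_sigma1: "V.act n (sigma1 (k, j)) u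
    = (\<lambda>i. V.act n (alt_from j X1 X0) u 0 * V.act n (alt_to k X0 X1) (phi n) i)"
  by (simp add: sigma1_def V.act_mult V_e_def V.act_scale_right)

text \<open>On the Hecke module the first family vanishes and the second one maps the unit vector to distinct basis
  vectors. Once the second family is gone, each element of the first family acts on the other module
  as a functional times a vector, both taken from independent families.\<close>

lemma coefficients_vanish:
  assumes a: "eqv n a (\<Sum>i\<in>index n. scalar (c i) * sigma i)"
    and V: "\<And>u. u \<in> V_space n \<Longrightarrow> V.act n a u = (\<lambda>i. 0)"
    and H: "H.act n a (H_unit 0) = (\<lambda>i. 0)"
    and i: "i \<in> index n"
  shows "c i = 0"
proof -
  have split: "(\<Sum>i\<in>index n. scalar (c i) * sigma i) =
      (\<Sum>p\<in>index1 n. scalar (c (Inl p)) * sigma1 p) + (\<Sum>k\<in>index2 n. scalar (c (Inr k)) * sigma2 k)"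
    unfolding index_def by (simp add: sum.Plus finite_index sigma_def)
  have H0: "H_unit 0 \<in> H_space n" by (rule H_unit_in_H_space) (simp add: H_range_def)
  have c2: "c (Inr k) = 0" if k: "k \<in> index2 n" for k
  proof -
    have "(\<lambda>i. 0) = H.act n (\<Sum>i\<in>index n. scalar (c i) * sigma i) (H_unit 0)"
      using H H.act_eqv[OF a H0] by simp
    also have "\<dots> = (\<lambda>i. \<Sum>k\<in>index2 n. c (Inr k) * H_unit k i)"
      unfolding split by (simp add: H.act_add H.act_sum H.act_mult H_act_sigma1 act_sigma2 cong: sum.cong)
    finally have "0 = (\<Sum>k'\<in>index2 n. c (Inr k') * H_unit k' k)" by (rule fun_cong)
    also have "\<dots> = (\<Sum>k'\<in>index2 n. if k' = k then c (Inr k') else 0)"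
      by (intro sum.cong) (auto simp: H_unit_def)
    also have "\<dots> = c (Inr k)" using k finite_index by simp
    finally show ?thesis by simp
  qed
  have c1: "c (Inl (k, j)) = 0" if kj: "k \<le> 2 * n" "j \<le> 2 * n" for k j
  proof -
    have "(\<Sum>j\<le>2 * n. c (Inl (k, j)) * V.act n (alt_from j X1 X0) u 0) = 0" if u: "u \<in> V_space n" for u
    proof (rule cells_independent[where c = "\<lambda>k. \<Sum>j\<le>2 * n. c (Inl (k, j)) * V.act n (alt_from j X1 X0) u 0", OF _ kj(1)])
      fix i
      have "(\<lambda>i. 0) = V.act n (\<Sum>i\<in>index n. scalar (c i) * sigma i) u"
        using V[OF u] V.act_eqv[OF a u] by simp
      also have "\<dots> = (\<lambda>i. \<Sum>p\<in>index1 n. c (Inl p) * V.act n (sigma1 p) u i)"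
        unfolding split by (simp add: V.act_add V.act_sum V.act_mult c2 cong: sum.cong)
      finally have "0 = (\<Sum>p\<in>index1 n. c (Inl p) * V.act n (sigma1 p) u i)" by (rule fun_cong)
      also have "\<dots> = (\<Sum>k\<le>2 * n. \<Sum>j\<le>2 * n. c (Inl (k, j)) * V.act n (sigma1 (k, j)) u i)"
        unfolding index1_def by (simp add: sum.cartesian_product case_prod_unfold)
      finally show "(\<Sum>k\<le>2 * n. (\<Sum>j\<le>2 * n. c (Inl (k, j)) * V.act n (alt_from j X1 X0) u 0) *
          V.act n (alt_to k X0 X1) (phi n) i) = 0"
        by (simp add: V_act_sigma1 sum_distrib_right mult.assoc)
    qed
    from evaluation_functionals_independent[OF this kj(2)] show ?thesis .
  qed
  show ?thesis
    using i c1 c2 by (auto simp: index_def index1_def)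
qed

theorem jointly_faithful:
  assumes n: "n \<ge> 1"
    and V: "\<And>u. u \<in> V_space n \<Longrightarrow> V.act n a u = (\<lambda>i. 0)"
    and H: "H.act n a (H_unit 0) = (\<lambda>i. 0)"
  shows "a \<in> B_ideal n"
proof -
  obtain c where c: "eqv n a (\<Sum>i\<in>index n. scalar (c i) * sigma i)"
    using sigma_spans[OF n, of a] by (auto simp: combs_def)
  have "(\<Sum>i\<in>index n. scalar (c i) * sigma i) = 0"
    using coefficients_vanish[OF c V H] by (intro sum.neutral) simp
  then show ?thesis using c by (simp add: eqv_0_iff)
qed

theorem sigma_independent:
  assumes "(\<Sum>i\<in>index n. scalar (c i) * sigma i) \<in> B_ideal n" "i \<in> index n"
  shows "c i = 0"
proof (rule coefficients_vanish[OF _ _ _ assms(2)])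
  show "eqv n 0 (\<Sum>i\<in>index n. scalar (c i) * sigma i)"
    by (rule eqv_sym) (use assms(1) in \<open>simp only: eqv_0_iff\<close>)
qed simp_all


section \<open>Absence of nilpotent left ideals\<close>

text \<open>For \<open>z = b * E0 * a * x\<close> in the left ideal, \<open>z * z\<close> is zero in the algebra. Enclosed between \<open>E0 * a * x\<close> and \<open>b * E0\<close> it becomes
  the third power of the corner \<open>E0 * (a * x * b) * E0\<close>, whose factor is therefore zero. So \<open>x\<close> acts as zero
  on the first module. On the Hecke module, \<open>y = star x * x\<close> is self-adjoint with square zero,
  hence zero by definiteness, and the same argument passes from \<open>y\<close> to \<open>x\<close>.\<close>

theorem no_square_zero_left_ideal:
  assumes n: "n \<ge> 1"
    and left: "\<And>a x. x \<in> L \<Longrightarrow> a * x \<in> L"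
    and square: "\<And>x y. x \<in> L \<Longrightarrow> y \<in> L \<Longrightarrow> x * y \<in> B_ideal n"
    and x: "x \<in> L"
  shows "x \<in> B_ideal n"
proof (rule jointly_faithful[OF n])
  have corner: "V.act n (a * x * b) (phi n) 0 = 0" for a b
  proof -
    let ?f = "scalar (V.act n (a * x * b) (phi n) 0)" and ?w = "E0 * (a * x * b)"
    have corner: "eqv n (?w * E0) (?f * E0)" by (rule E0_corner)
    have "b * E0 * a * x \<in> L" by (rule left[OF x])
    from square[OF this this] have "E0 * a * x * (b * E0 * a * x * (b * E0 * a * x)) * (b * E0) \<in> B_ideal n"
      by (rule B_ideal_mult_right[OF B_ideal_mult_left])
    also have "E0 * a * x * (b * E0 * a * x * (b * E0 * a * x)) * (b * E0) = ?w * (?w * (?w * E0))"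
      by (simp only: mult.assoc)
    finally have "?w * (?w * (?w * E0)) \<in> B_ideal n" .
    then have "eqv n 0 (?w * (?w * (?w * E0)))"
      using eqv_0_iff eqv_sym by blast
    also have "eqv n \<dots> (?w * (?w * (?f * E0)))"
      by (intro eqv_left corner)
    also have "\<dots> = ?f * (?w * (?w * E0))"
      by (simp only: scalar_left_commute[of ?w])
    also have "eqv n \<dots> (?f * (?w * (?f * E0)))"
      by (intro eqv_left corner)
    also have "\<dots> = ?f * (?f * (?w * E0))"
      by (simp only: scalar_left_commute[of ?w])
    also have "eqv n \<dots> (?f * (?f * (?f * E0)))"
      by (intro eqv_left corner)
    also have "\<dots> = scalar (V.act n (a * x * b) (phi n) 0 ^ 3) * E0"
      by (simp only: power3_eq_cube scalar_simps mult.assoc)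
    finally have "scalar (V.act n (a * x * b) (phi n) 0 ^ 3) * E0 \<in> B_ideal n"
      using eqv_sym eqv_0_iff by blast
    then show ?thesis using scalar_E0_in_ideal by fastforce
  qed
  show "V.act n x u = (\<lambda>i. 0)" if u: "u \<in> V_space n" for u
  proof (rule V_space_eqI[OF V.V_act[OF u]])
    show "(\<lambda>i. 0) \<in> V_space n" by (rule V.V_0)
    fix j assume j: "j \<le> 2 * n"
    let ?L = "\<lambda>u. V.act n ((X1 * X0) ^ j * x) u 0"
    have "?L u = 0"
    proof (rule functional_vanishing_on_orbit[where L = ?L, OF _ _ u])
      show "?L (V.act n a (phi n)) = 0" for a
        using corner[of "(X1 * X0) ^ j" a] by (simp add: V.act_mult)
    qed (simp add: V.act_sum_right V.act_scale_right)
    then show "V.act n x u j = 0"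
      using j by (simp add: V.act_mult act_X1X0_power[OF V.V_act[OF u]]) (simp add: shift_def)
  qed
  show "H.act n x (H_unit 0) = (\<lambda>i. 0)"
  proof -
    have H0: "H_unit 0 \<in> H_space n" by (rule H_unit_in_H_space) (simp add: H_range_def)
    let ?y = "star x * x"
    have y: "?y \<in> L" by (rule left[OF x])
    have zero: "H_form n w (\<lambda>i. 0) = 0" for w by (simp add: H_form_def)
    have "H_form n (H.act n ?y (H_unit 0)) (H.act n ?y (H_unit 0)) = H_form n (H_unit 0) (H.act n (?y * ?y) (H_unit 0))"
      unfolding H_form_act by (simp add: H.act_mult star_mult)
    also have "\<dots> = 0"
      by (simp only: H.act_B_ideal[OF square[OF y y] H0] zero)
    finally have "H.act n ?y (H_unit 0) = (\<lambda>i. 0)"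
      by (rule H_form_definite[OF H.V_act[OF H0]])
    then have "H_form n (H.act n x (H_unit 0)) (H.act n x (H_unit 0)) = 0"
      unfolding H_form_act by (simp add: H.act_mult zero)
    then show ?thesis by (rule H_form_definite[OF H.V_act[OF H0]])
  qed
qed


section \<open>A criterion for semisimplicity\<close>

context ring
begin

lemma left_idealI:
  assumes "I \<subseteq> carrier R" "\<zero> \<in> I" "\<And>x y. x \<in> I \<Longrightarrow> y \<in> I \<Longrightarrow> x \<oplus> y \<in> I"
    and "\<And>a x. a \<in> carrier R \<Longrightarrow> x \<in> I \<Longrightarrow> a \<otimes> x \<in> I"
  shows "left_ideal R I"
proof -
  have "\<ominus> x \<in> I" if "x \<in> I" for x
    using assms(4)[of "\<ominus> \<one>" x] that assms(1) by (simp add: l_minus subset_iff)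
  then have "subgroup I (add_monoid R)"
    by (intro add.subgroupI) (use assms in \<open>auto simp: a_inv_def\<close>)
  then show ?thesis using assms(4) by (simp add: left_ideal_def additive_subgroup_def)
qed

lemma left_idealD:
  assumes "left_ideal R I"
  shows "I \<subseteq> carrier R" "\<zero> \<in> I" "x \<in> I \<Longrightarrow> y \<in> I \<Longrightarrow> x \<oplus> y \<in> I" "x \<in> I \<Longrightarrow> y \<in> I \<Longrightarrow> x \<ominus> y \<in> I"
    "a \<in> carrier R \<Longrightarrow> x \<in> I \<Longrightarrow> a \<otimes> x \<in> I" "subgroup I (add_monoid R)"
proof -
  interpret I: additive_subgroup I R using assms by (simp add: left_ideal_def)
  show "I \<subseteq> carrier R" "\<zero> \<in> I" "x \<in> I \<Longrightarrow> y \<in> I \<Longrightarrow> x \<oplus> y \<in> I" "subgroup I (add_monoid R)"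
    using I.a_subset I.zero_closed I.a_closed I.a_subgroup by auto
  show "a \<in> carrier R \<Longrightarrow> x \<in> I \<Longrightarrow> a \<otimes> x \<in> I"
    using assms by (simp add: left_ideal_def)
  show "x \<in> I \<Longrightarrow> y \<in> I \<Longrightarrow> x \<ominus> y \<in> I"
    using I.a_closed I.a_inv_closed by (simp add: a_minus_def)
qed

lemma left_ideal_annihilator:
  assumes "left_ideal R L" "e \<in> carrier R"
  shows "left_ideal R {x \<in> L. x \<otimes> e = \<zero>}"
  using left_idealD[OF assms(1)] assms(2)
  by (intro left_idealI) (auto simp: l_distr m_assoc subset_iff)

lemma left_ideal_right_multiples:
  assumes "left_ideal R L" "e \<in> carrier R"
  shows "left_ideal R ((\<lambda>x. x \<otimes> e) ` L)"
proof (rule left_idealI)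
  note L = left_idealD[OF assms(1)]
  show "(\<lambda>x. x \<otimes> e) ` L \<subseteq> carrier R" using L(1) assms(2) by auto
  show "\<zero> \<in> (\<lambda>x. x \<otimes> e) ` L" using L(2) assms(2) by (intro image_eqI[of _ _ "\<zero>"]) auto
  show "x \<oplus> y \<in> (\<lambda>x. x \<otimes> e) ` L" if xy: "x \<in> (\<lambda>x. x \<otimes> e) ` L" "y \<in> (\<lambda>x. x \<otimes> e) ` L" for x y
  proof -
    from xy obtain x' y' where "x' \<in> L" "y' \<in> L" "x = x' \<otimes> e" "y = y' \<otimes> e" by auto
    then show ?thesis using L(1,3) assms(2)
      by (intro image_eqI[of _ _ "x' \<oplus> y'"]) (auto simp: l_distr subset_iff)
  qed
  show "a \<otimes> x \<in> (\<lambda>x. x \<otimes> e) ` L" if a: "a \<in> carrier R" and x: "x \<in> (\<lambda>x. x \<otimes> e) ` L" for a x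
  proof -
    from x obtain x' where "x' \<in> L" "x = x' \<otimes> e" by auto
    then show ?thesis using L(1,5) assms(2) a
      by (intro image_eqI[of _ _ "a \<otimes> x'"]) (auto simp: m_assoc subset_iff)
  qed
qed

lemma simple_left_idealD:
  assumes "simple_left_ideal R S"
  shows "left_ideal R S" "S \<noteq> {\<zero>}" "left_ideal R J \<Longrightarrow> J \<subseteq> S \<Longrightarrow> J = {\<zero>} \<or> J = S"
  using assms by (auto simp: simple_left_ideal_def)

text \<open>Brauer's lemma. Right multiplication by \<open>y\<close> is a homomorphism defined on \<open>S\<close>; by simplicity it is onto
  \<open>S\<close> and injective. A preimage \<open>e\<close> of \<open>y\<close> is a right identity, since \<open>s e - s\<close> lies in its kernel.\<close>

lemma simple_left_ideal_right_identity:
  assumes S: "simple_left_ideal R S" and xy: "x \<in> S" "y \<in> S" "x \<otimes> y \<noteq> \<zero>"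
  obtains e where "e \<in> S" "\<And>s. s \<in> S \<Longrightarrow> s \<otimes> e = s"
proof -
  note L = left_idealD[OF simple_left_idealD(1)[OF S]]
  have c: "y \<in> carrier R" using xy L(1) by auto
  have "(\<lambda>x. x \<otimes> y) ` S = S"
  proof -
    have "(\<lambda>x. x \<otimes> y) ` S \<subseteq> S" using L(1,5) xy by auto
    moreover have "(\<lambda>x. x \<otimes> y) ` S \<noteq> {\<zero>}" using xy by auto
    ultimately show ?thesis
      using simple_left_idealD(3)[OF S left_ideal_right_multiples[OF simple_left_idealD(1)[OF S] c]] by blast
  qed
  then obtain e where e: "e \<in> S" "e \<otimes> y = y" using xy(2) by (metis imageE)
  have K: "{s \<in> S. s \<otimes> y = \<zero>} = {\<zero>}"
  proof -
    have "x \<notin> {s \<in> S. s \<otimes> y = \<zero>}" using xy by simp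
    then show ?thesis
      using simple_left_idealD(3)[OF S left_ideal_annihilator[OF simple_left_idealD(1)[OF S] c]] xy(1) by blast
  qed
  have "s \<otimes> e = s" if s: "s \<in> S" for s
  proof -
    have cs: "s \<in> carrier R" "e \<in> carrier R" using s e L(1) by auto
    have "(s \<otimes> e \<ominus> s) \<otimes> y = s \<otimes> (e \<otimes> y) \<ominus> s \<otimes> y"
      using cs c by (simp add: a_minus_def l_distr l_minus m_assoc)
    also have "\<dots> = \<zero>" using cs c e by (simp add: a_minus_def r_neg)
    finally have "s \<otimes> e \<ominus> s \<in> {s \<in> S. s \<otimes> y = \<zero>}"
      using L(4)[OF L(5)[OF cs(1) e(1)] s] by simp
    then have "s \<otimes> e \<ominus> s = \<zero>" using K by auto
    moreover have "s \<otimes> e = (s \<otimes> e \<ominus> s) \<oplus> s" using cs by (simp add: a_minus_def a_assoc l_neg)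
    ultimately show ?thesis using cs by simp
  qed
  with e(1) that show ?thesis by blast
qed

text \<open>The sum of \<open>S\<close> and the group generated by \<open>U\<close> is a group, which lets the independence of a family be
  checked after a summand has been added.\<close>

lemma generate_Un_subset:
  assumes S: "subgroup S (add_monoid R)" and U: "U \<subseteq> carrier R"
  shows "generate (add_monoid R) (S \<union> U) \<subseteq> S <+> generate (add_monoid R) U"
proof -
  have G: "subgroup (generate (add_monoid R) U) (add_monoid R)"
    by (rule add.generate_is_subgroup) (use U in simp)
  have "additive_subgroup (S <+> generate (add_monoid R) U) R"
    using S G by (intro add_additive_subgroups) (simp_all add: additive_subgroup_def)
  moreover have "S \<union> U \<subseteq> S <+> generate (add_monoid R) U"
  proof
    fix x assume x: "x \<in> S \<union> U"
    have z: "\<zero> \<in> S" "\<zero> \<in> generate (add_monoid R) U"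
      using subgroup.one_closed[OF S] subgroup.one_closed[OF G] by auto
    have "x \<in> carrier R" using x U subgroup.subset[OF S] by auto
    then have "x = x \<oplus> \<zero>" "x = \<zero> \<oplus> x" by auto
    moreover have "x \<in> S \<or> x \<in> generate (add_monoid R) U"
      using x generate.incl by fastforce
    ultimately show "x \<in> S <+> generate (add_monoid R) U"
      using z unfolding set_add_def' by blast
  qed
  ultimately show ?thesis
    by (intro add.generate_subgroup_incl) (simp_all add: additive_subgroup_def)
qed

text \<open>Every left ideal \<open>L\<close> is an internal direct sum of simple ones, by induction on the rank. A nonzero left
  ideal \<open>S\<close> of minimal rank in \<open>L\<close> is simple; it has a right identity \<open>e\<close>, and \<open>x = x e + (x - x e)\<close> splits \<open>L\<close>
  into \<open>S\<close> and the annihilator of \<open>e\<close> in \<open>L\<close>.\<close>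

theorem semisimple_if_semiprime:
  fixes rank :: "'a set \<Rightarrow> nat"
  assumes rank: "\<And>I J. left_ideal R I \<Longrightarrow> left_ideal R J \<Longrightarrow> I \<subset> J \<Longrightarrow> rank I < rank J"
    and semiprime: "\<And>L. left_ideal R L \<Longrightarrow> (\<And>x y. x \<in> L \<Longrightarrow> y \<in> L \<Longrightarrow> x \<otimes> y = \<zero>) \<Longrightarrow> L = {\<zero>}"
  shows "semisimple_ring R"
proof -
  let ?G = "generate (add_monoid R)"
  have decomposition: "\<exists>F. (\<forall>I\<in>F. simple_left_ideal R I \<and> I \<subseteq> L) \<and> ?G (\<Union>F) = L \<and> (\<forall>I\<in>F. I \<inter> ?G (\<Union>(F - {I})) = {\<zero>})"
    if "left_ideal R L" for L
    using that
  proof (induction "rank L" arbitrary: L rule: less_induct)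
    case less
    note L = left_idealD[OF less.prems]
    show ?case
    proof (cases "L = {\<zero>}")
      case True
      have "?G {} = {\<zero>}" using add.generate_empty by simp
      then show ?thesis using True by (intro exI[of _ "{}"]) simp
    next
      case False
      let ?P = "\<lambda>I. left_ideal R I \<and> I \<noteq> {\<zero>} \<and> I \<subseteq> L"
      obtain S where S: "?P S" and min: "\<And>J. ?P J \<Longrightarrow> rank S \<le> rank J"
        using ex_has_least_nat[of ?P L rank] less.prems False by blast
      have simple: "simple_left_ideal R S"
        unfolding simple_left_ideal_def
      proof (intro conjI allI impI)
        fix J assume J: "left_ideal R J \<and> J \<subseteq> S"
        show "J = {\<zero>} \<or> J = S"
        proof (rule ccontr)
          assume n: "\<not> (J = {\<zero>} \<or> J = S)"
          then have "rank J < rank S" using J S by (intro rank) auto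
          moreover have "?P J" using J n S by auto
          ultimately show False using min by fastforce
        qed
      qed (use S in auto)
      obtain x y where "x \<in> S" "y \<in> S" "x \<otimes> y \<noteq> \<zero>"
        using semiprime S by blast
      then obtain e where e: "e \<in> S" "\<And>s. s \<in> S \<Longrightarrow> s \<otimes> e = s"
        using simple_left_ideal_right_identity[OF simple] by blast
      have ec: "e \<in> carrier R" using e(1) S L(1) by auto
      define C where "C = {x \<in> L. x \<otimes> e = \<zero>}"
      have C: "left_ideal R C" unfolding C_def by (rule left_ideal_annihilator[OF less.prems ec])
      have SC: "S \<inter> C = {\<zero>}"
        using e(2) left_idealD(2)[OF C] left_idealD(2)[of S] S by (auto simp: C_def)
      have "C \<noteq> L"
      proof
        assume "C = L"
        then have "S \<subseteq> {\<zero>}" using SC S by auto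
        then show False using S left_idealD(2)[of S] by auto
      qed
      then have "C \<subset> L" by (auto simp: C_def)
      from less.hyps[OF rank[OF C less.prems this] C]
      obtain F where F0: "(\<forall>I\<in>F. simple_left_ideal R I \<and> I \<subseteq> C) \<and> ?G (\<Union>F) = C
          \<and> (\<forall>I\<in>F. I \<inter> ?G (\<Union>(F - {I})) = {\<zero>})"
        by (rule exE)
      have F: "I \<in> F \<Longrightarrow> simple_left_ideal R I" "I \<in> F \<Longrightarrow> I \<subseteq> C" "?G (\<Union>F) = C"
        "I \<in> F \<Longrightarrow> I \<inter> ?G (\<Union>(F - {I})) = {\<zero>}" for I
        using F0 by simp_all
      have Cc: "C \<subseteq> carrier R" by (rule left_idealD(1)[OF C])
      have GC: "?G U \<subseteq> C" if "U \<subseteq> C" for U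
        using that by (rule add.generate_subgroup_incl) (rule left_idealD(6)[OF C])
      have Sg: "subgroup S (add_monoid R)" using left_idealD(6) S by blast
      have Sc: "S \<subseteq> carrier R" using S L(1) by auto
      have zero_in: "\<zero> \<in> ?G U" for U using generate.one[of "add_monoid R" U] by simp
      show ?thesis
      proof (intro exI[of _ "insert S F"] conjI ballI)
        fix I assume "I \<in> insert S F"
        then show "simple_left_ideal R I" "I \<subseteq> L" using simple F(1,2) S by (auto simp: C_def)
      next
        show "?G (\<Union>(insert S F)) = L"
        proof
          have "\<Union>(insert S F) \<subseteq> L" using S F(2) by (auto simp: C_def)
          then show "?G (\<Union>(insert S F)) \<subseteq> L"
            by (rule add.generate_subgroup_incl) (rule L(6))
          show "L \<subseteq> ?G (\<Union>(insert S F))"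
          proof
            fix x assume x: "x \<in> L"
            have xc: "x \<in> carrier R" using x L(1) by auto
            have ee: "e \<otimes> e = e" using e by blast
            have xe: "x \<otimes> e \<in> S" using left_idealD(5)[of S x e] S xc e(1) by blast
            have "(x \<ominus> x \<otimes> e) \<otimes> e = \<zero>"
              using xc ec ee by (simp add: a_minus_def l_distr l_minus m_assoc r_neg)
            then have d: "x \<ominus> x \<otimes> e \<in> C"
              using L(4)[OF x] xe S by (auto simp: C_def)
            have "x \<otimes> e \<in> ?G (\<Union>(insert S F))" using xe by (intro generate.incl) auto
            moreover have "x \<ominus> x \<otimes> e \<in> ?G (\<Union>(insert S F))"
            proof -
              have "?G (\<Union>F) \<subseteq> ?G (\<Union>(insert S F))"
                by (rule add.mono_generate) auto
              then show ?thesis using d F(3) by auto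
            qed
            ultimately have "x \<otimes> e \<oplus> (x \<ominus> x \<otimes> e) \<in> ?G (\<Union>(insert S F))"
              using generate.eng[of _ "add_monoid R"] by fastforce
            moreover have "x \<otimes> e \<oplus> (x \<ominus> x \<otimes> e) = x"
              using xc ec by (simp add: a_minus_def a_lcomm r_neg)
            ultimately show "x \<in> ?G (\<Union>(insert S F))" by simp
          qed
        qed
      next
        fix I assume I: "I \<in> insert S F"
        show "I \<inter> ?G (\<Union>(insert S F - {I})) = {\<zero>}"
        proof (cases "I = S")
          case True
          have "?G (\<Union>(insert S F - {I})) \<subseteq> C" using F(2) True by (intro GC) auto
          then show ?thesis using SC True zero_in left_idealD(2)[of S] S by blast
        next
          case False
          then have IF: "I \<in> F" using I by simp
          have eq: "\<Union>(insert S F - {I}) = S \<union> \<Union>(F - {I})" using False by auto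
          have "x = \<zero>" if x: "x \<in> I" "x \<in> ?G (\<Union>(insert S F - {I}))" for x
          proof -
            have "x \<in> S <+> ?G (\<Union>(F - {I}))"
              using generate_Un_subset[OF Sg, of "\<Union>(F - {I})"] x(2) F(2) Cc unfolding eq by blast
            then obtain s c where sc: "s \<in> S" "c \<in> ?G (\<Union>(F - {I}))" "x = s \<oplus> c"
              unfolding set_add_def' by auto
            have cC: "c \<in> C" using GC[of "\<Union>(F - {I})"] sc(2) F(2) by blast
            have xC: "x \<in> C" using x(1) F(2)[OF IF] by auto
            have cc: "s \<in> carrier R" "c \<in> carrier R" using sc(1) cC Sc Cc by auto
            have "x \<ominus> c = s" using cc sc(3) by (simp add: a_minus_def a_assoc r_neg)
            then have "s \<in> C" using left_idealD(4)[OF C xC cC] by simp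
            then have "s = \<zero>" using SC sc(1) by auto
            then have "x = c" using sc(3) cc by simp
            then show ?thesis using F(4)[OF IF] x(1) sc(2) by auto
          qed
          moreover have "\<zero> \<in> I" using left_idealD(2) simple_left_idealD(1)[OF F(1)[OF IF]] by blast
          ultimately show ?thesis using zero_in by blast
        qed
      qed
    qed
  qed
  have "left_ideal R (carrier R)" by (rule left_idealI) auto
  from decomposition[OF this] obtain F where
    "(\<forall>I\<in>F. simple_left_ideal R I \<and> I \<subseteq> carrier R) \<and> ?G (\<Union>F) = carrier R
      \<and> (\<forall>I\<in>F. I \<inter> ?G (\<Union>(F - {I})) = {\<zero>})"
    by (rule exE)
  then show ?thesis unfolding semisimple_ring_def by (intro exI[of _ F]) simp
qed

end


section \<open>The quotient algebra\<close>

lemma B_proj_eq_iff: "B_proj n a = B_proj n b \<longleftrightarrow> eqv n a b"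
proof
  have coset: "x \<in> B_proj n y \<longleftrightarrow> eqv n x y" for x y
    by (auto simp: B_proj_def a_r_coset_def' eqv_def algebra_simps) (metis diff_add_cancel)
  show "eqv n a b" if "B_proj n a = B_proj n b"
    using that coset[of a a] coset[of a b] by simp
  show "B_proj n a = B_proj n b" if "eqv n a b"
    using that coset eqv_trans eqv_sym by blast
qed

lemma carrier_B_alg: "carrier (B_alg n) = range (B_proj n)"
  by (auto simp: B_alg_simps FactRing_def A_RCOSETS_def' B_proj_def)

lemma B_proj_mult: "B_proj n a \<otimes>\<^bsub>B_alg n\<^esub> B_proj n b = B_proj n (a * b)"
  and B_proj_add: "B_proj n a \<oplus>\<^bsub>B_alg n\<^esub> B_proj n b = B_proj n (a + b)"
  using Ring.ring_hom_mult[OF B_proj_hom, of a b n] Ring.ring_hom_add[OF B_proj_hom, of a b n]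
  by (simp_all add: B_alg_simps)

lemma B_proj_smult: "c \<odot>\<^bsub>B_alg n\<^esub> B_proj n a = B_proj n (scalar c * a)"
  using Ring.ring_hom_mult[OF B_proj_hom, of "scalar c" a n] by (simp add: B_alg_simps)

lemma B_proj_closed: "B_proj n a \<in> carrier (B_alg n)"
  by (simp add: carrier_B_alg)

lemma zero_B_alg: "\<zero>\<^bsub>B_alg n\<^esub> = B_proj n 0"
proof -
  interpret R: ring "B_alg n" by (rule B_alg_ring)
  have "B_proj n 0 \<oplus>\<^bsub>B_alg n\<^esub> B_proj n 0 = B_proj n 0" by (simp add: B_proj_add)
  then show ?thesis using R.add.r_cancel_one' B_proj_closed by metis
qed

lemma B_proj_eq_zero_iff: "B_proj n a = \<zero>\<^bsub>B_alg n\<^esub> \<longleftrightarrow> a \<in> B_ideal n"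
  by (simp add: zero_B_alg B_proj_eq_iff eqv_0_iff)

lemma B_proj_sum:
  "finite A \<Longrightarrow> finsum (B_alg n) (\<lambda>i. B_proj n (f i)) A = B_proj n (sum f A)"
proof (induction A rule: finite_induct)
  case empty
  interpret R: ring "B_alg n" by (rule B_alg_ring)
  show ?case by (simp add: zero_B_alg)
next
  case (insert x A)
  interpret R: ring "B_alg n" by (rule B_alg_ring)
  show ?case using insert by (simp add: R.finsum_insert B_proj_closed B_proj_add)
qed


section \<open>The basis\<close>

lemma Sigma1_eq: "Sigma1 n = sigma1 ` index1 n"
  unfolding Sigma1_def sigma1_def index1_def by force

lemma Sigma2_eq: "Sigma2 n = sigma2 ` index2 n"
proof
  show "Sigma2 n \<subseteq> sigma2 ` index2 n"
  proof
    fix x assume "x \<in> Sigma2 n"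
    then consider i where "x = alt_from i X1 X0" "i \<le> 2 * n" | j where "x = alt_from j X0 X1" "1 \<le> j" "j \<le> 2 * n + 1"
      by (auto simp: Sigma2_def)
    then show "x \<in> sigma2 ` index2 n"
    proof cases
      case (1 i)
      then show ?thesis by (intro image_eqI[of _ _ "int i"]) (simp_all add: sigma2_def index2_def)
    next
      case (2 j)
      then show ?thesis by (intro image_eqI[of _ _ "- int j"]) (simp_all add: sigma2_def index2_def)
    qed
  qed
  show "sigma2 ` index2 n \<subseteq> Sigma2 n"
  proof
    fix x assume "x \<in> sigma2 ` index2 n"
    then obtain k where k: "k \<in> index2 n" "x = sigma2 k" by auto
    show "x \<in> Sigma2 n"
    proof (cases "0 \<le> k")
      case True
      then have "x = alt_from (nat k) X1 X0" "nat k \<le> 2 * n"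
        using k by (simp_all add: sigma2_def index2_def)
      then show ?thesis unfolding Sigma2_def by blast
    next
      case False
      then have "x = alt_from (nat (- k)) X0 X1" "1 \<le> nat (- k)" "nat (- k) \<le> 2 * n + 1"
        using k by (simp_all add: sigma2_def index2_def)
      then show ?thesis unfolding Sigma2_def by blast
    qed
  qed
qed

lemma Sigma_basis_eq: "Sigma_basis n = (\<lambda>i. B_proj n (sigma i)) ` index n"
proof -
  have "sigma ` index n = sigma1 ` index1 n \<union> sigma2 ` index2 n"
    unfolding index_def Plus_def image_Un image_image by (simp add: sigma_def)
  then show ?thesis
    unfolding Sigma_basis_def Sigma1_eq Sigma2_eq by (simp add: image_image[symmetric])
qed

text \<open>Two equal members of the family would give a nontrivial relation. This is what makes the basis a
  set of the expected cardinality.\<close>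

lemma sigma_inj: "inj_on (\<lambda>i. B_proj n (sigma i)) (index n)"
proof (rule inj_onI, rule ccontr)
  fix i j assume ij: "i \<in> index n" "j \<in> index n" "B_proj n (sigma i) = B_proj n (sigma j)" "i \<noteq> j"
  let ?c = "\<lambda>k. (if k = i then 1 else 0) - (if k = j then 1 else 0) :: ratfun"
  have "scalar (?c k) * sigma k = (if k = i then sigma i else 0) - (if k = j then sigma j else 0)" for k
    using ij(4) by (auto simp: scalar_minus)
  then have "(\<Sum>k\<in>index n. scalar (?c k) * sigma k) = sigma i - sigma j"
    using ij finite_index by (simp add: sum_subtractf)
  moreover have "sigma i - sigma j \<in> B_ideal n"
    using ij(3) by (simp add: B_proj_eq_iff eqv_def)
  ultimately have "(\<Sum>k\<in>index n. scalar (?c k) * sigma k) \<in> B_ideal n" by simp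
  from sigma_independent[OF this ij(1)] ij(4) show False by simp
qed

lemma card_index: "card (index n) = 2 * (2 * n + 1) + (2 * n + 1) ^ 2"
proof -
  have "card (index2 n) = 2 * (2 * n + 1)" by (simp add: index2_def)
  moreover have "card (index1 n) = (2 * n + 1) ^ 2"
    by (simp add: index1_def card_cartesian_product power2_eq_square)
  ultimately show ?thesis
    unfolding index_def by (simp add: card_Plus finite_index)
qed

lemma Sigma_basis_is_basis:
  assumes n: "n \<ge> 1"
  shows "vectorspace.basis (class_ring :: ratfun ring) (B_alg n) (Sigma_basis n)"
proof -
  interpret V: vectorspace "class_ring :: ratfun ring" "B_alg n" by (rule B_alg_vectorspace)
  let ?b = "\<lambda>i. B_proj n (sigma i)"
  have fin: "finite (Sigma_basis n)" by (simp add: Sigma_basis_eq finite_index)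
  have sub: "Sigma_basis n \<subseteq> carrier (B_alg n)"
    unfolding Sigma_basis_eq carrier_B_alg by auto
  have comb: "V.lincomb a (Sigma_basis n) = B_proj n (\<Sum>i\<in>index n. scalar (a (?b i)) * sigma i)" for a
  proof -
    have "V.lincomb a (Sigma_basis n) = finsum (B_alg n) (\<lambda>i. a (?b i) \<odot>\<^bsub>B_alg n\<^esub> ?b i) (index n)"
      unfolding V.lincomb_def Sigma_basis_eq
      by (rule V.finsum_reindex[OF _ sigma_inj]) (auto simp: B_proj_smult B_proj_closed)
    also have "\<dots> = B_proj n (\<Sum>i\<in>index n. scalar (a (?b i)) * sigma i)"
      by (simp only: B_proj_smult B_proj_sum[OF finite_index(3)])
    finally show ?thesis .
  qed
  have "V.lin_indpt (Sigma_basis n)"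
  proof (rule V.finite_lin_indpt2[OF fin sub])
    fix a assume "V.lincomb a (Sigma_basis n) = \<zero>\<^bsub>B_alg n\<^esub>"
    then have "(\<Sum>i\<in>index n. scalar (a (?b i)) * sigma i) \<in> B_ideal n"
      by (simp only: comb B_proj_eq_zero_iff)
    from sigma_independent[OF this] show "\<forall>v\<in>Sigma_basis n. a v = \<zero>\<^bsub>class_ring :: ratfun ring\<^esub>"
      by (auto simp: Sigma_basis_eq)
  qed
  moreover have "V.span (Sigma_basis n) = carrier (B_alg n)"
  proof
    show "V.span (Sigma_basis n) \<subseteq> carrier (B_alg n)" by (rule V.span_is_subset2[OF sub])
    show "carrier (B_alg n) \<subseteq> V.span (Sigma_basis n)"
    proof
      fix x assume "x \<in> carrier (B_alg n)"
      then obtain y where y: "x = B_proj n y" by (auto simp: carrier_B_alg)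
      obtain c where c: "eqv n y (\<Sum>i\<in>index n. scalar (c i) * sigma i)"
        using sigma_spans[OF n, of y] by (auto simp: combs_def)
      let ?a = "\<lambda>v. c (inv_into (index n) ?b v)"
      have "(\<Sum>i\<in>index n. scalar (?a (?b i)) * sigma i) = (\<Sum>i\<in>index n. scalar (c i) * sigma i)"
        by (intro sum.cong refl) (simp add: inv_into_f_f[OF sigma_inj])
      then have "V.lincomb ?a (Sigma_basis n) = x"
        unfolding comb y using c by (simp add: B_proj_eq_iff eqv_sym)
      then show "x \<in> V.span (Sigma_basis n)"
        unfolding V.finite_span[OF fin sub] by (intro CollectI exI[of _ ?a]) simp
    qed
  qed
  ultimately show ?thesis using sub by (simp add: V.basis_def)
qed


section \<open>Semisimplicity\<close>

text \<open>Left ideals are subspaces. The rank is the dimension, taken as the maximal size of an independent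
  subset, which a vector outside the smaller subspace enlarges.\<close>

lemma left_ideal_rank:
  assumes n: "n \<ge> 1"
  obtains rank :: "free_alg set set \<Rightarrow> nat" where
    "\<And>I J. left_ideal (B_alg n) I \<Longrightarrow> left_ideal (B_alg n) J \<Longrightarrow> I \<subset> J \<Longrightarrow> rank I < rank J"
proof -
  interpret R: ring "B_alg n" by (rule B_alg_ring)
  interpret V: vectorspace "class_ring :: ratfun ring" "B_alg n" by (rule B_alg_vectorspace)
  let ?P = "\<lambda>I k. \<exists>A. A \<subseteq> I \<and> V.lin_indpt A \<and> finite A \<and> card A = k"
  define rank where "rank I = (GREATEST k. ?P I k)" for I
  have fd: "V.fin_dim"
    using Sigma_basis_is_basis[OF n] finite_index unfolding V.fin_dim_def V.basis_def
    by (intro exI[of _ "Sigma_basis n"]) (simp add: Sigma_basis_eq)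
  have bounded: "k \<le> V.dim" if "?P I k" "I \<subseteq> carrier (B_alg n)" for I k
    using that V.li_le_dim(2)[OF fd] by blast
  have empty: "?P I 0" for I
    by (intro exI[of _ "{}"]) (auto simp: V.lin_dep_def)
  have "rank I < rank J" if I: "left_ideal (B_alg n) I" and J: "left_ideal (B_alg n) J" and IJ: "I \<subset> J" for I J
  proof -
    note Ic = R.left_idealD(1)[OF I] and Jc = R.left_idealD(1)[OF J]
    have "?P I (rank I)"
      unfolding rank_def
    proof (rule GreatestI_nat[where P = "?P I" and k = 0 and b = V.dim])
      show "?P I 0" by (rule empty)
    qed (use bounded Ic in blast)
    then obtain A where A: "A \<subseteq> I" "V.lin_indpt A" "finite A" "card A = rank I" by blast
    obtain x where x: "x \<in> J" "x \<notin> I" using IJ by auto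
    have "submodule (class_ring :: ratfun ring) I (B_alg n)"
    proof
      show "I \<subseteq> carrier (B_alg n)" by (rule Ic)
      show "\<zero>\<^bsub>B_alg n\<^esub> \<in> I" by (rule R.left_idealD(2)[OF I])
      show "v \<oplus>\<^bsub>B_alg n\<^esub> w \<in> I" if "v \<in> I" "w \<in> I" for v w
        by (rule R.left_idealD(3)[OF I that])
      show "c \<odot>\<^bsub>B_alg n\<^esub> v \<in> I" if v: "v \<in> I" for c v
      proof -
        obtain a where a: "v = B_proj n a" using v Ic by (auto simp: carrier_B_alg)
        have "c \<odot>\<^bsub>B_alg n\<^esub> v = B_proj n (scalar c) \<otimes>\<^bsub>B_alg n\<^esub> v"
          by (simp add: a B_proj_smult B_proj_mult)
        then show ?thesis using R.left_idealD(5)[OF I B_proj_closed v] by simp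
      qed
    qed
    then have "V.span A \<subseteq> I" by (rule V.span_is_subset[OF A(1)])
    then have "\<not> V.lin_dep (A \<union> {x})"
      using V.lin_dep_iff_in_span[of A x] A Ic Jc x by blast
    moreover have "card (A \<union> {x}) = Suc (rank I)" using A x by (subst Un_commute) (auto simp: card_insert_if)
    ultimately have "?P J (Suc (rank I))"
      using A x IJ by (intro exI[of _ "A \<union> {x}"]) auto
    then have "Suc (rank I) \<le> rank J"
      unfolding rank_def[of J]
      by (rule Greatest_le_nat[where P = "?P J" and b = V.dim]) (use bounded Jc in blast)
    then show ?thesis by simp
  qed
  then show ?thesis by (rule that)
qed

lemma B_alg_semisimple:
  assumes n: "n \<ge> 1"
  shows "semisimple_ring (B_alg n)"
proof -
  interpret R: ring "B_alg n" by (rule B_alg_ring)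
  obtain rank :: "free_alg set set \<Rightarrow> nat" where
    rank: "\<And>I J. left_ideal (B_alg n) I \<Longrightarrow> left_ideal (B_alg n) J \<Longrightarrow> I \<subset> J \<Longrightarrow> rank I < rank J"
    using left_ideal_rank[OF n] by blast
  show ?thesis
  proof (rule R.semisimple_if_semiprime[OF rank])
    fix L assume L: "left_ideal (B_alg n) L"
      and square: "\<And>x y. x \<in> L \<Longrightarrow> y \<in> L \<Longrightarrow> x \<otimes>\<^bsub>B_alg n\<^esub> y = \<zero>\<^bsub>B_alg n\<^esub>"
    let ?L = "{a. B_proj n a \<in> L}"
    have "a \<in> B_ideal n" if a: "a \<in> ?L" for a
    proof (rule no_square_zero_left_ideal[OF n _ _ a])
      show "x * a \<in> ?L" if "a \<in> ?L" for x a
        using R.left_idealD(5)[OF L B_proj_closed[of n x], of "B_proj n a"] that by (simp add: B_proj_mult)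
      show "x * y \<in> B_ideal n" if "x \<in> ?L" "y \<in> ?L" for x y
        using square[of "B_proj n x" "B_proj n y"] that by (simp add: B_proj_mult B_proj_eq_zero_iff)
    qed
    then have "L \<subseteq> {\<zero>\<^bsub>B_alg n\<^esub>}"
      using R.left_idealD(1)[OF L] by (auto simp: carrier_B_alg B_proj_eq_zero_iff[symmetric])
    then show "L = {\<zero>\<^bsub>B_alg n\<^esub>}" using R.left_idealD(2)[OF L] by auto
  qed
qed

theorem theorem3p4:
  fixes n :: nat
  assumes "n \<ge> 1"
  shows "semisimple_ring (B_alg n) \<and>
    vectorspace.basis (class_ring :: ratfun ring) (B_alg n) (Sigma_basis n) \<and>
    vectorspace.dim (class_ring :: ratfun ring) (B_alg n) = 2 * (2 * n + 1) + (2 * n + 1) ^ 2"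
proof (intro conjI)
  interpret V: vectorspace "class_ring :: ratfun ring" "B_alg n" by (rule B_alg_vectorspace)
  show "semisimple_ring (B_alg n)" by (rule B_alg_semisimple[OF assms])
  show basis: "V.basis (Sigma_basis n)" by (rule Sigma_basis_is_basis[OF assms])
  have "V.dim = card (Sigma_basis n)"
    by (rule V.dim_basis[OF _ basis]) (simp add: Sigma_basis_eq finite_index)
  also have "\<dots> = card (index n)"
    unfolding Sigma_basis_eq by (rule card_image[OF sigma_inj])
  finally show "V.dim = 2 * (2 * n + 1) + (2 * n + 1) ^ 2"
    by (simp only: card_index)
qed

end
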